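(* Let $\mathcal{B}=(\Gamma,\mathcal{E})$ be a Brocard porism of non-equilateral triangles. Recursive calculation of the second Brocard triangle, starting from the 3-periodics of $\mathcal{B}$, produces an infinite sequence of Brocard porisms $\mathcal{B}',\mathcal{B}'',\mathcal{B}''',\dots$ (the 3-periodics of each being the family containing the second Brocard triangles of the 3-periodics of the preceding one) such that: (i) the isodynamic points of all the porisms are stationary at the original $X_{15}$ and $X_{16}$; (ii) the Brocard circle of each new porism is contained within (the closed disk bounded by) the Brocard circle of its parent, forming an infinite nesting; (iii) both the circumradius and the eccentricity of the Brocard inellipse decrease monotonically along the sequence; (iv) the Brocard angle increases monotonically along the sequence and converges to $\pi/6$; (v) the sequence of porisms converges to the point $X_{15}$, i.e. the circumcircles and the inellipses of the porisms shrink to the point $X_{15}$.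
   Context: For a triangle $T=ABC$ with vertices labelled counterclockwise, the Brocard angle $\omega$ and Brocard points $\Omega_1,\Omega_2$ are defined by $\angle\Omega_1AB=\angle\Omega_1BC=\angle\Omega_1CA=\omega$ and $\angle\Omega_2BA=\angle\Omega_2CB=\angle\Omega_2AC=\omega$. One has $0<\omega\le\pi/6$, with $\omega=\pi/6$ exactly for equilateral triangles. $X_3$ is the circumcenter and $X_6$ the symmedian point. The Brocard circle $\mathcal{K}$ is the circle through $X_3,\Omega_1,\Omega_2$; it has $X_3X_6$ as a diameter. The Brocard inellipse $\mathcal{E}$ is the ellipse tangent to the three sides with foci $\Omega_1,\Omega_2$. The isodynamic points are the two common points of the three Apollonius circles of the triangle; $X_{15}$ (first) is the one inside the circumcircle and $X_{16}$ (second) is its inverse in the circumcircle. A Brocard porism is the pair $(\Gamma,\mathcal{E})$ of circumcircle and Brocard inellipse of a triangle; its 3-periodics are all triangles inscribed in $\Gamma$ and circumscribed about $\mathcal{E}$. All of them have the same circumradius, $\omega,\Omega_1,\Omega_2,X_3,X_6,X_{15},X_{16},\mathcal{K}$, so these are attributes of the porism. The second Brocard triangle $T'=A'B'C'$ of $T=ABC$: $A'$ is the intersection, other than $X_6$, of the line $AX_6$ with $\mathcal{K}$ (and $A'=X_6$ if the line is tangent to $\mathcal{K}$), similarly $B'$ and $C'$. *)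

theory Defs
  imports "HOL-Analysis.Analysis"
begin

text \<open>
  The Euclidean plane is \<^typ>\<open>complex\<close>. A triangle is the set of its three vertices; labellings
  are introduced only where a notion depends on them. (The map sending a triangle to its second
  Brocard triangle reverses the orientation of the labelling.) Circles and ellipses are point sets.
  The functions defined by a definite description are meaningful only where the object exists and
  is unique, e.g. the Brocard circle only for non-equilateral triangles.
\<close>

definition triangle :: "complex set \<Rightarrow> bool" where
  "triangle T \<longleftrightarrow> card T = 3 \<and> \<not> collinear T"

definition equilateral :: "complex set \<Rightarrow> bool" where
  "equilateral T \<longleftrightarrow> (\<exists>d. \<forall>A\<in>T. \<forall>B\<in>T. A \<noteq> B \<longrightarrow> dist A B = d)"

definition counterclockwise :: "complex \<Rightarrow> complex \<Rightarrow> complex \<Rightarrow> bool" where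
  "counterclockwise A B C \<longleftrightarrow> Im (cnj (B - A) * (C - A)) > 0"

text \<open>The unoriented angle at \<open>Q\<close>, in the range from \<open>0\<close> to \<open>pi\<close>.\<close>

definition angle :: "complex \<Rightarrow> complex \<Rightarrow> complex \<Rightarrow> real" where
  "angle P Q R = arccos (((P - Q) \<bullet> (R - Q)) / (norm (P - Q) * norm (R - Q)))"


subsection \<open>Circles and ellipses\<close>

definition circle_center :: "complex set \<Rightarrow> complex" where
  "circle_center S = (THE c. \<exists>r>0. S = sphere c r)"

definition circle_radius :: "complex set \<Rightarrow> real" where
  "circle_radius S = (THE r. r > 0 \<and> (\<exists>c. S = sphere c r))"

definition circle_through :: "complex set \<Rightarrow> complex set" where
  "circle_through X = (THE S. (\<exists>c. \<exists>r>0. S = sphere c r) \<and> X \<subseteq> S)"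

definition circle_inverse :: "complex set \<Rightarrow> complex \<Rightarrow> complex" where
  "circle_inverse S P =
     (let c = circle_center S; r = circle_radius S
      in c + ((r / dist P c)\<^sup>2) *\<^sub>R (P - c))"

text \<open>Foci \<open>F\<close>, \<open>G\<close> and semi-major axis \<open>a\<close>; a genuine ellipse if \<open>dist F G < 2 * a\<close>.\<close>

definition ellipse :: "complex \<Rightarrow> complex \<Rightarrow> real \<Rightarrow> complex set" where
  "ellipse F G a = {P. dist P F + dist P G = 2 * a}"

definition eccentricity :: "complex set \<Rightarrow> real" where
  "eccentricity E =
     (THE e. \<exists>F G a. dist F G < 2 * a \<and> E = ellipse F G a \<and> e = dist F G / (2 * a))"

text \<open>
  An ellipse is tangent to a line iff it meets it in exactly one point. The point of contact is
  required to lie on the side itself, so that the ellipse is inscribed and not escribed.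
\<close>

definition circumscribed :: "complex set \<Rightarrow> complex set \<Rightarrow> bool" where
  "circumscribed T E \<longleftrightarrow>
     (\<forall>A\<in>T. \<forall>B\<in>T. A \<noteq> B \<longrightarrow> (\<exists>P\<in>open_segment A B. E \<inter> affine hull {A, B} = {P}))"


subsection \<open>Triangle centers\<close>

definition circumcircle :: "complex set \<Rightarrow> complex set" where
  "circumcircle T = circle_through T"

definition circumcenter :: "complex set \<Rightarrow> complex" where
  "circumcenter T = circle_center (circumcircle T)"

definition centroid :: "complex set \<Rightarrow> complex" where
  "centroid T = (\<Sum>X\<in>T. X) / 3"

text \<open>
  The symmedians are the reflections of the medians in the internal angle bisectors; the
  symmedian point is their common point.
\<close>

definition symmedian_point :: "complex set \<Rightarrow> complex" where
  "symmedian_point T =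
     (THE P. P \<in> interior (convex hull T) \<and>
        (\<forall>A B C. T = {A, B, C} \<longrightarrow> angle P A B = angle (centroid T) A C))"

text \<open>
  Since angles are unoriented, the Brocard points are required to be inside the triangle. Exchanging
  the orientation of the labelling exchanges the two points.
\<close>

definition is_brocard1 :: "complex set \<Rightarrow> complex \<Rightarrow> real \<Rightarrow> bool" where
  "is_brocard1 T P \<omega> \<longleftrightarrow> P \<in> interior (convex hull T) \<and>
     (\<exists>A B C. T = {A, B, C} \<and> counterclockwise A B C \<and>
        angle P A B = \<omega> \<and> angle P B C = \<omega> \<and> angle P C A = \<omega>)"

definition is_brocard2 :: "complex set \<Rightarrow> complex \<Rightarrow> real \<Rightarrow> bool" where
  "is_brocard2 T P \<omega> \<longleftrightarrow> P \<in> interior (convex hull T) \<and>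
     (\<exists>A B C. T = {A, B, C} \<and> counterclockwise A B C \<and>
        angle P B A = \<omega> \<and> angle P C B = \<omega> \<and> angle P A C = \<omega>)"

definition brocard_angle :: "complex set \<Rightarrow> real" where
  "brocard_angle T = (THE \<omega>. (\<exists>P. is_brocard1 T P \<omega>) \<and> (\<exists>P. is_brocard2 T P \<omega>))"

definition brocard1 :: "complex set \<Rightarrow> complex" where
  "brocard1 T = (THE P. is_brocard1 T P (brocard_angle T))"

definition brocard2 :: "complex set \<Rightarrow> complex" where
  "brocard2 T = (THE P. is_brocard2 T P (brocard_angle T))"

definition brocard_circle :: "complex set \<Rightarrow> complex set" where
  "brocard_circle T = circle_through {circumcenter T, brocard1 T, brocard2 T}"

definition brocard_inellipse :: "complex set \<Rightarrow> complex set" where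
  "brocard_inellipse T =
     (THE E. (\<exists>a. dist (brocard1 T) (brocard2 T) < 2 * a \<and>
                E = ellipse (brocard1 T) (brocard2 T) a) \<and> circumscribed T E)"

text \<open>
  The Apollonius circle through \<open>A\<close>: the locus of the points whose distances to \<open>B\<close> and \<open>C\<close> have
  the same ratio as those of \<open>A\<close> (a line if \<open>dist A B = dist A C\<close>).
\<close>

definition apollonius_circle :: "complex \<Rightarrow> complex \<Rightarrow> complex \<Rightarrow> complex set" where
  "apollonius_circle A B C = {P. dist P B * dist A C = dist P C * dist A B}"

definition isodynamic_points :: "complex set \<Rightarrow> complex set" where
  "isodynamic_points T = \<Inter> {apollonius_circle A B C | A B C. T = {A, B, C}}"

definition isodynamic1 :: "complex set \<Rightarrow> complex" where
  "isodynamic1 T =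
     (THE P. P \<in> isodynamic_points T \<and> P \<in> ball (circumcenter T) (circle_radius (circumcircle T)))"

definition isodynamic2 :: "complex set \<Rightarrow> complex" where
  "isodynamic2 T = circle_inverse (circumcircle T) (isodynamic1 T)"


subsection \<open>The second Brocard triangle\<close>

definition second_brocard_vertex :: "complex set \<Rightarrow> complex \<Rightarrow> complex" where
  "second_brocard_vertex T A =
     (let K = brocard_circle T; S = symmedian_point T; l = affine hull {A, S}
      in if K \<inter> l = {S} then S else (THE P. P \<in> K \<inter> l \<and> P \<noteq> S))"

definition second_brocard_triangle :: "complex set \<Rightarrow> complex set" where
  "second_brocard_triangle T = second_brocard_vertex T ` T"


subsection \<open>Brocard porisms\<close>

text \<open>A porism is given by its pair of outer circle and inner ellipse.\<close>

type_synonym porism = "complex set \<times> complex set"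

definition porism_of :: "complex set \<Rightarrow> porism" where
  "porism_of T = (circumcircle T, brocard_inellipse T)"

definition brocard_porism :: "porism \<Rightarrow> bool" where
  "brocard_porism \<B> \<longleftrightarrow> (\<exists>T. triangle T \<and> \<B> = porism_of T)"

definition three_periodics :: "porism \<Rightarrow> complex set set" where
  "three_periodics \<B> = {T. triangle T \<and> T \<subseteq> fst \<B> \<and> circumscribed T (snd \<B>)}"

text \<open>The common value of a triangle function on all 3-periodics of a porism.\<close>

definition porism_attribute :: "(complex set \<Rightarrow> 'a) \<Rightarrow> porism \<Rightarrow> 'a" where
  "porism_attribute f \<B> = (THE x. \<forall>T\<in>three_periodics \<B>. f T = x)"

abbreviation "porism_circumradius \<B> \<equiv> circle_radius (fst \<B>)"
abbreviation "porism_eccentricity \<B> \<equiv> eccentricity (snd \<B>)"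
abbreviation "porism_brocard_angle \<equiv> porism_attribute brocard_angle"
abbreviation "porism_brocard_circle \<equiv> porism_attribute brocard_circle"
abbreviation "porism_isodynamic_points \<equiv> porism_attribute isodynamic_points"
abbreviation "porism_X15 \<equiv> porism_attribute isodynamic1"
abbreviation "porism_X16 \<equiv> porism_attribute isodynamic2"

definition nonequilateral_brocard_porism :: "porism \<Rightarrow> bool" where
  "nonequilateral_brocard_porism \<B> \<longleftrightarrow>
     brocard_porism \<B> \<and> (\<forall>T\<in>three_periodics \<B>. \<not> equilateral T)"

text \<open>
  The recursion step: the second Brocard triangles of the 3-periodics of \<open>\<B>\<close> all have \<open>\<B>'\<close> as
  their porism and belong to its family of 3-periodics.
\<close>

definition second_brocard_successor :: "porism \<Rightarrow> porism \<Rightarrow> bool" where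
  "second_brocard_successor \<B> \<B>' \<longleftrightarrow>
     (\<forall>T\<in>three_periodics \<B>.
        triangle (second_brocard_triangle T) \<and>
        porism_of (second_brocard_triangle T) = \<B>' \<and>
        second_brocard_triangle T \<in> three_periodics \<B>')"

end

theory Submission
  imports Defs
begin

text \<open>
  Every triangle consists of the points \<open>p + q * m\<^sub>s (zeta ^ k * a)\<close>, where \<open>zeta\<close> is a primitive cube root
  of unity, \<open>cmod a = 1\<close> and \<open>m\<^sub>s w = (w + s) / (1 + s * w)\<close> with \<open>0 \<le> s < 1\<close> preserves the unit circle;
  it is equilateral iff \<open>s = 0\<close>. The circumcircle is \<open>sphere p (cmod q)\<close>, the isodynamic points are the
  images \<open>p + q * s\<close> and \<open>p + q / s\<close> of \<open>0\<close> and \<open>\<infinity>\<close>, the Brocard points and \<open>X\<^sub>6\<close> are the images of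
  \<open>- zeta\<^sup>2 * s\<close>, \<open>- zeta * s\<close> and \<open>s\<close>. None of them depends on \<open>a\<close>, so rotating \<open>a\<close> sweeps out the
  3-periodics of the porism. There are no others, because a point of the circumcircle is on only two
  tangents of the inellipse.

  The second Brocard triangle has the parameters \<open>p + q * \<rho>\<close>, \<open>q * \<rho>\<close>, \<open>s\<^sup>2\<close>, \<open>- a\<^sup>2\<close> with
  \<open>\<rho> = s / (1 + s\<^sup>2) < 1 / 2\<close>. Both isodynamic points are invariant under this substitution, the
  radius \<open>cmod q\<close> is more than halved, and \<open>s\<close> tends to \<open>0\<close>; the cotangent
  \<open>sqrt 3 * (1 + s\<^sup>2) / (1 - s\<^sup>2)\<close> of the Brocard angle and the squared eccentricity
  \<open>3 * s\<^sup>2 / (1 + s\<^sup>2 + s ^ 4)\<close> are increasing functions of \<open>s\<close>.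
\<close>

subsection \<open>Oriented area, circles and angles\<close>

text \<open>An Apollonius circle says that a cross ratio has modulus 1, a condition kept by Moebius
  maps; in the equilateral model the three circles become the symmetry axes, which meet in 0 and
  infinity. The Brocard points, \<open>X6\<close> and the inellipse are not Moebius notions. For
  them everything rests on one identity: for consecutive vertices \<open>A\<close>, \<open>B\<close>
  the quotient of \<open>Om1 - A\<close> by \<open>B - A\<close> is a positive real times a constant
  \<open>kappa\<close> that is independent of \<open>a\<close>. It yields the common angle, the
  positions inside the triangle and the tangency of the sides. The substitution for the second
  Brocard triangle squares the parameters because the direction \<open>d\<close> of a symmedian
  enters only through \<open>d / cnj d\<close>. The new circumcircle is the old Brocard circle, and
  both isodynamic points survive because \<open>rho * (1 + s^2) = s\<close>. Since all notions are
  descriptions over unlabelled vertex sets, each needs existence, uniqueness and independence of the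
  labelling. Uniqueness is obtained by making the conditions algebraic: angles become cotangents,
  ellipses become quadratics along a line.\<close>

definition orient :: "complex \<Rightarrow> complex \<Rightarrow> complex \<Rightarrow> real" where
  "orient A B C = Im (cnj (B - A) * (C - A))"

lemma counterclockwise_iff: "counterclockwise A B C \<longleftrightarrow> orient A B C > 0"
  by (simp add: counterclockwise_def orient_def)

lemma orient_swap: "orient A C B = - orient A B C" "orient B A C = - orient A B C"
  by (simp_all add: orient_def algebra_simps)

lemma orient_sum: "orient A B P + orient B C P + orient C A P = orient A B C"
  by (simp add: orient_def algebra_simps)

lemma collinear_iff_orient: "collinear {A, B, C} \<longleftrightarrow> orient A B C = 0"
proof (cases "A = B")
  case True
  then show ?thesis by (simp add: orient_def)
next
  case False
  have "collinear {A, B, C} \<longleftrightarrow> collinear {0, A - B, C - B}"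
    by (rule collinear_3) simp
  also have "\<dots> \<longleftrightarrow> (C - B) / (A - B) \<in> \<real>"
    by (rule collinear_iff_Reals)
  also have "\<dots> \<longleftrightarrow> Im ((C - B) / (A - B)) = 0"
    by (simp add: complex_is_Real_iff)
  also have "\<dots> \<longleftrightarrow> orient A B C = 0"
  proof -
    have "(C - B) / (A - B) = ((C - B) * cnj (A - B)) / of_real ((cmod (A - B))\<^sup>2)"
      using complex_div_cnj[of "C - B" "A - B"] by simp
    then have "Im ((C - B) / (A - B)) = Im ((C - B) * cnj (A - B)) / (cmod (A - B))\<^sup>2"
      by (metis Im_divide_of_real)
    also have "Im ((C - B) * cnj (A - B)) = - orient A B C"
      by (simp add: orient_def algebra_simps)
    finally show ?thesis using False by simp
  qed
  finally show ?thesis .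
qed

text \<open>\<open>orient\<close> is twice the signed area, so the quotients by
  \<open>orient A B C\<close> are the barycentric coordinates of \<open>P\<close>. Products instead
  of quotients serve both orientations.\<close>

lemma interior_triangle_iff:
  assumes "orient A B C \<noteq> 0"
  shows "P \<in> interior (convex hull {A, B, C}) \<longleftrightarrow>
    orient A B C * orient A B P > 0 \<and> orient A B C * orient B C P > 0 \<and>
    orient A B C * orient C A P > 0"
    (is "?L \<longleftrightarrow> ?R")
proof -
  let ?D = "orient A B C"
  have hull: "?L \<longleftrightarrow> (\<exists>x y z. 0 < x \<and> 0 < y \<and> 0 < z \<and> x + y + z = 1 \<and>
      x *\<^sub>R A + y *\<^sub>R B + z *\<^sub>R C = P)"
    using assms by (subst interior_convex_hull_3_minimal) (auto simp: collinear_iff_orient)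
  show ?thesis
  proof
    assume ?L
    then obtain x y z where pos: "0 < x" "0 < y" "0 < z" and "x + y + z = 1"
      and P: "x *\<^sub>R A + y *\<^sub>R B + z *\<^sub>R C = P"
      unfolding hull by blast
    then have x: "x = 1 - y - z" by simp
    have "orient A B P = z * ?D" "orient B C P = x * ?D" "orient C A P = y * ?D"
      unfolding P[symmetric] unfolding x orient_def by (simp_all add: algebra_simps)
    moreover have "?D * ?D > 0"
      using assms by (auto simp: zero_less_mult_iff)
    ultimately show ?R
      using pos by (simp add: mult.left_commute[of ?D])
  next
    assume R: ?R
    let ?x = "orient B C P / ?D" and ?y = "orient C A P / ?D" and ?z = "orient A B P / ?D"
    have "?x + ?y + ?z = 1"
      using orient_sum[of A B P C] assms by (simp add: field_simps)
    moreover have "?x > 0" "?y > 0" "?z > 0"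
      using R by (auto simp: zero_less_mult_iff zero_less_divide_iff)
    moreover have "?x *\<^sub>R A + ?y *\<^sub>R B + ?z *\<^sub>R C = P"
    proof -
      have "orient B C P *\<^sub>R A + orient C A P *\<^sub>R B + orient A B P *\<^sub>R C = ?D *\<^sub>R P"
        unfolding orient_def by (simp add: complex_eq_iff) (simp add: algebra_simps)
      then have "(1 / ?D) *\<^sub>R (orient B C P *\<^sub>R A + orient C A P *\<^sub>R B + orient A B P *\<^sub>R C) = P"
        using assms by simp
      then show ?thesis by (simp add: scaleR_add_right)
    qed
    ultimately show ?L unfolding hull by blast
  qed
qed

text \<open>The lines \<open>A S\<close> and \<open>B S\<close> are distinct and meet only in
  \<open>S\<close>. Brocard and symmedian points are both pinned down in this way.\<close>

lemma intersection_of_cevians: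
  assumes "orient A B S \<noteq> 0" "P - A = of_real t * (S - A)" "P - B = of_real r * (S - B)"
  shows "P = S"
proof -
  have P: "P = A + of_real t * (S - A)"
    using assms(2) by (simp add: algebra_simps)
  have "A + of_real t * (S - A) - B = of_real r * (S - B)"
    using assms(3) P by simp
  then have "Im (cnj (S - B) * (A + of_real t * (S - A) - B)) = 0"
    by (simp only:) (simp add: algebra_simps)
  moreover have "Im (cnj (S - B) * (A + of_real t * (S - A) - B)) = (1 - t) * orient A B S"
    by (simp add: orient_def algebra_simps)
  ultimately have "t = 1" using assms(1) by simp
  with P show ?thesis by simp
qed

section \<open>Circles recovered from their point sets\<close>

lemma power2_dist_complex: "(dist a b)\<^sup>2 = (Re a - Re b)\<^sup>2 + (Im a - Im b)\<^sup>2"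
  by (simp add: dist_norm cmod_power2)

lemma sphere_eq_sphere_iff:
  fixes c c' :: complex
  assumes "r > 0" "r' > 0" "sphere c r = sphere c' r'"
  shows "c = c'" "r = r'"
proof -
  have "c + of_real r * e \<in> sphere c' r'" if "cmod e = 1" for e
    unfolding assms(3)[symmetric] using assms(1) that by (simp add: dist_norm norm_mult)
  then have *: "(dist c' (c + of_real r * e))\<^sup>2 = r'\<^sup>2" if "cmod e = 1" for e
    using that by simp
  show "c = c'"
  proof -
    \<comment> \<open>The four extreme points of the first circle lie on the second; subtracting the
      equations of opposite points gives linear ones.\<close>
    have "(Re c' - (Re c + r))\<^sup>2 + (Im c' - Im c)\<^sup>2 = r'\<^sup>2"
      "(Re c' - (Re c - r))\<^sup>2 + (Im c' - Im c)\<^sup>2 = r'\<^sup>2"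
      "(Re c' - Re c)\<^sup>2 + (Im c' - (Im c + r))\<^sup>2 = r'\<^sup>2"
      "(Re c' - Re c)\<^sup>2 + (Im c' - (Im c - r))\<^sup>2 = r'\<^sup>2"
      using *[of 1] *[of "-1"] *[of \<i>] *[of "-\<i>"] unfolding power2_dist_complex by simp_all
    then have "r * (Re c - Re c') = 0" "r * (Im c - Im c') = 0"
      by algebra+
    then show ?thesis using assms(1) by (simp add: complex_eq_iff)
  qed
  then show "r = r'"
    using *[of 1] assms(1,2) by (simp add: dist_norm)
qed

lemma circle_center_sphere [simp]: "r > 0 \<Longrightarrow> circle_center (sphere c r) = c"
  unfolding circle_center_def using sphere_eq_sphere_iff by blast

lemma circle_radius_sphere [simp]: "r > 0 \<Longrightarrow> circle_radius (sphere c r) = r"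
  unfolding circle_radius_def using sphere_eq_sphere_iff by blast

lemma circle_through_three:
  assumes "orient A B C \<noteq> 0" "r > 0" "{A, B, C} \<subseteq> sphere c r"
  shows "circle_through {A, B, C} = sphere c r"
  unfolding circle_through_def
proof (rule the_equality)
  show "(\<exists>c'. \<exists>r'>0. sphere c r = sphere c' r') \<and> {A, B, C} \<subseteq> sphere c r"
    using assms by blast
next
  fix S assume "(\<exists>c. \<exists>r>0. S = sphere c r) \<and> {A, B, C} \<subseteq> S"
  then obtain c' r' where S: "S = sphere c' r'" "r' > 0" "{A, B, C} \<subseteq> sphere c' r'"
    by blast
  have 1: "(dist c A)\<^sup>2 = r\<^sup>2" "(dist c B)\<^sup>2 = r\<^sup>2" "(dist c C)\<^sup>2 = r\<^sup>2"
    and 2: "(dist c' A)\<^sup>2 = r'\<^sup>2" "(dist c' B)\<^sup>2 = r'\<^sup>2" "(dist c' C)\<^sup>2 = r'\<^sup>2"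
    using assms S by auto
  define u v where "u = Re c - Re c'" and "v = Im c - Im c'"
  \<comment> \<open>Subtracting the equations of the two circles makes the difference of the centers
    orthogonal to two independent sides.\<close>
  have "u * (Re B - Re A) + v * (Im B - Im A) = 0" "u * (Re C - Re A) + v * (Im C - Im A) = 0"
    using 1 2 unfolding power2_dist_complex u_def v_def by algebra+
  then have "u * orient A B C = 0" "v * orient A B C = 0"
    unfolding orient_def by (simp_all, algebra+)
  then have "c = c'"
    using assms(1) by (simp add: u_def v_def complex_eq_iff)
  moreover from this have "r = r'"
    using assms S by auto
  ultimately show "S = sphere c r" using S by simp
qed

text \<open>The right-hand side is the arc cotangent, so equality of angles becomes equality of
  cotangents. The absolute value reflects that angles are unoriented.\<close>

lemma angle_eq_arctan:
  assumes "w = (P - Q) * cnj (R - Q)" "Im w \<noteq> 0"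
  shows "angle P Q R = pi / 2 - arctan (Re w / \<bar>Im w\<bar>)"
proof -
  have nz: "w \<noteq> 0" using assms(2) by auto
  have "(P - Q) \<bullet> (R - Q) = Re w" "norm (P - Q) * norm (R - Q) = cmod w"
    unfolding assms(1) by (simp_all add: inner_complex_def norm_mult flip: complex_cnj_diff)
      (simp add: algebra_simps)
  then have "angle P Q R = arccos (Re w / cmod w)" by (simp add: angle_def)
  also have "\<dots> = pi / 2 - arcsin (Re w / cmod w)"
    using abs_Re_le_cmod[of w] nz
    by (intro arccos_arcsin_eq) (auto simp: field_simps abs_le_iff)
  also have "arcsin (Re w / cmod w) = arctan (Re w / \<bar>Im w\<bar>)"
  proof (rule arcsin_unique)
    have c: "cmod w = \<bar>Im w\<bar> * sqrt (1 + (Re w / \<bar>Im w\<bar>)\<^sup>2)"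
    proof -
      have "\<bar>Im w\<bar> * sqrt (1 + (Re w / \<bar>Im w\<bar>)\<^sup>2) = sqrt ((Im w)\<^sup>2 * (1 + (Re w / \<bar>Im w\<bar>)\<^sup>2))"
        by (simp add: real_sqrt_mult)
      also have "(Im w)\<^sup>2 * (1 + (Re w / \<bar>Im w\<bar>)\<^sup>2) = (Re w)\<^sup>2 + (Im w)\<^sup>2"
        using assms(2) by (simp add: field_simps)
      finally show ?thesis by (simp add: cmod_def)
    qed
    show "sin (arctan (Re w / \<bar>Im w\<bar>)) = Re w / cmod w"
      unfolding sin_arctan c by simp
  qed (use arctan_bounded[of "Re w / \<bar>Im w\<bar>"] in auto)
  finally show ?thesis .
qed

text \<open>Both numbers lie in the same open half-plane, where the cotangent determines the
  ray.\<close>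

lemma positive_multiple_iff:
  assumes "Im w * Im v > 0"
  shows "Re w / \<bar>Im w\<bar> = Re v / \<bar>Im v\<bar> \<longleftrightarrow> (\<exists>t>0. w = of_real t * v)"
proof
  assume *: "Re w / \<bar>Im w\<bar> = Re v / \<bar>Im v\<bar>"
  have "w = of_real (\<bar>Im w\<bar> / \<bar>Im v\<bar>) * v"
    using * assms by (auto simp: complex_eq_iff zero_less_mult_iff field_simps)
  moreover have "\<bar>Im w\<bar> / \<bar>Im v\<bar> > 0" using assms by (auto simp: zero_less_mult_iff intro: divide_pos_neg divide_neg_neg)
  ultimately show "\<exists>t>0. w = of_real t * v" by blast
next
  assume "\<exists>t>0. w = of_real t * v"
  then show "Re w / \<bar>Im w\<bar> = Re v / \<bar>Im v\<bar>"
    by (auto simp: abs_mult)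
qed

subsection \<open>Ellipses\<close>

text \<open>The difference of the two sides splits as in Heron's formula into
  \<open>x + y - 2 * a\<close> and three factors that the triangle inequality makes positive. The
  fourth powers cancel along a line, which leaves a quadratic.\<close>

lemma ellipse_iff_quadratic:
  assumes "dist F G < 2 * a"
  shows "P \<in> ellipse F G a \<longleftrightarrow>
    16 * a\<^sup>2 * (dist P F)\<^sup>2 = (4 * a\<^sup>2 + (dist P F)\<^sup>2 - (dist P G)\<^sup>2)\<^sup>2"
proof -
  define x y where "x = dist P F" and "y = dist P G"
  have pos: "2 * a - x + y > 0" "2 * a + x - y > 0" "2 * a + x + y > 0"
    using assms dist_triangle2[of F G P] dist_triangle[of P F G] dist_triangle[of P G F]
      zero_le_dist[of F G] zero_le_dist[of P F] zero_le_dist[of P G] dist_commute[of F G]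
    by (auto simp: x_def y_def dist_commute[of P])
  have "16 * a\<^sup>2 * x\<^sup>2 - (4 * a\<^sup>2 + x\<^sup>2 - y\<^sup>2)\<^sup>2 =
      (x + y - 2 * a) * ((2 * a - x + y) * ((2 * a + x - y) * (2 * a + x + y)))"
    by algebra
  then have "16 * a\<^sup>2 * x\<^sup>2 = (4 * a\<^sup>2 + x\<^sup>2 - y\<^sup>2)\<^sup>2 \<longleftrightarrow> x + y - 2 * a = 0"
    using pos by auto
  then show ?thesis by (simp add: ellipse_def x_def y_def)
qed

lemma quadratic_unique_root_iff:
  fixes \<alpha> \<beta> \<gamma> t :: real
  assumes "\<alpha> > 0" "\<alpha> * t\<^sup>2 + \<beta> * t + \<gamma> = 0"
  shows "(\<forall>r. \<alpha> * r\<^sup>2 + \<beta> * r + \<gamma> = 0 \<longrightarrow> r = t) \<longleftrightarrow> \<beta>\<^sup>2 = 4 * \<alpha> * \<gamma>"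
proof
  assume *: "\<forall>r. \<alpha> * r\<^sup>2 + \<beta> * r + \<gamma> = 0 \<longrightarrow> r = t"
  \<comment> \<open>The sum of the roots, so that \<open>u - t\<close> is the other root.\<close>
  define u where "u = - \<beta> / \<alpha>"
  have \<beta>: "\<beta> = - \<alpha> * u" using assms(1) by (simp add: u_def)
  have "\<alpha> * (u - t)\<^sup>2 + \<beta> * (u - t) + \<gamma> = \<alpha> * t\<^sup>2 + \<beta> * t + \<gamma>"
    by (simp add: \<beta> power2_eq_square algebra_simps)
  then have "u - t = t" using *[rule_format, of "u - t"] assms(2) by simp
  then have u: "u = 2 * t" by simp
  have "\<gamma> = \<alpha> * t\<^sup>2" using assms(2) by (simp add: \<beta> u power2_eq_square algebra_simps)
  then show "\<beta>\<^sup>2 = 4 * \<alpha> * \<gamma>" by (simp add: \<beta> u power2_eq_square algebra_simps)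
next
  assume disc: "\<beta>\<^sup>2 = 4 * \<alpha> * \<gamma>"
  have "2 * \<alpha> * r + \<beta> = 0" if "\<alpha> * r\<^sup>2 + \<beta> * r + \<gamma> = 0" for r
  proof -
    have "(2 * \<alpha> * r + \<beta>)\<^sup>2 = 4 * \<alpha> * (\<alpha> * r\<^sup>2 + \<beta> * r + \<gamma>) + (\<beta>\<^sup>2 - 4 * \<alpha> * \<gamma>)"
      by (simp add: power2_eq_square algebra_simps)
    then have "(2 * \<alpha> * r + \<beta>)\<^sup>2 = 0" using that disc by simp
    then show ?thesis by simp
  qed
  then have "2 * \<alpha> * r = 2 * \<alpha> * t" if "\<alpha> * r\<^sup>2 + \<beta> * r + \<gamma> = 0" for r
    using that assms(2) by (smt (verit))
  then show "\<forall>r. \<alpha> * r\<^sup>2 + \<beta> * r + \<gamma> = 0 \<longrightarrow> r = t"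
    using assms(1) by simp
qed

text \<open>
  The right-hand side says that the product of the distances of the foci from the line is the
  square of the semi-minor axis.
\<close>

lemma ellipse_tangent_iff:
  assumes a: "dist F G < 2 * a" and "A \<noteq> B"
    and P: "P \<in> ellipse F G a" "P \<in> affine hull {A, B}"
  shows "ellipse F G a \<inter> affine hull {A, B} = {P} \<longleftrightarrow>
    (4 * a\<^sup>2 - (dist F G)\<^sup>2) * (dist A B)\<^sup>2 = 4 * orient A B F * orient A B G"
proof -
  define D where "D = B - A"
  define f where "f = F - A"
  define g where "g = G - A"
  define N where "N = (Re D)\<^sup>2 + (Im D)\<^sup>2"
  define \<phi> where "\<phi> = Re D * Re f + Im D * Im f"
  define \<psi> where "\<psi> = Re D * Re g + Im D * Im g"
  define X where "X = orient A B F"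
  define Y where "Y = orient A B G"
  define ff where "ff = (Re f)\<^sup>2 + (Im f)\<^sup>2"
  define gg where "gg = (Re g)\<^sup>2 + (Im g)\<^sup>2"
  have X: "X = Re D * Im f - Im D * Re f" and Y: "Y = Re D * Im g - Im D * Re g"
    by (simp_all add: X_def Y_def orient_def D_def f_def g_def algebra_simps)
  \<comment> \<open>Lagrange's identity: squared inner product plus squared area is the product of
    the squared lengths.\<close>
  have ff: "N * ff = \<phi>\<^sup>2 + X\<^sup>2" and gg: "N * gg = \<psi>\<^sup>2 + Y\<^sup>2"
    unfolding N_def ff_def gg_def \<phi>_def \<psi>_def X Y by (simp_all add: power2_eq_square algebra_simps)
  have NAB: "N = (dist A B)\<^sup>2"
    unfolding power2_dist_complex N_def D_def by (simp add: power2_eq_square algebra_simps)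
  have N: "N > 0" using \<open>A \<noteq> B\<close> by (simp add: NAB)
  have dFG: "N * (dist F G)\<^sup>2 = (\<phi> - \<psi>)\<^sup>2 + (X - Y)\<^sup>2"
  proof -
    have d: "(dist F G)\<^sup>2 = (Re f - Re g)\<^sup>2 + (Im f - Im g)\<^sup>2"
      by (simp add: power2_dist_complex f_def g_def)
    show ?thesis
      unfolding d N_def \<phi>_def \<psi>_def X Y by (simp add: power2_eq_square algebra_simps)
  qed
  have pos: "(dist F G)\<^sup>2 < 4 * a\<^sup>2"
    using power_strict_mono[OF a, of 2] by (simp add: power_mult_distrib)
  define m where "m = 4 * a\<^sup>2 + ff - gg"
  define \<alpha> where "\<alpha> = 16 * a\<^sup>2 * N - 4 * (\<phi> - \<psi>)\<^sup>2"
  define \<beta> where "\<beta> = - 32 * a\<^sup>2 * \<phi> + 4 * m * (\<phi> - \<psi>)"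
  define \<gamma> where "\<gamma> = 16 * a\<^sup>2 * ff - m\<^sup>2"
  have onE: "A + of_real t * D \<in> ellipse F G a \<longleftrightarrow> \<alpha> * t\<^sup>2 + \<beta> * t + \<gamma> = 0" for t
  proof -
    have d: "(dist (A + of_real t * D) F)\<^sup>2 = ff - 2 * t * \<phi> + t\<^sup>2 * N"
      "(dist (A + of_real t * D) G)\<^sup>2 = gg - 2 * t * \<psi> + t\<^sup>2 * N"
      unfolding power2_dist_complex ff_def gg_def N_def \<phi>_def \<psi>_def f_def g_def
      by (simp_all add: power2_eq_square algebra_simps)
    show ?thesis
      unfolding ellipse_iff_quadratic[OF a] d \<alpha>_def \<beta>_def \<gamma>_def m_def
      by (simp add: power2_eq_square algebra_simps)
  qed
  have line: "affine hull {A, B} = range (\<lambda>t. A + of_real t * D)"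
    by (simp add: affine_hull_2_alt D_def scaleR_conv_of_real)
  obtain t where t: "P = A + of_real t * D" using P(2) line by auto
  have "\<alpha> > 0"
  proof -
    have "(\<phi> - \<psi>)\<^sup>2 \<le> N * (dist F G)\<^sup>2" using dFG by simp
    also have "\<dots> < N * (4 * a\<^sup>2)" using pos N by (simp only: mult_less_cancel_left_pos)
    finally show ?thesis by (simp add: \<alpha>_def mult.commute)
  qed
  have "ellipse F G a \<inter> affine hull {A, B} = {P} \<longleftrightarrow>
      (\<forall>r. \<alpha> * r\<^sup>2 + \<beta> * r + \<gamma> = 0 \<longrightarrow> r = t)"
  proof -
    have "ellipse F G a \<inter> affine hull {A, B} = {P} \<longleftrightarrow>
        (\<forall>r. A + of_real r * D \<in> ellipse F G a \<longrightarrow> A + of_real r * D = P)"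
      using P unfolding line by blast
    also have "\<dots> \<longleftrightarrow> (\<forall>r. A + of_real r * D \<in> ellipse F G a \<longrightarrow> r = t)"
      using \<open>A \<noteq> B\<close> by (simp add: t D_def)
    finally show ?thesis by (simp add: onE)
  qed
  also have "\<dots> \<longleftrightarrow> \<beta>\<^sup>2 = 4 * \<alpha> * \<gamma>"
    using \<open>\<alpha> > 0\<close> P(1) by (intro quadratic_unique_root_iff) (simp_all add: onE[symmetric] t)
  also have "\<dots> \<longleftrightarrow> (4 * a\<^sup>2 - (dist F G)\<^sup>2) * N = 4 * X * Y"
  proof -
    \<comment> \<open>Multiplication by \<open>N\<close> eliminates \<open>ff\<close> and
      \<open>gg\<close>. The discriminant then splits into a positive factor and the difference of
      the two sides of the claim.\<close>
    define M where "M = N * m"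
    define k where "k = 4 * a\<^sup>2 * N"
    have M: "M = k + \<phi>\<^sup>2 + X\<^sup>2 - \<psi>\<^sup>2 - Y\<^sup>2"
    proof -
      have "N * m = 4 * a\<^sup>2 * N + N * ff - N * gg" by (simp add: m_def algebra_simps)
      then show ?thesis unfolding ff gg M_def k_def by simp
    qed
    have b: "N * \<beta> = - 8 * k * \<phi> + 4 * M * (\<phi> - \<psi>)" by (simp add: \<beta>_def M_def k_def algebra_simps)
    have c: "N\<^sup>2 * \<gamma> = 4 * k * (\<phi>\<^sup>2 + X\<^sup>2) - M\<^sup>2"
      unfolding \<gamma>_def M_def k_def ff[symmetric] by (simp add: power2_eq_square algebra_simps)
    have al: "\<alpha> = 4 * (k - (\<phi> - \<psi>)\<^sup>2)" by (simp add: \<alpha>_def k_def)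
    have e1: "k - (\<phi> - \<psi>)\<^sup>2 - (X - Y)\<^sup>2 = N * (4 * a\<^sup>2 - (dist F G)\<^sup>2)"
      unfolding right_diff_distrib dFG k_def by (simp add: algebra_simps)
    then have e2: "k - (\<phi> - \<psi>)\<^sup>2 - (X + Y)\<^sup>2 = N * (4 * a\<^sup>2 - (dist F G)\<^sup>2) - 4 * X * Y"
      by (simp add: power2_eq_square algebra_simps)
    have "N\<^sup>2 * (\<beta>\<^sup>2 - 4 * \<alpha> * \<gamma>) = (N * \<beta>)\<^sup>2 - 4 * \<alpha> * (N\<^sup>2 * \<gamma>)"
      by (simp add: power2_eq_square algebra_simps)
    also have "\<dots> = 16 * k * ((k - (\<phi> - \<psi>)\<^sup>2 - (X - Y)\<^sup>2) * (k - (\<phi> - \<psi>)\<^sup>2 - (X + Y)\<^sup>2))"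
      unfolding b c al M by (simp add: power2_eq_square algebra_simps)
    finally have "N\<^sup>2 * (\<beta>\<^sup>2 - 4 * \<alpha> * \<gamma>) = 16 * k * (N * (4 * a\<^sup>2 - (dist F G)\<^sup>2)) *
        ((4 * a\<^sup>2 - (dist F G)\<^sup>2) * N - 4 * X * Y)"
      unfolding e1 e2 by (simp add: mult_ac)
    moreover have "16 * k * (N * (4 * a\<^sup>2 - (dist F G)\<^sup>2)) > 0"
    proof -
      have "a\<^sup>2 > 0" using pos zero_le_power2[of "dist F G"] by linarith
      then show ?thesis using pos N by (simp add: k_def)
    qed
    ultimately have "\<beta>\<^sup>2 - 4 * \<alpha> * \<gamma> = 0 \<longleftrightarrow> (4 * a\<^sup>2 - (dist F G)\<^sup>2) * N - 4 * X * Y = 0"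
      using N by auto
    then show ?thesis by simp
  qed
  finally show ?thesis by (simp add: NAB X_def Y_def)
qed

text \<open>Symmetry about the center and the extreme distances from it (the two semi-axes) are
  visible in the point set alone, without reference to the foci.\<close>

lemma ellipse_center_extremes:
  assumes a: "dist F G < 2 * a" and c: "c = (F + G) / 2"
  shows "P \<in> ellipse F G a \<Longrightarrow> 2 * c - P \<in> ellipse F G a"
    and "P \<in> ellipse F G a \<Longrightarrow> dist P c \<le> a"
    and "\<exists>P\<in>ellipse F G a. dist P c = a"
    and "P \<in> ellipse F G a \<Longrightarrow> a\<^sup>2 - (dist F G / 2)\<^sup>2 \<le> (dist P c)\<^sup>2"
    and "\<exists>P\<in>ellipse F G a. (dist P c)\<^sup>2 = a\<^sup>2 - (dist F G / 2)\<^sup>2"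
proof -
  have c2: "2 * c = F + G" by (simp add: c)
  show "2 * c - P \<in> ellipse F G a" if "P \<in> ellipse F G a"
    using that unfolding ellipse_def c2 by (simp add: dist_norm norm_minus_commute add.commute)
  show "dist P c \<le> a" if "P \<in> ellipse F G a"
  proof -
    have "2 * dist P c = cmod (2 * (P - c))" by (simp only: dist_norm norm_mult) simp
    also have "2 * (P - c) = (P - F) + (P - G)" unfolding right_diff_distrib c2 by simp
    also have "cmod \<dots> \<le> dist P F + dist P G" unfolding dist_norm by (rule norm_triangle_ineq)
    finally show ?thesis using that by (simp add: ellipse_def)
  qed
  show "a\<^sup>2 - (dist F G / 2)\<^sup>2 \<le> (dist P c)\<^sup>2" if "P \<in> ellipse F G a"
  proof -
    \<comment> \<open>The parallelogram law for the median from \<open>P\<close> to the midpoint of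
      the foci.\<close>
    have "(dist P F)\<^sup>2 + (dist P G)\<^sup>2 = 2 * (dist P c)\<^sup>2 + 2 * (dist F G / 2)\<^sup>2"
      unfolding power_divide power2_dist_complex c by (simp add: power2_eq_square field_simps)
    moreover have "(dist P F)\<^sup>2 + (dist P G)\<^sup>2 = 2 * a\<^sup>2 + 2 * (dist P F - a)\<^sup>2"
    proof -
      have "dist P G = 2 * a - dist P F" using that by (simp add: ellipse_def)
      then show ?thesis by algebra
    qed
    ultimately show ?thesis using zero_le_power2[of "dist P F - a"] by linarith
  qed
  \<comment> \<open>A unit vector along the major axis; for a circle any direction will do.\<close>
  obtain e where e: "cmod e = 1" "G - F = of_real (dist F G) * e"
  proof (cases "F = G")
    case True
    then show ?thesis using that[of 1] by simp
  next
    case False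
    then show ?thesis
      using that[of "(G - F) / of_real (dist F G)"]
      by (simp add: dist_norm norm_divide norm_minus_commute)
  qed
  define f where "f = dist F G / 2"
  have f: "0 \<le> f" "f < a" using a by (simp_all add: f_def)
  have "G = F + of_real (2 * f) * e" using e(2) by (simp add: f_def algebra_simps)
  then have Gc: "G = c + of_real f * e" and Fc: "F = c - of_real f * e"
    unfolding c by (simp_all add: field_simps)
  have "c + of_real a * e \<in> ellipse F G a"
  proof -
    have "c + of_real a * e - F = of_real (a + f) * e" "c + of_real a * e - G = of_real (a - f) * e"
      by (simp_all add: Gc Fc algebra_simps)
    then have "dist (c + of_real a * e) F = \<bar>a + f\<bar>" "dist (c + of_real a * e) G = \<bar>a - f\<bar>"
      unfolding dist_norm by (simp_all only: norm_mult norm_of_real e(1) mult_1_right)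
    then show ?thesis using f by (simp add: ellipse_def)
  qed
  moreover have "dist (c + of_real a * e) c = a" using f e(1) by (simp add: dist_norm norm_mult)
  ultimately show "\<exists>P\<in>ellipse F G a. dist P c = a" by blast
  define b where "b = sqrt (a\<^sup>2 - f\<^sup>2)"
  have b: "b\<^sup>2 = a\<^sup>2 - f\<^sup>2" using f by (simp add: b_def power_mono)
  have "c + Complex 0 b * e \<in> ellipse F G a"
  proof -
    have "c + Complex 0 b * e - F = Complex f b * e" "c + Complex 0 b * e - G = Complex (- f) b * e"
      by (simp_all add: Gc Fc complex_eq_iff algebra_simps)
    then show ?thesis
      using f b by (simp add: ellipse_def dist_norm norm_mult e(1) complex_norm)
  qed
  moreover have "(dist (c + Complex 0 b * e) c)\<^sup>2 = b\<^sup>2"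
    using e(1) by (simp add: dist_norm norm_mult complex_norm)
  ultimately show "\<exists>P\<in>ellipse F G a. (dist P c)\<^sup>2 = a\<^sup>2 - (dist F G / 2)\<^sup>2"
    unfolding b f_def by blast
qed

text \<open>\<open>eccentricity\<close> ranges over all representations of the set as an ellipse, so
  the data entering it must be determined by the set.\<close>

lemma ellipse_eq_imp_eq_axes:
  assumes a: "dist F G < 2 * a" and a': "dist F' G' < 2 * a'"
    and eq: "ellipse F G a = ellipse F' G' a'"
  shows "a = a'" "dist F G = dist F' G'"
proof -
  define c where "c = (F + G) / 2"
  define c' where "c' = (F' + G') / 2"
  note E = ellipse_center_extremes[OF a c_def]
  note E' = ellipse_center_extremes[OF a' c'_def, folded eq]
  obtain P where P: "P \<in> ellipse F G a" using E(3) by blast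
  have "c = c'"
  proof (rule ccontr)
    assume "c \<noteq> c'"
    \<comment> \<open>Two point reflections with different centers compose to a nonzero translation,
      which a bounded nonempty set cannot admit.\<close>
    define v where "v = 2 * (c' - c)"
    have step: "Q + v \<in> ellipse F G a" if "Q \<in> ellipse F G a" for Q
    proof -
      have "2 * c' - (2 * c - Q) \<in> ellipse F G a" using E(1) E'(1) that by blast
      then show ?thesis by (simp add: v_def algebra_simps)
    qed
    have "P + of_nat n * v \<in> ellipse F G a" for n
    proof (induction n)
      case (Suc n)
      then show ?case using step[OF Suc] by (simp add: algebra_simps)
    qed (use P in simp)
    then have b: "dist (P + of_nat n * v) c \<le> a" for n using E(2) by blast
    have "cmod v > 0" using \<open>c \<noteq> c'\<close> by (simp add: v_def)
    then obtain n where "real n * cmod v > 2 * a" using reals_Archimedean3 by blast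
    moreover have "real n * cmod v = cmod (of_nat n * v)"
      by (simp add: norm_mult)
    moreover have "\<dots> \<le> dist (P + of_nat n * v) c + dist P c"
      using norm_triangle_ineq4[of "P + of_nat n * v - c" "P - c"]
      by (simp add: dist_norm)
    ultimately show False using b[of n] b[of 0] by simp
  qed
  note E' = E'[folded \<open>c = c'\<close>]
  show "a = a'"
  proof (rule order_antisym)
    show "a \<le> a'" using E(3) E'(2) by blast
    show "a' \<le> a" using E(2) E'(3) by blast
  qed
  have "(dist F G / 2)\<^sup>2 = (dist F' G' / 2)\<^sup>2"
  proof -
    have "a\<^sup>2 - (dist F G / 2)\<^sup>2 = a'\<^sup>2 - (dist F' G' / 2)\<^sup>2"
    proof (rule order_antisym)
      show "a\<^sup>2 - (dist F G / 2)\<^sup>2 \<le> a'\<^sup>2 - (dist F' G' / 2)\<^sup>2" using E(4) E'(5) by force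
      show "a'\<^sup>2 - (dist F' G' / 2)\<^sup>2 \<le> a\<^sup>2 - (dist F G / 2)\<^sup>2" using E(5) E'(4) by force
    qed
    with \<open>a = a'\<close> show ?thesis by simp
  qed
  then show "dist F G = dist F' G'" by simp
qed

lemma eccentricity_ellipse:
  assumes "dist F G < 2 * a"
  shows "eccentricity (ellipse F G a) = dist F G / (2 * a)"
  unfolding eccentricity_def
proof (rule the_equality)
  show "\<exists>F' G' a'. dist F' G' < 2 * a' \<and> ellipse F G a = ellipse F' G' a' \<and>
      dist F G / (2 * a) = dist F' G' / (2 * a')"
    using assms by blast
next
  fix e assume "\<exists>F' G' a'. dist F' G' < 2 * a' \<and> ellipse F G a = ellipse F' G' a' \<and>
      e = dist F' G' / (2 * a')"
  then show "e = dist F G / (2 * a)"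
    using ellipse_eq_imp_eq_axes[OF assms] by metis
qed

subsection \<open>Moebius images of an equilateral triangle\<close>

definition zeta :: complex where
  "zeta = Complex (- 1 / 2) (sqrt 3 / 2)"

lemma zeta_simps:
  "Re zeta = - 1 / 2" "Im zeta = sqrt 3 / 2" "cnj zeta = zeta\<^sup>2" "cmod zeta = 1"
  "Re (zeta\<^sup>2) = - 1 / 2" "Im (zeta\<^sup>2) = - sqrt 3 / 2"
  by (simp_all add: zeta_def complex_eq_iff power2_eq_square cmod_def field_simps)

lemma zeta_sum: "1 + zeta + zeta\<^sup>2 = 0"
  by (simp add: complex_eq_iff zeta_simps)

lemma zeta_cube: "zeta * zeta\<^sup>2 = 1" "zeta\<^sup>2 * zeta = 1" "zeta\<^sup>2 * zeta\<^sup>2 = zeta"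
  "zeta ^ 4 = zeta"
  using zeta_sum by algebra+

lemma zeta_neq: "zeta \<noteq> 1" "zeta\<^sup>2 \<noteq> 1" "zeta \<noteq> zeta\<^sup>2" "zeta \<noteq> 0"
  by (auto simp: complex_eq_iff zeta_simps)

lemma norm_zeta_minus_1: "(cmod (zeta - 1))\<^sup>2 = 3" "(cmod (zeta\<^sup>2 - zeta))\<^sup>2 = 3"
  by (simp_all add: cmod_power2 zeta_simps) (simp_all add: power2_eq_square field_simps)

section \<open>Moebius maps of the disc and the parametrized triangles\<close>

definition mob :: "real \<Rightarrow> complex \<Rightarrow> complex" where
  "mob s w = (w + of_real s) / (1 + of_real s * w)"

definition pt :: "complex \<Rightarrow> complex \<Rightarrow> real \<Rightarrow> complex \<Rightarrow> complex" where
  "pt p q s w = p + q * mob s w"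

definition tri :: "complex \<Rightarrow> complex \<Rightarrow> real \<Rightarrow> complex \<Rightarrow> complex set" where
  "tri p q s a = {pt p q s a, pt p q s (zeta * a), pt p q s (zeta\<^sup>2 * a)}"

lemma unit_cnj: "cmod a = 1 \<Longrightarrow> a * cnj a = 1"
  by (metis complex_norm_square of_real_1 power_one)

text \<open>Besides \<open>w - x\<close> the difference has one factor for each point, so that
  quotients of chords simplify to products.\<close>

lemma mob_diff:
  assumes "1 + of_real s * w \<noteq> 0" "1 + of_real s * x \<noteq> 0"
  shows "mob s w - mob s x =
    (w - x) * of_real (1 - s\<^sup>2) / ((1 + of_real s * w) * (1 + of_real s * x))"
  using assms by (simp add: mob_def divide_simps) (simp add: power2_eq_square algebra_simps)

lemma norm_mob:
  assumes "cmod w = 1" "\<bar>s\<bar> < 1"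
  shows "cmod (mob s w) = 1"
proof -
  have "w + of_real s = w * cnj (1 + of_real s * w)"
    using unit_cnj[OF assms(1)] by (simp add: algebra_simps)
  then have "cmod (w + of_real s) = cmod (1 + of_real s * w)"
    using assms(1) by (metis complex_mod_cnj mult_1 norm_mult)
  moreover have "1 + of_real s * w \<noteq> 0"
    using assms by (metis add_cancel_right_right add_eq_0_iff mult.right_neutral norm_minus_cancel
        norm_mult norm_of_real norm_one less_irrefl)
  ultimately show ?thesis by (simp add: mob_def norm_divide)
qed

lemma orient_ratio: "C - A = (B - A) * t \<Longrightarrow> orient A B C = (dist A B)\<^sup>2 * Im t"
  by (simp add: orient_def power2_dist_complex) (simp add: power2_eq_square algebra_simps)

text \<open>The equilateral case \<open>s = 0\<close> is included, so that the normal form covers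
  every triangle; \<open>moebius_porism\<close> excludes it later.\<close>

locale moebius_triangle =
  fixes p q :: complex and s :: real
  assumes q: "q \<noteq> 0" and s: "0 \<le> s" "s < 1"
begin

abbreviation "pnt \<equiv> pt p q s"

text \<open>The squared modulus of \<open>1 - s^2 * zeta\<close>, which is the value of
  \<open>W\<close> at the preimages of both Brocard points.\<close>

definition N :: real where "N = 1 + s\<^sup>2 + s ^ 4"

text \<open>
  This is \<open>1 / ((1 - zeta) * (1 - s\<^sup>2 * zeta\<^sup>2))\<close>, which is up to a positive factor the ratio of
  \<open>Om1 - A\<close> and \<open>B - A\<close> for consecutive vertices \<open>A\<close> and \<open>B\<close>: its argument is the Brocard angle.
\<close>

definition kappa :: complex where
  "kappa = Complex ((1 + s\<^sup>2) / (2 * N)) ((1 - s\<^sup>2) / (2 * sqrt 3 * N))"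

text \<open>Up to the factor \<open>1 - s^2\<close>, the reciprocal of the modulus of the derivative
  of \<open>mob s\<close> at \<open>a\<close>.\<close>

definition W :: "complex \<Rightarrow> real" where "W a = (cmod (1 + of_real s * a))\<^sup>2"

abbreviation "Om1 \<equiv> pnt (- zeta\<^sup>2 * of_real s)"
abbreviation "Om2 \<equiv> pnt (- zeta * of_real s)"

lemma s2: "0 \<le> s\<^sup>2" "s\<^sup>2 < 1" "0 < 1 - s\<^sup>2"
  using s by (simp_all add: power2_eq_square mult_left_le_one_le mult_less_cancel_left
      order_le_less_trans[OF mult_left_le])

lemma N_pos: "N > 0"
  unfolding N_def by (smt (verit) zero_le_power2 zero_le_power s(1))

lemma Im_kappa_pos: "Im kappa > 0"
  using N_pos s2 by (simp add: kappa_def)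

lemma denom_nz: "cmod w \<le> 1 \<Longrightarrow> 1 + of_real s * w \<noteq> 0"
proof
  assume w: "cmod w \<le> 1" and "1 + of_real s * w = 0"
  then have "of_real s * w = - 1" by (simp add: add_eq_0_iff)
  then have "s * cmod w = 1" using s by (metis abs_of_nonneg norm_minus_cancel norm_mult norm_of_real norm_one)
  moreover have "s * cmod w \<le> s" using w s by (simp add: mult_left_le)
  ultimately show False using s by simp
qed

lemma W_pos: "cmod a \<le> 1 \<Longrightarrow> W a > 0"
  using denom_nz by (simp add: W_def)

lemma norm_multiples [simp]:
  "cmod (zeta * a) = cmod a" "cmod (zeta\<^sup>2 * a) = cmod a" "cmod (zeta * (zeta * a)) = cmod a"
  by (simp_all add: norm_mult norm_power zeta_simps)

lemma norm_s_le [simp]: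
  "cmod (of_real s) \<le> 1" "cmod (- zeta * of_real s) \<le> 1" "cmod (- zeta\<^sup>2 * of_real s) \<le> 1"
  "cmod (- of_real s) \<le> 1"
  using s by (simp_all add: norm_mult norm_power zeta_simps)

lemma pnt_diff:
  assumes "cmod w \<le> 1" "cmod x \<le> 1"
  shows "pnt w - pnt x = q * (w - x) * of_real (1 - s\<^sup>2) / ((1 + of_real s * w) * (1 + of_real s * x))"
  using mob_diff[OF denom_nz denom_nz, OF assms]
  by (simp add: pt_def mult.assoc flip: right_diff_distrib)

lemma pnt_eq_iff: "cmod w \<le> 1 \<Longrightarrow> cmod x \<le> 1 \<Longrightarrow> pnt w = pnt x \<longleftrightarrow> w = x"
  using pnt_diff[of w x] denom_nz[of w] denom_nz[of x] q s2(3)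
  by (metis (no_types, lifting) divide_eq_0_iff eq_iff_diff_eq_0 less_irrefl mult_eq_0_iff of_real_eq_0_iff)

lemma dist_pnt:
  assumes "cmod w \<le> 1" "cmod x \<le> 1"
  shows "(dist (pnt w) (pnt x))\<^sup>2 = (cmod q)\<^sup>2 * (cmod (w - x))\<^sup>2 * (1 - s\<^sup>2)\<^sup>2 / (W w * W x)"
proof -
  have "dist (pnt w) (pnt x) = cmod q * cmod (w - x) * (1 - s\<^sup>2) /
      (cmod (1 + of_real s * w) * cmod (1 + of_real s * x))"
    unfolding dist_norm pnt_diff[OF assms] using s2 by (simp only: norm_mult norm_divide norm_of_real abs_of_pos)
  then show ?thesis by (simp add: W_def power_mult_distrib power_divide)
qed

lemma pnt_unit_in_circle: "cmod a = 1 \<Longrightarrow> pnt a \<in> sphere p (cmod q)"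
  using norm_mob[of a s] s by (simp add: pt_def dist_norm norm_mult)

lemma kappa: "kappa * ((1 - zeta) * (1 - of_real (s\<^sup>2) * zeta\<^sup>2)) = 1"
proof -
  have e: "(1 - zeta) * (1 - of_real (s\<^sup>2) * zeta\<^sup>2) = Complex (3 / 2 * (1 + s\<^sup>2)) (- sqrt 3 / 2 * (1 - s\<^sup>2))"
    by (simp add: complex_eq_iff zeta_simps field_simps)
  have "(1 + s\<^sup>2)\<^sup>2 * 3 + (1 - s\<^sup>2)\<^sup>2 = 4 * N"
    by (simp add: N_def power2_eq_square algebra_simps power4_eq_xxxx)
  moreover have "x / (2 * N) * (3 / 2 * x) + y / (2 * r * N) * (r / 2 * y) = (x\<^sup>2 * 3 + y\<^sup>2) / (4 * N)"
    if "r \<noteq> 0" for x y r :: real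
    using N_pos that by (simp add: field_simps power2_eq_square)
  ultimately have "(1 + s\<^sup>2) / (2 * N) * (3 / 2 * (1 + s\<^sup>2)) + (1 - s\<^sup>2) / (2 * sqrt 3 * N) * (sqrt 3 / 2 * (1 - s\<^sup>2)) = 1"
    using N_pos by (metis divide_self_if less_irrefl mult_eq_0_iff real_sqrt_eq_zero_cancel_iff zero_neq_numeral)
  moreover have "(1 - s\<^sup>2) / (2 * sqrt 3 * N) * (3 / 2 * (1 + s\<^sup>2)) = (1 + s\<^sup>2) / (2 * N) * (sqrt 3 / 2 * (1 - s\<^sup>2))"
  proof -
    have "y / (2 * r * N) * (r * r / 2 * x) = x / (2 * N) * (r / 2 * y)" if "r \<noteq> 0" for x y r :: real
      using N_pos that by (simp add: field_simps)
    moreover have "sqrt 3 \<noteq> 0" by simp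
    ultimately have "(1 - s\<^sup>2) / (2 * sqrt 3 * N) * (sqrt 3 * sqrt 3 / 2 * (1 + s\<^sup>2)) =
        (1 + s\<^sup>2) / (2 * N) * (sqrt 3 / 2 * (1 - s\<^sup>2))" by blast
    then show ?thesis by (simp only: real_sqrt_mult_self abs_numeral)
  qed
  ultimately show ?thesis unfolding e kappa_def by (simp add: complex_eq_iff)
qed

lemma W_unit: "cmod a = 1 \<Longrightarrow> of_real (W a) = (1 + of_real s * a) * (1 + of_real s * cnj a)"
  unfolding W_def by (simp add: complex_norm_square del: of_real_power)

text \<open>The real factor \<open>W (zeta * a)\<close> depends on the vertex, the argument of
  \<open>kappa\<close> does not: hence the three equal angles. The identity holds because
  \<open>a * cnj a = 1\<close> turns the denominator belonging to \<open>zeta * a\<close> into the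
  numerator \<open>a + s * zeta^2\<close> of \<open>Om1 - pnt a\<close>.\<close>

lemma Om1_side:
  assumes a: "cmod a = 1"
  shows "Om1 - pnt a = (pnt (zeta * a) - pnt a) * (of_real (W (zeta * a)) * kappa)"
proof -
  define k where "k = q * of_real (1 - s\<^sup>2) / (1 + of_real s * a)"
  have nz: "1 + of_real s * a \<noteq> 0" "1 + of_real s * (zeta * a) \<noteq> 0"
    "1 + of_real s * (- zeta\<^sup>2 * of_real s) \<noteq> 0"
    using a s by (intro denom_nz; simp)+
  have "(pnt (zeta * a) - pnt a) * (of_real (W (zeta * a)) * kappa) =
      k * ((zeta - 1) * kappa) * (a * (1 + of_real s * cnj (zeta * a)))"
    unfolding W_unit[OF trans[OF norm_multiples(1) a]] using a nz
    by (simp add: pnt_diff k_def divide_simps) (simp add: algebra_simps)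
  also have "a * (1 + of_real s * cnj (zeta * a)) = a + of_real s * zeta\<^sup>2 * (a * cnj a)"
    by (simp add: zeta_simps algebra_simps)
  also have "\<dots> = a + of_real s * zeta\<^sup>2" using unit_cnj[OF a] by simp
  also have "(zeta - 1) * kappa = - 1 / (1 + of_real s * (- zeta\<^sup>2 * of_real s))"
  proof -
    define d where "d = 1 + of_real s * (- zeta\<^sup>2 * of_real s)"
    have "kappa * ((1 - zeta) * d) = 1" using kappa by (simp add: d_def power2_eq_square mult_ac)
    moreover have "d \<noteq> 0" using nz(3) by (simp only: d_def not_False_eq_True)
    ultimately show ?thesis unfolding d_def[symmetric] by (subst eq_divide_eq) (simp add: algebra_simps)
  qed
  also have "k * (- 1 / (1 + of_real s * (- zeta\<^sup>2 * of_real s))) * (a + of_real s * zeta\<^sup>2) = Om1 - pnt a"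
  proof -
    define w where "w = - zeta\<^sup>2 * of_real s"
    define v where "v = w - a"
    have e: "a + of_real s * zeta\<^sup>2 = - v" by (simp add: v_def w_def)
    show ?thesis
      unfolding pnt_diff[OF norm_s_le(3) eq_refl[OF a]] e
      unfolding w_def[symmetric] k_def v_def[symmetric] by (simp add: mult_ac)
  qed
  finally show ?thesis by simp
qed

text \<open>The counterpart at the other end of the side: the same angle in the opposite sense,
  hence \<open>cnj kappa\<close>.\<close>

lemma Om2_side:
  assumes a: "cmod a = 1"
  shows "Om2 - pnt (zeta * a) = (pnt a - pnt (zeta * a)) * (of_real (W a) * cnj kappa)"
proof -
  define k where "k = q * of_real (1 - s\<^sup>2) / (1 + of_real s * (zeta * a))"
  have nz: "1 + of_real s * a \<noteq> 0" "1 + of_real s * (zeta * a) \<noteq> 0"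
    "1 + of_real s * (- zeta * of_real s) \<noteq> 0"
    using a s by (intro denom_nz; simp)+
  have "(pnt a - pnt (zeta * a)) * (of_real (W a) * cnj kappa) =
      k * ((1 - zeta) * cnj kappa) * (a * (1 + of_real s * cnj a))"
    unfolding W_unit[OF a] using a nz
    by (simp add: pnt_diff k_def divide_simps) (simp add: algebra_simps)
  also have "a * (1 + of_real s * cnj a) = a + of_real s"
    using unit_cnj[OF a] by (simp add: algebra_simps)
  also have "(1 - zeta) * cnj kappa = - zeta / (1 + of_real s * (- zeta * of_real s))"
  proof -
    define d where "d = 1 + of_real s * (- zeta * of_real s)"
    have "cnj kappa * ((1 - zeta\<^sup>2) * (1 - of_real (s\<^sup>2) * (zeta\<^sup>2 * zeta\<^sup>2))) = 1"
      using arg_cong[OF kappa, of cnj] by (simp add: zeta_simps power2_eq_square mult.assoc)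
    then have "cnj kappa * ((1 - zeta\<^sup>2) * d) = 1"
      unfolding zeta_cube by (simp add: d_def power2_eq_square mult_ac)
    moreover have "1 - zeta = (1 - zeta\<^sup>2) * (- zeta)"
      using zeta_cube by (simp add: algebra_simps)
    ultimately have "(1 - zeta) * cnj kappa * d = - zeta" by algebra
    moreover have "d \<noteq> 0" using nz(3) by (simp only: d_def not_False_eq_True)
    ultimately show ?thesis unfolding d_def[symmetric] by (subst eq_divide_eq) simp
  qed
  also have "k * (- zeta / (1 + of_real s * (- zeta * of_real s))) * (a + of_real s) = Om2 - pnt (zeta * a)"
  proof -
    define w where "w = - zeta * of_real s"
    have "w - zeta * a = - zeta * (a + of_real s)" by (simp add: w_def algebra_simps)
    then show ?thesis
      unfolding pnt_diff[OF norm_s_le(2) eq_refl[OF trans[OF norm_multiples(1) a]]]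
      unfolding w_def[symmetric] k_def by (simp add: mult_ac)
  qed
  finally show ?thesis by simp
qed

lemma orient_side:
  assumes a: "cmod a = 1"
  shows "orient (pnt a) (pnt (zeta * a)) Om1 = (dist (pnt a) (pnt (zeta * a)))\<^sup>2 * (W (zeta * a) * Im kappa)"
    and "orient (pnt a) (pnt (zeta * a)) Om2 = (dist (pnt a) (pnt (zeta * a)))\<^sup>2 * (W a * Im kappa)"
proof -
  show "orient (pnt a) (pnt (zeta * a)) Om1 = (dist (pnt a) (pnt (zeta * a)))\<^sup>2 * (W (zeta * a) * Im kappa)"
    using orient_ratio[OF Om1_side[OF a]] by simp
  have "orient (pnt (zeta * a)) (pnt a) Om2 = (dist (pnt (zeta * a)) (pnt a))\<^sup>2 * (- W a * Im kappa)"
    using orient_ratio[OF Om2_side[OF a]] by simp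
  then show "orient (pnt a) (pnt (zeta * a)) Om2 = (dist (pnt a) (pnt (zeta * a)))\<^sup>2 * (W a * Im kappa)"
    by (simp add: orient_swap(2)[of "pnt (zeta * a)"] dist_commute)
qed

lemma unit_distinct:
  assumes "cmod a = 1"
  shows "pnt a \<noteq> pnt (zeta * a)" "pnt (zeta * a) \<noteq> pnt (zeta\<^sup>2 * a)" "pnt (zeta\<^sup>2 * a) \<noteq> pnt a"
  using assms zeta_neq by (auto simp: pnt_eq_iff)

lemma orient_side_pos:
  assumes a: "cmod a = 1"
  shows "orient (pnt a) (pnt (zeta * a)) Om1 > 0" "orient (pnt a) (pnt (zeta * a)) Om2 > 0"
  unfolding orient_side[OF a] using a W_pos Im_kappa_pos unit_distinct(1)[OF a] by simp_all

lemma tri_cycle: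
  "pnt (zeta * (zeta * a)) = pnt (zeta\<^sup>2 * a)" "pnt (zeta * (zeta\<^sup>2 * a)) = pnt a"
  "pnt (zeta\<^sup>2 * (zeta * a)) = pnt a"
  using zeta_cube by (simp_all add: power2_eq_square flip: mult.assoc)

text \<open>The area is the sum of the three areas with apex \<open>Om1\<close>, which are positive
  by the side identity.\<close>

lemma orient_tri_pos:
  assumes a: "cmod a = 1"
  shows "orient (pnt a) (pnt (zeta * a)) (pnt (zeta\<^sup>2 * a)) > 0"
  using orient_side_pos(1)[of a] orient_side_pos(1)[of "zeta * a"] orient_side_pos(1)[of "zeta\<^sup>2 * a"] a
    orient_sum[of "pnt a" "pnt (zeta * a)" Om1 "pnt (zeta\<^sup>2 * a)"]
  by (simp add: tri_cycle)

end

subsection \<open>Brocard points and Brocard angle\<close>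

text \<open>One labelling without a condition on its orientation: transposing the first two labels
  turns the condition for the first Brocard point into that for the second.\<close>

definition brocard_ray :: "complex \<Rightarrow> complex \<Rightarrow> complex \<Rightarrow> complex \<Rightarrow> real \<Rightarrow> bool" where
  "brocard_ray A B C P \<omega> \<longleftrightarrow> P \<in> interior (convex hull {A, B, C}) \<and>
     angle P A B = \<omega> \<and> angle P B C = \<omega> \<and> angle P C A = \<omega>"

lemma Im_orient: "Im ((P - A) * cnj (B - A)) = orient A B P"
  by (simp add: orient_def algebra_simps)

text \<open>
  Writing \<open>k\<close> for the cotangent of the common angle, \<open>Re w = k * \<bar>Im w\<bar>\<close> for each of the three
  products \<open>w = (P - A) * cnj (B - A)\<close>; in the sum of the real parts \<open>P\<close> cancels, and the sum of
  the imaginary parts is the oriented area of the triangle.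
\<close>

lemma brocard_cotangent:
  assumes D: "orient A B C \<noteq> 0" and P: "brocard_ray A B C P \<omega>"
  defines "k \<equiv> Re ((A - B) * cnj A + (B - C) * cnj B + (C - A) * cnj C) / \<bar>orient A B C\<bar>"
  shows "\<omega> = pi / 2 - arctan k"
    and "Re ((P - A) * cnj (B - A)) = k * \<bar>orient A B P\<bar>"
    and "Re ((P - B) * cnj (C - B)) = k * \<bar>orient B C P\<bar>"
proof -
  have int: "orient A B C * orient A B P > 0" "orient A B C * orient B C P > 0"
    "orient A B C * orient C A P > 0"
    using P interior_triangle_iff[OF D] by (auto simp: brocard_ray_def)
  then have nz: "orient A B P \<noteq> 0" "orient B C P \<noteq> 0" "orient C A P \<noteq> 0" by auto
  define k1 where "k1 = Re ((P - A) * cnj (B - A)) / \<bar>orient A B P\<bar>"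
  define k2 where "k2 = Re ((P - B) * cnj (C - B)) / \<bar>orient B C P\<bar>"
  define k3 where "k3 = Re ((P - C) * cnj (A - C)) / \<bar>orient C A P\<bar>"
  have ang: "\<omega> = pi / 2 - arctan k1" "\<omega> = pi / 2 - arctan k2" "\<omega> = pi / 2 - arctan k3"
    using P nz unfolding brocard_ray_def k1_def k2_def k3_def
    by (metis Im_orient angle_eq_arctan)+
  then have k23: "k2 = k1" "k3 = k1" by (simp_all add: arctan_eq_iff)
  have re: "Re ((P - A) * cnj (B - A)) = k1 * \<bar>orient A B P\<bar>"
    "Re ((P - B) * cnj (C - B)) = k1 * \<bar>orient B C P\<bar>"
    "Re ((P - C) * cnj (A - C)) = k1 * \<bar>orient C A P\<bar>"
    using nz k1_def k2_def k3_def k23 by (simp_all add: field_simps)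
  \<comment> \<open>For an inner point the three areas have the same sign, so absolute values add
    up.\<close>
  have "\<bar>orient A B C\<bar> = \<bar>orient A B P\<bar> + \<bar>orient B C P\<bar> + \<bar>orient C A P\<bar>"
    using int orient_sum[of A B P C] by (auto simp: zero_less_mult_iff)
  then have "k1 * \<bar>orient A B C\<bar> =
      Re ((P - A) * cnj (B - A) + (P - B) * cnj (C - B) + (P - C) * cnj (A - C))"
    using re by (simp add: distrib_left)
  also have "\<dots> = Re ((A - B) * cnj A + (B - C) * cnj B + (C - A) * cnj C)"
    by (simp add: algebra_simps)
  finally have "k1 = k" using D by (simp add: k_def field_simps)
  then show "\<omega> = pi / 2 - arctan k" "Re ((P - A) * cnj (B - A)) = k * \<bar>orient A B P\<bar>"
    "Re ((P - B) * cnj (C - B)) = k * \<bar>orient B C P\<bar>"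
    using ang re by simp_all
qed

lemma real_multiple_of_cot:
  assumes "Re w = k * \<bar>Im w\<bar>" "Re v = k * \<bar>Im v\<bar>" "Im w * Im v > 0"
  shows "\<exists>t>0. w = of_real t * v"
proof -
  have "Im w \<noteq> 0" "Im v \<noteq> 0" using assms(3) by auto
  then have "Re w / \<bar>Im w\<bar> = Re v / \<bar>Im v\<bar>" using assms(1,2) by simp
  with positive_multiple_iff[OF assms(3)] show ?thesis by simp
qed

text \<open>The triangle alone determines the cotangent, so both points lie on the same ray from
  \<open>A\<close> and on the same ray from \<open>B\<close>.\<close>

lemma brocard_ray_unique:
  assumes D: "orient A B C \<noteq> 0" and P: "brocard_ray A B C P \<omega>" and S: "brocard_ray A B C S \<omega>'"
  shows "P = S" "\<omega> = \<omega>'"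
proof -
  note kP = brocard_cotangent[OF D P] and kS = brocard_cotangent[OF D S]
  show "\<omega> = \<omega>'" using kP(1) kS(1) by simp
  have pos: "orient A B P * orient A B S > 0" "orient B C P * orient B C S > 0"
    and nz: "orient A B S \<noteq> 0"
    using P S interior_triangle_iff[OF D] unfolding brocard_ray_def
    by (auto simp: zero_less_mult_iff)
  then have "B \<noteq> A" "C \<noteq> B" by (auto simp: orient_def)
  have "\<exists>t>0. (P - A) * cnj (B - A) = of_real t * ((S - A) * cnj (B - A))"
    by (rule real_multiple_of_cot) (use kP(2) kS(2) pos in \<open>simp_all only: Im_orient\<close>)
  then obtain t where t: "P - A = of_real t * (S - A)"
    using \<open>B \<noteq> A\<close> by (auto simp flip: mult.assoc)
  have "\<exists>t>0. (P - B) * cnj (C - B) = of_real t * ((S - B) * cnj (C - B))"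
    by (rule real_multiple_of_cot) (use kP(3) kS(3) pos in \<open>simp_all only: Im_orient\<close>)
  then obtain r where r: "P - B = of_real r * (S - B)"
    using \<open>C \<noteq> B\<close> by (auto simp flip: mult.assoc)
  show "P = S" by (rule intersection_of_cevians[OF nz t r])
qed

lemma brocard_rayI:
  assumes P: "P \<in> interior (convex hull {A, B, C})" and D: "orient A B C \<noteq> 0"
    and ray: "P - A = (B - A) * (of_real x * \<kappa>)" "P - B = (C - B) * (of_real y * \<kappa>)"
      "P - C = (A - C) * (of_real z * \<kappa>)"
    and pos: "x > 0" "y > 0" "z > 0" "Im \<kappa> \<noteq> 0"
  shows "brocard_ray A B C P (pi / 2 - arctan (Re \<kappa> / \<bar>Im \<kappa>\<bar>))"
proof -
  have "angle P A B = pi / 2 - arctan (Re \<kappa> / \<bar>Im \<kappa>\<bar>)"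
    if "P - A = (B - A) * (of_real x * \<kappa>)" "x > 0" "B \<noteq> A" for A B x
  proof -
    have "(P - A) * cnj (B - A) = of_real (x * (cmod (B - A))\<^sup>2) * \<kappa>"
      by (simp add: that(1) complex_norm_square del: of_real_power)
    moreover have "x * (cmod (B - A))\<^sup>2 > 0" using that by simp
    ultimately show ?thesis
      using angle_eq_arctan[OF refl, of P A B] pos(4) that(2,3) by (simp add: abs_mult)
  qed
  moreover have "B \<noteq> A" "C \<noteq> B" "A \<noteq> C" using D by (auto simp: orient_def algebra_simps)
  ultimately show ?thesis unfolding brocard_ray_def using P ray pos by blast
qed

context moebius_triangle
begin

definition omega :: real where "omega = pi / 2 - arctan (sqrt 3 * (1 + s\<^sup>2) / (1 - s\<^sup>2))"

lemma kappa_ratio: "Re kappa / \<bar>Im kappa\<bar> = sqrt 3 * (1 + s\<^sup>2) / (1 - s\<^sup>2)"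
proof -
  have "\<bar>Im kappa\<bar> = Im kappa" using Im_kappa_pos by simp
  then show ?thesis using N_pos s2 by (simp add: kappa_def)
qed

text \<open>
  The labellings of the triangle are the images of \<open>a\<close>, \<open>zeta * a\<close>, \<open>zeta\<^sup>2 * a\<close> for the three
  admissible choices of \<open>a\<close>, up to the transposition of the last two vertices.
\<close>

lemma tri_labelling:
  assumes a: "cmod a = 1" and T: "tri p q s a = {A, B, C}"
  obtains b where "cmod b = 1" "tri p q s b = tri p q s a" "A = pnt b"
    "(B = pnt (zeta * b) \<and> C = pnt (zeta\<^sup>2 * b)) \<or> (B = pnt (zeta\<^sup>2 * b) \<and> C = pnt (zeta * b))"
proof -
  note d = unit_distinct[OF a]
  have rot: "tri p q s (zeta * a) = tri p q s a" "tri p q s (zeta\<^sup>2 * a) = tri p q s a"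
    using zeta_cube unfolding tri_def by (auto simp flip: mult.assoc simp: power2_eq_square)
  have "A \<in> tri p q s a" using T by simp
  then consider "A = pnt a" | "A = pnt (zeta * a)" | "A = pnt (zeta\<^sup>2 * a)" by (auto simp: tri_def)
  then obtain b where b: "cmod b = 1" "tri p q s b = tri p q s a" "A = pnt b"
  proof cases
    case 1 then show ?thesis using that a by blast
  next
    case 2 then show ?thesis using that[of "zeta * a"] a rot by simp
  next
    case 3 then show ?thesis using that[of "zeta\<^sup>2 * a"] a rot by simp
  qed
  have "{pnt b, pnt (zeta * b), pnt (zeta\<^sup>2 * b)} = {pnt b, B, C}"
    using T b by (simp add: tri_def)
  then have "pnt (zeta * b) \<in> {pnt b, B, C}" "pnt (zeta\<^sup>2 * b) \<in> {pnt b, B, C}" by blast+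
  then have "(B = pnt (zeta * b) \<and> C = pnt (zeta\<^sup>2 * b)) \<or> (B = pnt (zeta\<^sup>2 * b) \<and> C = pnt (zeta * b))"
    using unit_distinct[OF b(1)] by auto
  with b that show ?thesis by blast
qed

lemma tri_ccw_labelling:
  assumes a: "cmod a = 1" and T: "tri p q s a = {A, B, C}" and ccw: "counterclockwise A B C"
  obtains b where "cmod b = 1" "tri p q s b = tri p q s a" "A = pnt b" "B = pnt (zeta * b)"
    "C = pnt (zeta\<^sup>2 * b)"
proof -
  obtain b where b: "cmod b = 1" "tri p q s b = tri p q s a" "A = pnt b"
    "(B = pnt (zeta * b) \<and> C = pnt (zeta\<^sup>2 * b)) \<or> (B = pnt (zeta\<^sup>2 * b) \<and> C = pnt (zeta * b))"
    using tri_labelling[OF a T] .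
  moreover have "\<not> (B = pnt (zeta\<^sup>2 * b) \<and> C = pnt (zeta * b))"
    using ccw orient_tri_pos[OF b(1)] orient_swap(1)[of A C B] b(3) by (auto simp: counterclockwise_iff)
  ultimately show ?thesis using that by blast
qed

lemma interior_tri_iff:
  assumes a: "cmod a = 1"
  shows "P \<in> interior (convex hull tri p q s a) \<longleftrightarrow>
    orient (pnt a) (pnt (zeta * a)) P > 0 \<and> orient (pnt (zeta * a)) (pnt (zeta\<^sup>2 * a)) P > 0 \<and>
    orient (pnt (zeta\<^sup>2 * a)) (pnt a) P > 0"
  using orient_tri_pos[OF a] unfolding tri_def
  by (subst interior_triangle_iff) (auto simp: zero_less_mult_iff)

lemma Om_interior:
  assumes a: "cmod a = 1"
  shows "Om1 \<in> interior (convex hull tri p q s a)" "Om2 \<in> interior (convex hull tri p q s a)"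
  using orient_side_pos[of a] orient_side_pos[of "zeta * a"] orient_side_pos[of "zeta\<^sup>2 * a"] a
  by (simp_all add: interior_tri_iff tri_cycle)

lemma brocard_ray_Om1:
  assumes a: "cmod a = 1"
  shows "brocard_ray (pnt a) (pnt (zeta * a)) (pnt (zeta\<^sup>2 * a)) Om1 omega"
  unfolding omega_def kappa_ratio[symmetric]
proof (rule brocard_rayI)
  show "Om1 \<in> interior (convex hull {pnt a, pnt (zeta * a), pnt (zeta\<^sup>2 * a)})"
    using Om_interior(1)[OF a] by (simp add: tri_def)
  show "orient (pnt a) (pnt (zeta * a)) (pnt (zeta\<^sup>2 * a)) \<noteq> 0"
    using orient_tri_pos[OF a] by simp
  show "Om1 - pnt a = (pnt (zeta * a) - pnt a) * (of_real (W (zeta * a)) * kappa)"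
    using Om1_side[OF a] .
  show "Om1 - pnt (zeta * a) = (pnt (zeta\<^sup>2 * a) - pnt (zeta * a)) * (of_real (W (zeta * (zeta * a))) * kappa)"
    using Om1_side[of "zeta * a"] a by (simp add: tri_cycle)
  show "Om1 - pnt (zeta\<^sup>2 * a) = (pnt a - pnt (zeta\<^sup>2 * a)) * (of_real (W (zeta * (zeta\<^sup>2 * a))) * kappa)"
    using Om1_side[of "zeta\<^sup>2 * a"] a by (simp add: tri_cycle)
qed (use a Im_kappa_pos in \<open>simp_all add: W_pos\<close>)

lemma brocard_ray_Om2:
  assumes a: "cmod a = 1"
  shows "brocard_ray (pnt (zeta * a)) (pnt a) (pnt (zeta\<^sup>2 * a)) Om2 omega"
proof -
  have "brocard_ray (pnt (zeta * a)) (pnt a) (pnt (zeta\<^sup>2 * a)) Om2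
      (pi / 2 - arctan (Re (cnj kappa) / \<bar>Im (cnj kappa)\<bar>))"
  proof (rule brocard_rayI)
    show "Om2 \<in> interior (convex hull {pnt (zeta * a), pnt a, pnt (zeta\<^sup>2 * a)})"
      using Om_interior(2)[OF a] by (simp add: tri_def insert_commute)
    show "orient (pnt (zeta * a)) (pnt a) (pnt (zeta\<^sup>2 * a)) \<noteq> 0"
      using orient_tri_pos[OF a] by (simp add: orient_swap(2)[of "pnt (zeta * a)"])
    show "Om2 - pnt (zeta * a) = (pnt a - pnt (zeta * a)) * (of_real (W a) * cnj kappa)"
      using Om2_side[OF a] .
    show "Om2 - pnt a = (pnt (zeta\<^sup>2 * a) - pnt a) * (of_real (W (zeta\<^sup>2 * a)) * cnj kappa)"
      using Om2_side[of "zeta\<^sup>2 * a"] a by (simp add: tri_cycle)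
    show "Om2 - pnt (zeta\<^sup>2 * a) = (pnt (zeta * a) - pnt (zeta\<^sup>2 * a)) * (of_real (W (zeta * a)) * cnj kappa)"
      using Om2_side[of "zeta * a"] a by (simp add: tri_cycle)
  qed (use a Im_kappa_pos in \<open>simp_all add: W_pos\<close>)
  then show ?thesis by (simp add: omega_def kappa_ratio[symmetric])
qed

text \<open>The angle is left free here, because \<open>brocard_angle\<close> is described before a
  Brocard point is chosen.\<close>

lemma is_brocard1_iff:
  assumes a: "cmod a = 1"
  shows "is_brocard1 (tri p q s a) P \<omega> \<longleftrightarrow> P = Om1 \<and> \<omega> = omega"
proof
  assume "is_brocard1 (tri p q s a) P \<omega>"
  then obtain A B C where T: "tri p q s a = {A, B, C}" "counterclockwise A B C"
    and P: "brocard_ray A B C P \<omega>"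
    unfolding is_brocard1_def brocard_ray_def by auto
  then obtain b where "cmod b = 1" "A = pnt b" "B = pnt (zeta * b)" "C = pnt (zeta\<^sup>2 * b)"
    using tri_ccw_labelling[OF a] by metis
  then have "brocard_ray A B C Om1 omega" "orient A B C \<noteq> 0"
    using brocard_ray_Om1[of b] orient_tri_pos[of b] by auto
  then show "P = Om1 \<and> \<omega> = omega" using brocard_ray_unique[OF _ P] by metis
next
  assume "P = Om1 \<and> \<omega> = omega"
  then show "is_brocard1 (tri p q s a) P \<omega>"
    using brocard_ray_Om1[OF a] orient_tri_pos[OF a]
    unfolding is_brocard1_def brocard_ray_def tri_def counterclockwise_iff by blast
qed

lemma is_brocard2_iff:
  assumes a: "cmod a = 1"
  shows "is_brocard2 (tri p q s a) P \<omega> \<longleftrightarrow> P = Om2 \<and> \<omega> = omega"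
proof
  assume "is_brocard2 (tri p q s a) P \<omega>"
  then obtain A B C where T: "tri p q s a = {A, B, C}" "counterclockwise A B C"
    and P: "brocard_ray B A C P \<omega>"
    unfolding is_brocard2_def brocard_ray_def by (auto simp: insert_commute)
  then obtain b where "cmod b = 1" "A = pnt b" "B = pnt (zeta * b)" "C = pnt (zeta\<^sup>2 * b)"
    using tri_ccw_labelling[OF a] by metis
  then have "brocard_ray B A C Om2 omega" "orient B A C \<noteq> 0"
    using brocard_ray_Om2[of b] orient_tri_pos[of b] orient_swap(2)[of B A C] by auto
  then show "P = Om2 \<and> \<omega> = omega" using brocard_ray_unique[OF _ P] by metis
next
  assume "P = Om2 \<and> \<omega> = omega"
  then show "is_brocard2 (tri p q s a) P \<omega>"
    using brocard_ray_Om2[OF a] orient_tri_pos[OF a] Om_interior[OF a]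
    unfolding is_brocard2_def brocard_ray_def tri_def counterclockwise_iff by blast
qed

lemma brocard_tri:
  assumes a: "cmod a = 1"
  shows "brocard_angle (tri p q s a) = omega" "brocard1 (tri p q s a) = Om1"
    "brocard2 (tri p q s a) = Om2"
proof -
  show *: "brocard_angle (tri p q s a) = omega"
    unfolding brocard_angle_def is_brocard1_iff[OF a] is_brocard2_iff[OF a] by (rule the_equality) auto
  show "brocard1 (tri p q s a) = Om1" "brocard2 (tri p q s a) = Om2"
    unfolding brocard1_def brocard2_def is_brocard1_iff[OF a] is_brocard2_iff[OF a] * by simp_all
qed

end

subsection \<open>Circumcircle, symmedian point and Brocard circle\<close>

context moebius_triangle
begin

lemma triangle_tri:
  assumes a: "cmod a = 1"
  shows "triangle (tri p q s a)"
  using unit_distinct[OF a] orient_tri_pos[OF a]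
  unfolding triangle_def tri_def collinear_iff_orient by (auto simp: card_insert_if)

lemma tri_subset_circle: "cmod a = 1 \<Longrightarrow> tri p q s a \<subseteq> sphere p (cmod q)"
  using pnt_unit_in_circle[of a] pnt_unit_in_circle[of "zeta * a"] pnt_unit_in_circle[of "zeta\<^sup>2 * a"]
  by (simp add: tri_def)

lemma circumcircle_tri:
  assumes a: "cmod a = 1"
  shows "circumcircle (tri p q s a) = sphere p (cmod q)" "circumcenter (tri p q s a) = p"
proof -
  show *: "circumcircle (tri p q s a) = sphere p (cmod q)"
    unfolding circumcircle_def tri_def
    using orient_tri_pos[OF a] q tri_subset_circle[OF a] by (intro circle_through_three) (auto simp: tri_def)
  show "circumcenter (tri p q s a) = p" using q by (simp add: circumcenter_def *)
qed

section \<open>The symmedian point\<close>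

abbreviation "X6 \<equiv> pnt (of_real s)"

lemma one_plus_s2: "1 + s * s > 0" "1 + complex_of_real s * complex_of_real s \<noteq> 0"
proof -
  show *: "1 + s * s > 0" by (simp add: add_pos_nonneg)
  have "1 + complex_of_real s * complex_of_real s = of_real (1 + s * s)" by simp
  then show "1 + complex_of_real s * complex_of_real s \<noteq> 0" using * by (metis less_irrefl of_real_eq_0_iff)
qed

lemma X6_diff:
  "cmod a = 1 \<Longrightarrow> X6 - pnt a = q * (of_real s - a) * of_real (1 - s\<^sup>2) /
    ((1 + of_real s * of_real s) * (1 + of_real s * a))"
  by (rule pnt_diff) (use s in simp_all)

lemma X6_interior:
  assumes a: "cmod a = 1"
  shows "X6 \<in> interior (convex hull tri p q s a)"
proof -
  have side: "orient (pnt a) (pnt (zeta * a)) X6 > 0" if a: "cmod a = 1" for a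
  proof -
    have nz: "1 + of_real s * a \<noteq> 0" "1 + of_real s * (zeta * a) \<noteq> 0"
      using a by (intro denom_nz; simp)+
    have "3 + complex_of_real s * (complex_of_real s * 3) = 3 * (1 + complex_of_real s * complex_of_real s)"
      by (simp add: algebra_simps)
    then have s1: "3 + complex_of_real s * (complex_of_real s * 3) \<noteq> 0"
      by (metis one_plus_s2(2) mult_eq_0_iff zero_neq_numeral)
    have cz: "cnj (zeta - 1) * (zeta - 1) = 3"
      using norm_zeta_minus_1(1) by (metis complex_norm_square mult.commute of_real_numeral of_real_power)
    \<comment> \<open>The quotient of \<open>X6 - pnt a\<close> by the side vector, with its
      denominator made real by \<open>cz\<close> and \<open>a * cnj a = 1\<close>.\<close>
    define t where "t = cnj (zeta - 1) * (of_real s * cnj a - 1) * (1 + of_real s * (zeta * a)) / of_real (3 * (1 + s * s))"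
    have "X6 - pnt a = (pnt (zeta * a) - pnt a) * t"
    proof -
      have "(pnt (zeta * a) - pnt a) * t =
          q * of_real (1 - s\<^sup>2) * (cnj (zeta - 1) * (zeta - 1) / 3) * (of_real s * (a * cnj a) - a) /
          ((1 + of_real s * a) * (1 + of_real s * of_real s))"
        using a nz s1 one_plus_s2(2) by (simp add: pnt_diff t_def divide_simps) (simp add: algebra_simps)
      also have "\<dots> = X6 - pnt a"
        unfolding cz unit_cnj[OF a] X6_diff[OF a] by (simp add: mult_ac)
      finally show ?thesis by simp
    qed
    then have "orient (pnt a) (pnt (zeta * a)) X6 = (dist (pnt a) (pnt (zeta * a)))\<^sup>2 * Im t"
      by (rule orient_ratio)
    moreover have "Im t = (sqrt 3 / 2 * (1 - s\<^sup>2)) / (3 * (1 + s * s))"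
    proof -
      \<comment> \<open>The two terms that contain \<open>a\<close> are conjugate up to sign of
        their factors and add up to a real number, so the imaginary part is independent of
        \<open>a\<close>.\<close>
      have "Im (cnj (zeta - 1) * (of_real s * cnj a - 1) * (1 + of_real s * (zeta * a))) =
          Im (cnj (zeta - 1) * (of_real s * cnj a - 1 - of_real s * (zeta * a) + of_real (s\<^sup>2) * zeta * (a * cnj a)))"
        by (simp add: power2_eq_square algebra_simps)
      also have "\<dots> = sqrt 3 / 2 * (1 - s\<^sup>2)"
        unfolding unit_cnj[OF a] by (simp add: zeta_simps field_simps)
      finally show ?thesis unfolding t_def by (simp only: Im_divide_of_real)
    qed
    moreover have "\<dots> > 0" using s2 by (simp add: power2_eq_square add_pos_nonneg)
    moreover have "(dist (pnt a) (pnt (zeta * a)))\<^sup>2 > 0" using unit_distinct(1)[OF a] by simp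
    ultimately show ?thesis by (metis mult_pos_pos)
  qed
  show ?thesis
    using side[of a] side[of "zeta * a"] side[of "zeta\<^sup>2 * a"] a by (simp add: interior_tri_iff tri_cycle)
qed

lemma X6_symmedian:
  assumes a: "cmod a = 1"
  shows "(X6 - pnt a) * ((pnt (zeta * a) - pnt a) + (pnt (zeta\<^sup>2 * a) - pnt a)) =
    of_real ((cmod (1 - of_real s * a))\<^sup>2 / (1 + s * s)) *
      ((pnt (zeta * a) - pnt a) * (pnt (zeta\<^sup>2 * a) - pnt a))"
proof -
  have nz: "1 + of_real s * a \<noteq> 0" "1 + of_real s * (zeta * a) \<noteq> 0" "1 + of_real s * (zeta\<^sup>2 * a) \<noteq> 0"
    using a by (intro denom_nz; simp)+
  note s1' = one_plus_s2(2)
  have za: "zeta * a - a = (zeta - 1) * a" "zeta\<^sup>2 * a - a = (zeta\<^sup>2 - 1) * a"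
    by (simp_all add: left_diff_distrib)
  define g where "g = q * of_real (1 - s\<^sup>2) / (1 + of_real s * a)"
  have X: "X6 - pnt a = g * (of_real s - a) / (1 + of_real s * of_real s)"
    unfolding X6_diff[OF a] by (simp add: g_def mult_ac)
  have B: "pnt (zeta * a) - pnt a = g * ((zeta - 1) * a) / (1 + of_real s * (zeta * a))"
    unfolding pnt_diff[OF eq_refl[OF trans[OF norm_multiples(1) a]] eq_refl[OF a]] za g_def
    by (simp add: mult_ac)
  have C: "pnt (zeta\<^sup>2 * a) - pnt a = g * ((zeta\<^sup>2 - 1) * a) / (1 + of_real s * (zeta\<^sup>2 * a))"
    unfolding pnt_diff[OF eq_refl[OF trans[OF norm_multiples(2) a]] eq_refl[OF a]] za g_def
    by (simp add: mult_ac)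
  have n: "of_real ((cmod (1 - of_real s * a))\<^sup>2) = (1 - of_real s * a) * (1 - of_real s * cnj a)"
    by (simp add: complex_norm_square del: of_real_power)
  \<comment> \<open>Both sides are \<open>3 * (a - s) * (1 - s * a)\<close>.\<close>
  have z: "(of_real s - a) * ((zeta - 1) * (1 + of_real s * (zeta\<^sup>2 * a)) + (zeta\<^sup>2 - 1) * (1 + of_real s * (zeta * a))) =
      (1 - of_real s * a) * (a - of_real s * (a * cnj a)) * ((zeta - 1) * (zeta\<^sup>2 - 1))"
    unfolding unit_cnj[OF a] using zeta_sum by algebra
  have combine: "g * x / M * (g * b / dB + g * c / dC) = n / M * (g * b / dB * (g * c / dC))"
    if "dB \<noteq> 0" "dC \<noteq> 0" "x * (b * dC + c * dB) = n * (b * c)" for x M b c dB dC n :: complex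
  proof -
    have "g * b / dB + g * c / dC = g * (b * dC + c * dB) / (dB * dC)"
      using that(1,2) by (simp add: field_simps)
    then have "g * x / M * (g * b / dB + g * c / dC) = g * g * (x * (b * dC + c * dB)) / (M * (dB * dC))"
      by (simp add: mult_ac)
    then show ?thesis unfolding that(3) by (simp add: mult_ac)
  qed
  have key: "(of_real s - a) * ((zeta - 1) * a * (1 + of_real s * (zeta\<^sup>2 * a)) + (zeta\<^sup>2 - 1) * a * (1 + of_real s * (zeta * a))) =
      (1 - of_real s * a) * (1 - of_real s * cnj a) * ((zeta - 1) * a * ((zeta\<^sup>2 - 1) * a))"
    using z by algebra
  have e: "of_real ((cmod (1 - of_real s * a))\<^sup>2 / (1 + s * s)) =
      (1 - of_real s * a) * (1 - of_real s * cnj a) / (1 + complex_of_real s * complex_of_real s)"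
    unfolding of_real_divide n by simp
  show ?thesis unfolding X B C e by (rule combine[OF nz(2,3) key])
qed

end

text \<open>A ray and its reflection in the bisector at \<open>A\<close> have arguments with the
  same sum as those of \<open>B - A\<close> and \<open>C - A\<close>. So the product of
  \<open>P - A\<close> with the median vector is a positive multiple of the product of the sides, a
  condition symmetric in \<open>B\<close> and \<open>C\<close>.\<close>

lemma symmedian_angle_iff:
  assumes D: "orient A B C \<noteq> 0"
    and P: "P \<in> interior (convex hull {A, B, C})"
  shows "angle P A B = angle (centroid {A, B, C}) A C \<longleftrightarrow>
    (\<exists>t>0. (P - A) * ((B - A) + (C - A)) = of_real t * ((B - A) * (C - A)))"
proof -
  let ?G = "centroid {A, B, C}"
  have ne: "A \<noteq> B" "A \<noteq> C" "B \<noteq> C" using D by (auto simp: orient_def algebra_simps)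
  have G: "?G - A = ((B - A) + (C - A)) / 3"
    using ne by (simp add: centroid_def field_simps)
  define w where "w = (P - A) * cnj (B - A)"
  define u where "u = (?G - A) * cnj (C - A)"
  \<comment> \<open>The second angle is measured from \<open>C\<close>, in the opposite sense;
    conjugation brings \<open>v\<close> and \<open>w\<close> into the same half-plane.\<close>
  define v where "v = cnj u"
  have wI: "Im w = orient A B P" unfolding w_def by (rule Im_orient)
  have e: "Im u = - orient A B C / 3"
    unfolding u_def G by (simp add: orient_def field_simps)
  have vI: "Im v = orient A B C / 3" unfolding v_def cnj.simps e by simp
  have pos: "Im w * Im v > 0"
    using P interior_triangle_iff[OF D] by (simp add: wI vI mult.commute)
  then have nz: "Im w \<noteq> 0" "Im v \<noteq> 0" by auto
  have "angle P A B = pi / 2 - arctan (Re w / \<bar>Im w\<bar>)"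
    using angle_eq_arctan[OF w_def nz(1)] .
  moreover have "angle ?G A C = pi / 2 - arctan (Re v / \<bar>Im v\<bar>)"
    using angle_eq_arctan[OF u_def] nz(2) by (simp add: v_def)
  ultimately have "angle P A B = angle ?G A C \<longleftrightarrow> (\<exists>t>0. w = of_real t * v)"
    using positive_multiple_iff[OF pos] by (simp add: arctan_eq_iff)
  also have "\<dots> \<longleftrightarrow> (\<exists>t>0. (P - A) * ((B - A) + (C - A)) = of_real t * ((B - A) * (C - A)))"
  proof -
    define m where "m = (B - A) + (C - A)"
    have v: "3 * v = cnj m * (C - A)" unfolding v_def u_def G m_def by simp
    have m: "m \<noteq> 0" using vI nz v by auto
    define k where "k = (cmod m)\<^sup>2 / (3 * (cmod (B - A))\<^sup>2)"
    have k: "k > 0" using m ne by (simp add: k_def)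
    have "w = of_real t * v \<longleftrightarrow> (P - A) * m = of_real (t * k) * ((B - A) * (C - A))" for t
    proof -
      have "w = of_real t * v \<longleftrightarrow> (3 * (B - A) * m) * w = (3 * (B - A) * m) * (of_real t * v)"
        using ne m by simp
      also have "(3 * (B - A) * m) * w = of_real (3 * (cmod (B - A))\<^sup>2) * ((P - A) * m)"
        by (simp add: w_def complex_norm_square mult_ac del: of_real_power complex_cnj_diff)
      also have "(3 * (B - A) * m) * (of_real t * v) = (B - A) * m * (of_real t * (3 * v))"
        by simp
      also have "\<dots> = of_real (3 * (cmod (B - A))\<^sup>2) * (of_real (t * k) * ((B - A) * (C - A)))"
      proof -
        have "3 * (cmod (B - A))\<^sup>2 * (t * k) = t * (cmod m)\<^sup>2" using ne by (simp add: k_def)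
        then have "of_real (3 * (cmod (B - A))\<^sup>2) * (of_real (t * k) * ((B - A) * (C - A))) =
            of_real (t * (cmod m)\<^sup>2) * ((B - A) * (C - A))"
          by (metis mult.assoc of_real_mult)
        also have "\<dots> = (B - A) * m * (of_real t * (3 * v))"
          unfolding v by (simp add: complex_norm_square mult_ac del: of_real_power)
        finally show ?thesis by (rule sym)
      qed
      finally show ?thesis using ne by simp
    qed
    then have "(\<exists>t>0. w = of_real t * v) \<longleftrightarrow> (\<exists>t>0. (P - A) * m = of_real (t * k) * ((B - A) * (C - A)))"
      by simp
    also have "\<dots> \<longleftrightarrow> (\<exists>t>0. (P - A) * m = of_real t * ((B - A) * (C - A)))"
    proof
      assume "\<exists>t>0. (P - A) * m = of_real t * ((B - A) * (C - A))"
      then obtain t where "t > 0" "(P - A) * m = of_real t * ((B - A) * (C - A))" by blast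
      then have "t / k > 0" "(P - A) * m = of_real (t / k * k) * ((B - A) * (C - A))"
        using k by simp_all
      then show "\<exists>t>0. (P - A) * m = of_real (t * k) * ((B - A) * (C - A))" by blast
    qed (use k in \<open>metis mult_pos_pos\<close>)
    finally show ?thesis by (simp add: m_def)
  qed
  finally show ?thesis .
qed

context moebius_triangle
begin

text \<open>Existence has to be checked for all labellings, which reduces to rotations of
  \<open>a\<close> and the transposition \<open>swap\<close>; for uniqueness two symmedians
  suffice.\<close>

lemma symmedian_point_tri:
  assumes a: "cmod a = 1"
  shows "symmedian_point (tri p q s a) = X6"
proof -
  define sym where "sym P A B C \<longleftrightarrow>
    (\<exists>t>0. (P - A) * ((B - A) + (C - A)) = of_real t * ((B - A) * (C - A)))" for P A B C :: complex
  have swap: "sym P A B C \<longleftrightarrow> sym P A C B" for P A B C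
    by (simp add: sym_def add.commute mult.commute)
  have iff: "angle P A B = angle (centroid (tri p q s a)) A C \<longleftrightarrow> sym P A B C"
    if "P \<in> interior (convex hull tri p q s a)" "tri p q s a = {A, B, C}" for P A B C
  proof -
    have "orient A B C \<noteq> 0"
      using triangle_tri[OF a] that(2) by (simp add: triangle_def collinear_iff_orient)
    then show ?thesis using symmedian_angle_iff[of A B C P] that by (simp add: sym_def)
  qed
  have symX6: "sym X6 (pnt b) (pnt (zeta * b)) (pnt (zeta\<^sup>2 * b))" if b: "cmod b = 1" for b
  proof -
    have "1 - of_real s * b \<noteq> 0"
      using denom_nz[of "- b"] b by simp
    then have "(cmod (1 - of_real s * b))\<^sup>2 / (1 + s * s) > 0"
      using s by (simp add: add_pos_nonneg)
    then show ?thesis using X6_symmedian[OF b] unfolding sym_def by blast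
  qed
  have line: "\<exists>t. P - A = of_real t * (S - A)"
    if sym: "sym P A B C" "sym S A B C" and ne: "B \<noteq> A" "C \<noteq> A" for P S A B C
  proof -
    obtain t r where t: "t > 0" "(P - A) * ((B - A) + (C - A)) = of_real t * ((B - A) * (C - A))"
      and r: "r > 0" "(S - A) * ((B - A) + (C - A)) = of_real r * ((B - A) * (C - A))"
      using sym unfolding sym_def by blast
    have nz: "(B - A) + (C - A) \<noteq> 0"
    proof
      assume "(B - A) + (C - A) = 0"
      then have "of_real t * ((B - A) * (C - A)) = 0" using t(2) by (metis mult_zero_right)
      then show False using t(1) ne by simp
    qed
    have "of_real r * ((P - A) * ((B - A) + (C - A))) = of_real t * ((S - A) * ((B - A) + (C - A)))"
      unfolding t(2) r(2) by simp
    then have "of_real r * (P - A) = of_real t * (S - A)" using nz by simp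
    then have "P - A = of_real (t / r) * (S - A)" using r(1) by (simp add: field_simps)
    then show ?thesis by blast
  qed
  show ?thesis unfolding symmedian_point_def
  proof (rule the_equality)
    show "X6 \<in> interior (convex hull tri p q s a) \<and>
        (\<forall>A B C. tri p q s a = {A, B, C} \<longrightarrow> angle X6 A B = angle (centroid (tri p q s a)) A C)"
    proof (intro conjI allI impI)
      fix A B C assume T: "tri p q s a = {A, B, C}"
      obtain b where "cmod b = 1" "A = pnt b"
        "(B = pnt (zeta * b) \<and> C = pnt (zeta\<^sup>2 * b)) \<or> (B = pnt (zeta\<^sup>2 * b) \<and> C = pnt (zeta * b))"
        using tri_labelling[OF a T] by blast
      then show "angle X6 A B = angle (centroid (tri p q s a)) A C"
        using iff[OF X6_interior[OF a] T] symX6 swap by metis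
    qed (rule X6_interior[OF a])
  next
    fix P assume P: "P \<in> interior (convex hull tri p q s a) \<and>
        (\<forall>A B C. tri p q s a = {A, B, C} \<longrightarrow> angle P A B = angle (centroid (tri p q s a)) A C)"
    let ?A = "pnt a" and ?B = "pnt (zeta * a)" and ?C = "pnt (zeta\<^sup>2 * a)"
    have T: "tri p q s a = {?A, ?B, ?C}" "tri p q s a = {?B, ?C, ?A}" by (auto simp: tri_def)
    have symP: "sym P ?A ?B ?C" "sym P ?B ?C ?A"
      using P iff[OF _ T(1)] iff[OF _ T(2)] T by blast+
    have symX: "sym X6 ?A ?B ?C" "sym X6 ?B ?C ?A"
      using symX6[of a] symX6[of "zeta * a"] a by (simp_all add: tri_cycle)
    obtain t r where tr: "P - ?A = of_real t * (X6 - ?A)" "P - ?B = of_real r * (X6 - ?B)"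
      using line[OF symP(1) symX(1)] line[OF symP(2) symX(2)] unit_distinct[OF a] by metis
    have "orient ?A ?B X6 \<noteq> 0"
      using X6_interior[OF a] by (simp add: interior_tri_iff[OF a])
    then show "P = X6" by (rule intersection_of_cevians[OF _ tr])
  qed
qed

text \<open>\<open>q * rho\<close> is half the vector from \<open>X3 = p\<close> to
  \<open>X6\<close>, since \<open>mob s\<close> sends \<open>s\<close> to
  \<open>2 * s / (1 + s^2)\<close>.\<close>

definition rho :: real where "rho = s / (1 + s\<^sup>2)"

text \<open>The center is the midpoint of \<open>p\<close> and \<open>X6\<close>. For
  \<open>s = 0\<close> the three defining points would coincide.\<close>

lemma brocard_circle_tri:
  assumes a: "cmod a = 1" and s0: "s > 0"
  shows "brocard_circle (tri p q s a) = sphere (p + q * of_real rho) (cmod q * rho)"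
    and "rho > 0" and "rho < 1 / 2" and "X6 = p + 2 * q * of_real rho"
proof -
  show rho: "rho > 0" using s0 s2 by (simp add: rho_def add_pos_nonneg)
  have "(1 - s)\<^sup>2 > 0" using s by simp
  then show "rho < 1 / 2" using one_plus_s2(1) by (simp add: rho_def field_simps power2_eq_square)
  show "X6 = p + 2 * q * of_real rho"
    by (simp add: pt_def mob_def rho_def power2_eq_square)
  define d1 where "d1 = 1 + of_real s * (- zeta\<^sup>2 * of_real s)"
  define d2 where "d2 = 1 + of_real s * (- zeta * of_real s)"
  have d: "d1 \<noteq> 0" "d2 \<noteq> 0" unfolding d1_def d2_def by (rule denom_nz; rule norm_s_le)+
  have cd: "cnj d1 = d2" by (simp add: d1_def d2_def zeta_simps zeta_cube power2_eq_square[of "zeta\<^sup>2"])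
  have m1: "Om1 = p + q * (of_real s * (1 - zeta\<^sup>2) / d1)"
    by (simp add: pt_def mob_def d1_def algebra_simps)
  have m2: "Om2 = p + q * (of_real s * (1 - zeta) / d2)"
    by (simp add: pt_def mob_def d2_def algebra_simps)
  show "brocard_circle (tri p q s a) = sphere (p + q * of_real rho) (cmod q * rho)"
    unfolding brocard_circle_def brocard_tri[OF a] circumcircle_tri[OF a]
  proof (rule circle_through_three)
    show "0 < cmod q * rho" using q rho by simp
    \<comment> \<open>The quotient of \<open>Om2 - p\<close> by \<open>Om1 - p\<close> is a real
      multiple of \<open>zeta * d1^2\<close>, whose imaginary part is a multiple of
      \<open>1 - s ^ 4\<close>.\<close>
    show "orient p Om1 Om2 \<noteq> 0"
    proof -
      have dd: "d1 * d2 = of_real ((cmod d1)\<^sup>2)"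
        by (simp add: complex_norm_square flip: cd del: of_real_power)
      have "d2 * (zeta * d1\<^sup>2 / (d1 * d2)) = zeta * d1" using d by (simp add: power2_eq_square)
      moreover have "1 - zeta = (1 - zeta\<^sup>2) * (- zeta)"
        using zeta_cube by (simp add: algebra_simps)
      ultimately have "Om2 - p = (Om1 - p) * (- (zeta * d1\<^sup>2) / of_real ((cmod d1)\<^sup>2))"
        unfolding dd[symmetric] m1 m2 using d by (simp add: divide_simps power2_eq_square)
      then have "orient p Om1 Om2 = (dist p Om1)\<^sup>2 * Im (- (zeta * d1\<^sup>2) / of_real ((cmod d1)\<^sup>2))"
        by (rule orient_ratio)
      also have "Im (- (zeta * d1\<^sup>2) / of_real ((cmod d1)\<^sup>2)) = - Im (zeta * d1\<^sup>2) / (cmod d1)\<^sup>2"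
        unfolding Im_divide_of_real by simp
      also have "zeta * d1\<^sup>2 = zeta - 2 * of_real (s\<^sup>2) + of_real (s ^ 4) * zeta\<^sup>2"
      proof -
        have "d1 = 1 - of_real s ^ 2 * zeta\<^sup>2" by (simp add: d1_def power2_eq_square)
        then show ?thesis using zeta_sum by (simp only: of_real_power) algebra
      qed
      also have "Im \<dots> = sqrt 3 / 2 * (1 - s ^ 4)"
        by (simp add: zeta_simps algebra_simps flip: of_real_power)
      finally have o: "orient p Om1 Om2 = (dist p Om1)\<^sup>2 * (- (sqrt 3 / 2 * (1 - s ^ 4)) / (cmod d1)\<^sup>2)" .
      have "s ^ 4 < 1" using s by (simp add: power_less_one_iff)
      moreover have "p \<noteq> Om1" unfolding m1 using q s0 d zeta_neq by simp
      ultimately show ?thesis unfolding o using d by simp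
    qed
    have nz: "1 + (complex_of_real s)\<^sup>2 \<noteq> 0" using one_plus_s2(2) by (simp add: power2_eq_square)
    have "d1 = 1 - of_real s ^ 2 * zeta\<^sup>2" "d2 = 1 - of_real s ^ 2 * zeta"
      by (simp_all add: d1_def d2_def power2_eq_square)
    then have e: "(1 - zeta\<^sup>2) * (1 + (complex_of_real s)\<^sup>2) - d1 = - zeta\<^sup>2 * d2"
      "(1 - zeta) * (1 + (complex_of_real s)\<^sup>2) - d2 = - zeta * d1"
      using zeta_sum by algebra+
    have r: "of_real rho = of_real s / (1 + (complex_of_real s)\<^sup>2)" by (simp add: rho_def)
    have "Om1 - (p + q * of_real rho) =
        q * of_real rho * (((1 - zeta\<^sup>2) * (1 + (complex_of_real s)\<^sup>2) - d1) / d1)"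
      "Om2 - (p + q * of_real rho) =
        q * of_real rho * (((1 - zeta) * (1 + (complex_of_real s)\<^sup>2) - d2) / d2)"
      unfolding m1 m2 r using d nz by (simp_all add: field_simps)
    \<comment> \<open>By \<open>e\<close> the quotients are \<open>d2 / d1\<close> and
      \<open>d1 / d2\<close> up to units, and \<open>d1\<close>, \<open>d2\<close> are
      conjugate.\<close>
    then have "cmod (Om1 - (p + q * of_real rho)) = cmod q * rho"
      "cmod (Om2 - (p + q * of_real rho)) = cmod q * rho"
      using rho d unfolding e by (simp_all add: norm_mult norm_divide norm_power zeta_simps flip: cd)
    then show "{p, Om1, Om2} \<subseteq> sphere (p + q * of_real rho) (cmod q * rho)"
      using rho by (simp add: dist_norm norm_minus_commute norm_mult)
  qed
qed

end

subsection \<open>The Brocard inellipse and the 3-periodics\<close>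

lemma circumscribed_ellipse_side:
  assumes "circumscribed T (ellipse F G a)" "dist F G < 2 * a" "A \<in> T" "B \<in> T" "A \<noteq> B"
  shows "(4 * a\<^sup>2 - (dist F G)\<^sup>2) * (dist A B)\<^sup>2 = 4 * orient A B F * orient A B G"
proof -
  obtain P where "ellipse F G a \<inter> affine hull {A, B} = {P}"
    using assms unfolding circumscribed_def by blast
  then show ?thesis using ellipse_tangent_iff[OF assms(2,5), of P] by blast
qed

lemma Re_of_real_times: "Re (of_real r * z) = r * Re z"
  by simp

text \<open>
  The side vector \<open>X - A\<close> of a chord of a circle with center 0 satisfies
  \<open>cnj (X - A) / (X - A) = - cnj (A * X) / r\<^sup>2\<close>, which makes the tangency condition linear in \<open>X\<close>.
\<close>

lemma tangent_chord_linear: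
  fixes A X F G :: complex
  assumes "cmod A = r" "cmod X = r" "A \<noteq> X"
    and "K * (dist A X)\<^sup>2 = 4 * orient A X F * orient A X G"
  shows "Re (cnj X * (cnj A * (F - A) * (G - A))) = r\<^sup>2 * (K / 2 - Re ((F - A) * cnj (G - A)))"
proof -
  define f where "f = F - A"
  define g where "g = G - A"
  define D where "D = X - A"
  define n where "n = (cmod D)\<^sup>2"
  have n: "of_real n = D * cnj D" by (simp add: n_def complex_norm_square del: of_real_power)
  have n0: "n \<noteq> 0" using assms(3) by (simp add: n_def D_def)
  have A: "A * cnj A = of_real (r\<^sup>2)" and X: "X * cnj X = of_real (r\<^sup>2)"
    using assms(1,2) complex_norm_square[of A] complex_norm_square[of X] by simp_all
  have D1: "D * (cnj A * cnj X) = - of_real (r\<^sup>2) * cnj D"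
  proof -
    have "D * (cnj A * cnj X) = cnj A * (X * cnj X) - (A * cnj A) * cnj X"
      by (simp add: D_def algebra_simps)
    then show ?thesis unfolding A X by (simp add: D_def algebra_simps)
  qed
  have D2: "of_real (r\<^sup>2) * (cnj D * cnj D) = - of_real n * (cnj A * cnj X)"
    unfolding n using arg_cong[OF D1, of "\<lambda>x. - (cnj D * x)"] by (simp add: mult_ac)
  have "K * n = 4 * Im (cnj D * f) * Im (cnj D * g)"
    using assms(4) by (simp add: n_def D_def f_def g_def orient_def dist_norm norm_minus_commute)
  \<comment> \<open>From \<open>2 * Im x * Im y = Re (x * cnj y) - Re (x * y)\<close>; only the
    second term involves the direction of \<open>D\<close>.\<close>
  also have "\<dots> = 2 * Re ((cnj D * f) * cnj (cnj D * g)) - 2 * Re ((cnj D * f) * (cnj D * g))"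
    by (simp add: algebra_simps)
  also have "(cnj D * f) * cnj (cnj D * g) = of_real n * (f * cnj g)"
    by (simp add: n)
  also have "Re \<dots> = n * Re (f * cnj g)" by (rule Re_of_real_times)
  finally have "r\<^sup>2 * (K * n) = 2 * r\<^sup>2 * (n * Re (f * cnj g)) - 2 * (r\<^sup>2 * Re ((cnj D * cnj D) * (f * g)))"
    by (simp only: right_diff_distrib mult_ac)
  also have "r\<^sup>2 * Re ((cnj D * cnj D) * (f * g)) = Re (of_real (r\<^sup>2) * (cnj D * cnj D) * (f * g))"
    by (simp only: mult.assoc Re_of_real_times)
  also have "\<dots> = - n * Re (cnj X * (cnj A * f * g))"
  proof -
    have "of_real (r\<^sup>2) * (cnj D * cnj D) * (f * g) = of_real (- n) * (cnj X * (cnj A * f * g))"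
      unfolding D2 by (simp add: mult_ac)
    then show ?thesis by (simp only: Re_of_real_times)
  qed
  finally have "n * (r\<^sup>2 * K) = n * (2 * r\<^sup>2 * Re (f * cnj g) + 2 * Re (cnj X * (cnj A * f * g)))"
    by (simp only: distrib_left mult_ac)
  then have "r\<^sup>2 * K = 2 * r\<^sup>2 * Re (f * cnj g) + 2 * Re (cnj X * (cnj A * f * g))"
    by (rule mult_left_cancel[THEN iffD1, OF n0])
  moreover have "v = R * (K / 2 - u)" if "R * K = 2 * R * u + 2 * v" for R u v :: real
    using that by (simp add: field_simps)
  ultimately show ?thesis unfolding f_def[symmetric] g_def[symmetric] by blast
qed

text \<open>Modulus and real part of \<open>cnj w * e\<close> are given, so its imaginary part is
  known up to sign.\<close>

lemma line_meets_circle_at_most_twice: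
  assumes "cmod x = r" "cmod y = r" "cmod z = r" "e \<noteq> 0"
    and "Re (cnj x * e) = c" "Re (cnj y * e) = c" "Re (cnj z * e) = c"
  shows "x = y \<or> x = z \<or> y = z"
proof -
  have im: "(Im (cnj w * e))\<^sup>2 = (r * cmod e)\<^sup>2 - c\<^sup>2" if "cmod w = r" "Re (cnj w * e) = c" for w
  proof -
    have "(cmod (cnj w * e))\<^sup>2 = (r * cmod e)\<^sup>2" using that(1) by (simp add: norm_mult)
    then show ?thesis unfolding cmod_power2 that(2) by linarith
  qed
  have "(Im (cnj x * e))\<^sup>2 = (Im (cnj y * e))\<^sup>2" "(Im (cnj x * e))\<^sup>2 = (Im (cnj z * e))\<^sup>2"
    using im assms by metis+
  then have "Im (cnj x * e) = Im (cnj y * e) \<or> Im (cnj x * e) = Im (cnj z * e) \<or>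
      Im (cnj y * e) = Im (cnj z * e)"
    by (metis power2_eq_iff)
  then have "cnj x * e = cnj y * e \<or> cnj x * e = cnj z * e \<or> cnj y * e = cnj z * e"
    unfolding complex_eq_iff by (simp only: assms simp_thms)
  then show ?thesis using \<open>e \<noteq> 0\<close> by simp
qed

section \<open>The common inellipse of the family and its 3-periodics\<close>

context moebius_triangle
begin

text \<open>The classical value \<open>R * sin omega\<close> of the semi-major axis, with
  circumradius \<open>R = cmod q\<close>.\<close>

definition semi :: real where "semi = cmod q * (1 - s\<^sup>2) / (2 * sqrt N)"

definition E :: "complex set" where "E = ellipse Om1 Om2 semi"

lemma semi: "4 * semi\<^sup>2 = (cmod q)\<^sup>2 * (1 - s\<^sup>2)\<^sup>2 / N" "semi > 0"
  using N_pos q s2 by (simp_all add: semi_def power_mult_distrib power_divide)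

lemma W_Om: "W (- zeta\<^sup>2 * of_real s) = N" "W (- zeta * of_real s) = N"
  unfolding W_def cmod_power2 N_def
  by (simp_all add: zeta_simps power_mult_distrib power_divide)
    (simp_all add: power2_eq_square power4_eq_xxxx field_simps)

lemma dist_Om: "(dist Om1 Om2)\<^sup>2 = 3 * (cmod q)\<^sup>2 * s\<^sup>2 * (1 - s\<^sup>2)\<^sup>2 / N\<^sup>2"
proof -
  have "- zeta\<^sup>2 * of_real s - - zeta * of_real s = - of_real s * (zeta\<^sup>2 - zeta)"
    by (simp add: algebra_simps)
  then have "(cmod (- zeta\<^sup>2 * of_real s - - zeta * of_real s))\<^sup>2 = s\<^sup>2 * 3"
    using norm_zeta_minus_1(2) by (simp only: norm_mult power_mult_distrib norm_minus_cancel norm_of_real power2_abs)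
  then show ?thesis
    unfolding dist_pnt[OF norm_s_le(3,2)] W_Om by (simp add: power2_eq_square mult_ac)
qed

text \<open>Four times the square of the semi-minor axis
  \<open>2 * R * (sin omega)^2\<close>.\<close>

lemma semi_minor: "4 * semi\<^sup>2 - (dist Om1 Om2)\<^sup>2 = (cmod q)\<^sup>2 * (1 - s\<^sup>2) ^ 4 / N\<^sup>2"
proof -
  have *: "N - 3 * s\<^sup>2 = (1 - s\<^sup>2)\<^sup>2"
    by (simp add: N_def power2_eq_square power4_eq_xxxx algebra_simps)
  have "x / N - x * y / N\<^sup>2 = x * (N - y) / N\<^sup>2" for x y
    using N_pos by (simp add: field_simps power2_eq_square)
  from this[of "(cmod q)\<^sup>2 * (1 - s\<^sup>2)\<^sup>2" "3 * s\<^sup>2"] show ?thesis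
    unfolding semi dist_Om * by (simp add: power2_eq_square power4_eq_xxxx mult_ac)
qed

lemma dist_Om_less: "dist Om1 Om2 < 2 * semi"
proof (rule power2_less_imp_less)
  have "0 < 4 * semi\<^sup>2 - (dist Om1 Om2)\<^sup>2"
    unfolding semi_minor using q s2 N_pos by simp
  then show "(dist Om1 Om2)\<^sup>2 < (2 * semi)\<^sup>2" by (simp add: power_mult_distrib)
qed (use semi(2) in simp)

lemma dist_side:
  assumes a: "cmod a = 1"
  shows "(dist (pnt a) (pnt (zeta * a)))\<^sup>2 * (W a * W (zeta * a)) = 3 * (cmod q)\<^sup>2 * (1 - s\<^sup>2)\<^sup>2"
proof -
  have "a - zeta * a = - (zeta - 1) * a" by (simp add: algebra_simps)
  then have "(cmod (a - zeta * a))\<^sup>2 = 3"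
    using norm_zeta_minus_1(1) a by (simp only: norm_mult norm_minus_cancel mult_1_right)
  then show ?thesis
    using a W_pos[of a] W_pos[of "zeta * a"] by (simp add: dist_pnt)
qed

lemma kappa_minor:
  "4 * (3 * (cmod q)\<^sup>2 * (1 - s\<^sup>2)\<^sup>2) * (Im kappa)\<^sup>2 = (cmod q)\<^sup>2 * (1 - s\<^sup>2) ^ 4 / N\<^sup>2"
proof -
  have "12 * (Im kappa)\<^sup>2 = (1 - s\<^sup>2)\<^sup>2 / N\<^sup>2"
    by (simp add: kappa_def power_divide power_mult_distrib)
  then have "(cmod q)\<^sup>2 * (1 - s\<^sup>2)\<^sup>2 * (12 * (Im kappa)\<^sup>2) = (cmod q)\<^sup>2 * ((1 - s\<^sup>2)\<^sup>2 * (1 - s\<^sup>2)\<^sup>2) / N\<^sup>2"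
    by simp
  also have "(1 - s\<^sup>2)\<^sup>2 * (1 - s\<^sup>2)\<^sup>2 = (1 - s\<^sup>2) ^ 4" by (simp flip: power_add)
  finally show ?thesis by (simp add: mult_ac)
qed

text \<open>The areas in \<open>orient_side\<close> carry the factors \<open>W (zeta * a)\<close>
  and \<open>W a\<close>, and the squared side is inversely proportional to their product. So the
  product of the focal distances from the side is independent of \<open>a\<close>, and one ellipse
  touches all sides.\<close>

lemma tangent_side:
  assumes a: "cmod a = 1"
  shows "(4 * semi\<^sup>2 - (dist Om1 Om2)\<^sup>2) * (dist (pnt a) (pnt (zeta * a)))\<^sup>2 =
    4 * orient (pnt a) (pnt (zeta * a)) Om1 * orient (pnt a) (pnt (zeta * a)) Om2"
proof -
  define d where "d = (dist (pnt a) (pnt (zeta * a)))\<^sup>2"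
  have "4 * semi\<^sup>2 - (dist Om1 Om2)\<^sup>2 = 4 * (d * (W a * W (zeta * a))) * (Im kappa)\<^sup>2"
    unfolding semi_minor d_def dist_side[OF a] kappa_minor ..
  then show ?thesis
    unfolding orient_side[OF a] d_def[symmetric] by (simp add: power2_eq_square mult_ac)
qed

lemma tangent_point_side:
  assumes a: "cmod a = 1"
  shows "\<exists>P\<in>open_segment (pnt a) (pnt (zeta * a)).
    E \<inter> affine hull {pnt a, pnt (zeta * a)} = {P}"
proof -
  define A where "A = pnt a"
  define B where "B = pnt (zeta * a)"
  define X where "X = W a"
  define Y where "Y = W (zeta * a)"
  have AB: "A \<noteq> B" using unit_distinct[OF a] by (simp add: A_def B_def)
  have XY: "X > 0" "Y > 0" using W_pos a by (simp_all add: X_def Y_def)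
  \<comment> \<open>With this ratio \<open>P - Om1\<close> and \<open>P - Om2\<close>, divided by
    the side vector, are conjugate up to real factors. Both focal radii then make equal angles with
    the side, which is the reflection property of the point of contact.\<close>
  define t where "t = Y / (X + Y)"
  have t: "0 < t" "t < 1" using XY by (simp_all add: t_def)
  define P where "P = A + of_real t * (B - A)"
  have seg: "P \<in> open_segment A B"
    using t AB unfolding in_segment P_def
    by (intro conjI exI[of _ t]) (simp_all add: scaleR_conv_of_real algebra_simps)
  then have hull: "P \<in> affine hull {A, B}"
    using convex_hull_subset_affine_hull by (auto simp: open_segment_def segment_convex_hull)
  have Om1: "Om1 = A + (B - A) * (of_real Y * kappa)"
    using Om1_side[OF a] by (simp add: A_def B_def Y_def algebra_simps)
  have Om2: "Om2 = B - (B - A) * (of_real X * cnj kappa)"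
    using Om2_side[OF a] by (simp add: A_def B_def X_def algebra_simps)
  define h where "h = cmod (1 - of_real (X + Y) * kappa)"
  have XYc: "of_real X + of_real Y \<noteq> (0 :: complex)"
    using XY by (metis add_pos_pos less_irrefl of_real_add of_real_eq_0_iff)
  have tc: "of_real t = of_real Y / (of_real X + of_real Y :: complex)" by (simp add: t_def)
  have "P - Om1 = (B - A) * of_real t * (1 - of_real (X + Y) * kappa)"
    unfolding P_def Om1 tc using XYc by (simp add: field_simps)
  then have d1: "dist P Om1 = dist A B * t * h"
    using t by (simp add: dist_norm norm_mult h_def norm_minus_commute del: of_real_add)
  have "P - Om2 = - (B - A) * of_real (1 - t) * cnj (1 - of_real (X + Y) * kappa)"
    unfolding P_def Om2 of_real_diff tc using XYc by (simp add: field_simps)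
  then have d2: "dist P Om2 = dist A B * (1 - t) * h"
    using t by (simp only: dist_norm norm_mult h_def norm_minus_cancel norm_of_real complex_mod_cnj
        abs_of_pos diff_gt_0_iff_gt norm_minus_commute[of A B])
  have sum: "dist P Om1 + dist P Om2 = dist A B * h"
    unfolding d1 d2 by (simp add: algebra_simps)
  \<comment> \<open>Unfolding the broken path from focus to focus by reflection in the side: its
    squared length exceeds the squared focal distance by four times the product of the distances of
    the foci from the side.\<close>
  have "(dist A B * h)\<^sup>2 = (dist Om1 Om2)\<^sup>2 + 4 * (dist A B)\<^sup>2 * (X * Y) * (Im kappa)\<^sup>2"
  proof -
    have "Om1 - Om2 = (B - A) * (of_real Y * kappa - 1 + of_real X * cnj kappa)"
      unfolding Om1 Om2 by (simp add: algebra_simps)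
    then have "(dist Om1 Om2)\<^sup>2 = (dist A B)\<^sup>2 * (cmod (of_real Y * kappa - 1 + of_real X * cnj kappa))\<^sup>2"
      by (simp add: dist_norm norm_mult power_mult_distrib norm_minus_commute)
    moreover have "h\<^sup>2 = (cmod (of_real Y * kappa - 1 + of_real X * cnj kappa))\<^sup>2 + 4 * (X * Y) * (Im kappa)\<^sup>2"
      unfolding h_def cmod_power2 by (simp add: power2_eq_square algebra_simps)
    ultimately show ?thesis by (simp add: power_mult_distrib algebra_simps)
  qed
  also have "4 * (dist A B)\<^sup>2 * (X * Y) * (Im kappa)\<^sup>2 = 4 * semi\<^sup>2 - (dist Om1 Om2)\<^sup>2"
    unfolding semi_minor A_def B_def X_def Y_def mult.assoc[of 4] dist_side[OF a]
    using kappa_minor by (simp add: mult.assoc)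
  finally have "(dist A B * h)\<^sup>2 = (2 * semi)\<^sup>2" by (simp add: power_mult_distrib)
  then have "dist A B * h = 2 * semi"
    by (rule power2_eq_imp_eq) (use semi(2) in \<open>simp_all add: h_def\<close>)
  then have "P \<in> ellipse Om1 Om2 semi" using sum by (simp add: ellipse_def)
  then have "E \<inter> affine hull {A, B} = {P}"
    using ellipse_tangent_iff[OF dist_Om_less AB] hull tangent_side[OF a]
    by (simp add: E_def A_def B_def)
  then show ?thesis using seg unfolding A_def B_def by blast
qed

lemma tri_edges:
  assumes a: "cmod a = 1" and AB: "A \<in> tri p q s a" "B \<in> tri p q s a" "A \<noteq> B"
  obtains b where "cmod b = 1" "A = pnt b \<and> B = pnt (zeta * b) \<or> B = pnt b \<and> A = pnt (zeta * b)"
proof -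
  have "(A = pnt a \<and> B = pnt (zeta * a) \<or> B = pnt a \<and> A = pnt (zeta * a)) \<or>
    (A = pnt (zeta * a) \<and> B = pnt (zeta * (zeta * a)) \<or> B = pnt (zeta * a) \<and> A = pnt (zeta * (zeta * a))) \<or>
    (A = pnt (zeta\<^sup>2 * a) \<and> B = pnt (zeta * (zeta\<^sup>2 * a)) \<or> B = pnt (zeta\<^sup>2 * a) \<and> A = pnt (zeta * (zeta\<^sup>2 * a)))"
    using AB unfolding tri_def tri_cycle by auto
  then show ?thesis using that a norm_multiples by metis
qed

lemma circumscribed_tri: "cmod a = 1 \<Longrightarrow> circumscribed (tri p q s a) E"
  unfolding circumscribed_def
proof (intro ballI impI)
  fix A B assume a: "cmod a = 1" and AB: "A \<in> tri p q s a" "B \<in> tri p q s a" "A \<noteq> B"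
  obtain b where "cmod b = 1" "A = pnt b \<and> B = pnt (zeta * b) \<or> B = pnt b \<and> A = pnt (zeta * b)"
    using tri_edges[OF a AB] .
  then show "\<exists>P\<in>open_segment A B. E \<inter> affine hull {A, B} = {P}"
    using tangent_point_side[of b] by (auto simp: insert_commute open_segment_commute)
qed

text \<open>For given foci, tangency to a single side already determines the axes.\<close>

lemma brocard_inellipse_tri:
  assumes a: "cmod a = 1"
  shows "brocard_inellipse (tri p q s a) = E"
  unfolding brocard_inellipse_def brocard_tri[OF a]
proof (rule the_equality)
  show "(\<exists>a. dist Om1 Om2 < 2 * a \<and> E = ellipse Om1 Om2 a) \<and> circumscribed (tri p q s a) E"
    using dist_Om_less circumscribed_tri[OF a] E_def by blast
next
  fix E' assume "(\<exists>a. dist Om1 Om2 < 2 * a \<and> E' = ellipse Om1 Om2 a) \<and> circumscribed (tri p q s a) E'"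
  then obtain b where b: "dist Om1 Om2 < 2 * b" "E' = ellipse Om1 Om2 b"
    and c: "circumscribed (tri p q s a) (ellipse Om1 Om2 b)" by blast
  have "(4 * b\<^sup>2 - (dist Om1 Om2)\<^sup>2) * (dist (pnt a) (pnt (zeta * a)))\<^sup>2 =
      (4 * semi\<^sup>2 - (dist Om1 Om2)\<^sup>2) * (dist (pnt a) (pnt (zeta * a)))\<^sup>2"
    unfolding tangent_side[OF a]
    by (rule circumscribed_ellipse_side[OF c b(1)]) (use unit_distinct[OF a] in \<open>simp_all add: tri_def\<close>)
  then have "b\<^sup>2 = semi\<^sup>2" using unit_distinct[OF a] by simp
  moreover have "b \<ge> 0" using b(1) zero_le_dist[of Om1 Om2] by linarith
  ultimately have "b = semi" by (rule power2_eq_imp_eq) (use semi(2) in simp)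
  then show "E' = E" using b by (simp add: E_def)
qed

lemma porism_of_tri: "cmod a = 1 \<Longrightarrow> porism_of (tri p q s a) = (sphere p (cmod q), E)"
  by (simp add: porism_of_def circumcircle_tri brocard_inellipse_tri)

text \<open>The excluded value \<open>m = 1 / s\<close> is the image of infinity, which reappears as
  the second isodynamic point.\<close>

lemma mob_inverse:
  assumes "1 - of_real s * m \<noteq> 0"
  shows "1 + of_real s * mob (- s) m = of_real (1 - s\<^sup>2) / (1 - of_real s * m)"
    and "mob s (mob (- s) m) = m"
proof -
  show e: "1 + of_real s * mob (- s) m = of_real (1 - s\<^sup>2) / (1 - of_real s * m)"
    using assms by (simp add: mob_def field_simps power2_eq_square)
  have c: "of_real (1 - s\<^sup>2) \<noteq> (0 :: complex)" using s2(3) by (metis less_irrefl of_real_eq_0_iff)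
  have "mob (- s) m + of_real s = m * of_real (1 - s\<^sup>2) / (1 - of_real s * m)"
    using assms by (simp add: mob_def field_simps power2_eq_square)
  then show "mob s (mob (- s) m) = m"
    unfolding mob_def[of s] e using assms c by simp
qed

lemma circle_point:
  assumes "A \<in> sphere p (cmod q)"
  obtains a where "cmod a = 1" "A = pnt a"
proof -
  define m where "m = (A - p) / q"
  have m: "cmod m = 1" using assms q by (simp add: m_def norm_divide dist_norm norm_minus_commute)
  have "1 - of_real s * m \<noteq> 0" using denom_nz[of "- m"] m by simp
  then have "A = pnt (mob (- s) m)" using q by (simp add: pt_def mob_inverse m_def)
  moreover have "cmod (mob (- s) m) = 1" using norm_mob[OF m, of "- s"] s by simp
  ultimately show ?thesis using that by blast
qed

lemma three_periodics_tri:
  "three_periodics (sphere p (cmod q), E) = tri p q s ` sphere 0 1"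
proof (intro equalityI subsetI)
  fix T assume "T \<in> tri p q s ` sphere 0 1"
  then obtain a where "cmod a = 1" "T = tri p q s a" by auto
  then show "T \<in> three_periodics (sphere p (cmod q), E)"
    using triangle_tri[of a] tri_subset_circle[of a] circumscribed_tri[of a]
    unfolding three_periodics_def by simp
next
  fix T assume "T \<in> three_periodics (sphere p (cmod q), E)"
  then have T: "triangle T" "T \<subseteq> sphere p (cmod q)" "circumscribed T (ellipse Om1 Om2 semi)"
    by (auto simp: three_periodics_def E_def)
  obtain A B C where ABC: "T = {A, B, C}" "A \<noteq> B" "A \<noteq> C" "B \<noteq> C"
    using T(1) unfolding triangle_def by (metis card_3_iff)
  obtain a where a: "cmod a = 1" and A: "A = pnt a"
    using circle_point T(2) ABC(1) by (metis insertI1 subsetD)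
  define B0 where "B0 = pnt (zeta * a)"
  define C0 where "C0 = pnt (zeta\<^sup>2 * a)"
  have T0: "tri p q s a = {A, B0, C0}" by (simp add: tri_def A B0_def C0_def)
  have ne0: "A \<noteq> B0" "A \<noteq> C0" "B0 \<noteq> C0"
    using unit_distinct[OF a] by (auto simp: A B0_def C0_def)
  define K where "K = 4 * semi\<^sup>2 - (dist Om1 Om2)\<^sup>2"
  \<comment> \<open>The normal vector, up to scaling, of the line that contains the second ends of
    all tangent chords from \<open>A\<close>. It is nonzero because \<open>A\<close> is not a
    Brocard point.\<close>
  define e where "e = cnj (A - p) * (Om1 - A) * (Om2 - A)"
  have OmA: "Om1 \<noteq> A" "Om2 \<noteq> A"
    using orient_side_pos[OF a] by (auto simp: A orient_def)
  have Ap: "cmod (A - p) = cmod q" using T(2) ABC(1) by (auto simp: dist_norm norm_minus_commute)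
  then have e: "e \<noteq> 0" using OmA q by (auto simp: e_def)
  define c where "c = (cmod q)\<^sup>2 * (K / 2 - Re ((Om1 - A) * cnj (Om2 - A)))"
  have shift: "orient (u - p) (v - p) (w - p) = orient u v w" for u v w by (simp add: orient_def)
  \<comment> \<open>Applied to \<open>T\<close> and to \<open>tri p q s a\<close>, this puts
    \<open>B\<close>, \<open>C\<close>, \<open>B0\<close>, \<open>C0\<close> on one line and one
    circle, so the two pairs agree.\<close>
  have lin: "cmod (X - p) = cmod q \<and> Re (cnj (X - p) * e) = c"
    if S: "circumscribed S (ellipse Om1 Om2 semi)" "S \<subseteq> sphere p (cmod q)" "A \<in> S" "X \<in> S" "A \<noteq> X" for X S
  proof
    show Xp: "cmod (X - p) = cmod q" using S by (auto simp: dist_norm norm_minus_commute)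
    have "K * (dist A X)\<^sup>2 = 4 * orient A X Om1 * orient A X Om2"
      using circumscribed_ellipse_side[OF S(1) dist_Om_less S(3,4,5)] by (simp add: K_def)
    then have "Re (cnj (X - p) * (cnj (A - p) * (Om1 - p - (A - p)) * (Om2 - p - (A - p)))) =
        (cmod q)\<^sup>2 * (K / 2 - Re ((Om1 - p - (A - p)) * cnj (Om2 - p - (A - p))))"
      using S(5) by (intro tangent_chord_linear[OF Ap Xp]) (simp_all add: shift dist_norm)
    then show "Re (cnj (X - p) * e) = c" by (simp add: e_def c_def)
  qed
  have lB: "cmod (B - p) = cmod q \<and> Re (cnj (B - p) * e) = c"
    "cmod (C - p) = cmod q \<and> Re (cnj (C - p) * e) = c"
    using lin[OF T(3,2)] ABC by simp_all
  have lB0: "cmod (B0 - p) = cmod q \<and> Re (cnj (B0 - p) * e) = c"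
    "cmod (C0 - p) = cmod q \<and> Re (cnj (C0 - p) * e) = c"
    using lin[OF circumscribed_tri[OF a, unfolded E_def] tri_subset_circle[OF a]] ne0 unfolding T0 by simp_all
  have "B - p = B0 - p \<or> B - p = C0 - p \<or> B0 - p = C0 - p"
    "C - p = B0 - p \<or> C - p = C0 - p \<or> B0 - p = C0 - p"
    using lB lB0 e by (intro line_meets_circle_at_most_twice[where r = "cmod q" and e = e and c = c]; simp)+
  then have "T = tri p q s a" unfolding T0 ABC(1) using ABC(4) ne0(3) by auto
  then show "T \<in> tri p q s ` sphere 0 1" using a by auto
qed

lemma porism_attribute_tri:
  assumes "\<And>a. cmod a = 1 \<Longrightarrow> f (tri p q s a) = v"
  shows "porism_attribute f (sphere p (cmod q), E) = v"
  unfolding porism_attribute_def three_periodics_tri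
proof (rule the_equality)
  show "\<forall>T\<in>tri p q s ` sphere 0 1. f T = v" using assms by auto
  fix x assume "\<forall>T\<in>tri p q s ` sphere 0 1. f T = x"
  then show "x = v" using assms[of 1] by auto
qed

lemma eccentricity_E: "eccentricity E = sqrt 3 * s / sqrt N"
proof -
  have "dist Om1 Om2 = sqrt ((sqrt 3 * cmod q * s * (1 - s\<^sup>2) / N)\<^sup>2)"
    using dist_Om by (simp add: power_mult_distrib power_divide real_sqrt_unique)
  then have d: "dist Om1 Om2 = sqrt 3 * cmod q * s * (1 - s\<^sup>2) / N" using s s2 N_pos by simp
  have "N = sqrt N * sqrt N" using N_pos by simp
  then have "dist Om1 Om2 / (2 * semi) = sqrt 3 * s / sqrt N"
    unfolding d semi_def using q s2 N_pos by (simp add: divide_simps)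
  then show ?thesis unfolding E_def eccentricity_ellipse[OF dist_Om_less] .
qed

end

subsection \<open>Isodynamic points and the second Brocard triangle\<close>

lemma unit_diff:
  assumes "cmod b = 1"
  shows "(cmod (b - zeta * b))\<^sup>2 = 3" "(cmod (b - zeta\<^sup>2 * b))\<^sup>2 = 3" "(cmod (zeta * b - zeta\<^sup>2 * b))\<^sup>2 = 3"
proof -
  have e: "b - zeta * b = - (zeta - 1) * b" "b - zeta\<^sup>2 * b = - (zeta\<^sup>2 - 1) * b"
    "zeta * b - zeta\<^sup>2 * b = - (zeta\<^sup>2 - zeta) * b"
    by (simp_all add: algebra_simps)
  have "(cmod (zeta\<^sup>2 - 1))\<^sup>2 = 3"
    by (simp add: cmod_power2 zeta_simps) (simp add: power2_eq_square field_simps)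
  then show "(cmod (b - zeta * b))\<^sup>2 = 3" "(cmod (b - zeta\<^sup>2 * b))\<^sup>2 = 3" "(cmod (zeta * b - zeta\<^sup>2 * b))\<^sup>2 = 3"
    using norm_zeta_minus_1 assms unfolding e by (simp_all only: norm_mult norm_minus_cancel mult_1_right)
qed

text \<open>After a rotation taking \<open>a\<close> to 1, equal distances mean that
  \<open>x\<close>, \<open>zeta * x\<close>, \<open>zeta^2 * x\<close> have equal real parts; these
  sum to 0, so all vanish.\<close>

lemma equidistant_imp_0:
  assumes a: "cmod a = 1"
    and "(cmod (w - a))\<^sup>2 = (cmod (w - zeta * a))\<^sup>2" "(cmod (w - a))\<^sup>2 = (cmod (w - zeta\<^sup>2 * a))\<^sup>2"
  shows "w = 0"
proof -
  define x where "x = w * cnj a"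
  have ex: "(cmod (w - b))\<^sup>2 = (cmod w)\<^sup>2 + 1 - 2 * Re (w * cnj b)" if "cmod b = 1" for b
  proof -
    have "(cmod b)\<^sup>2 = 1" using that by simp
    then show ?thesis unfolding cmod_power2 by (simp add: power2_eq_square algebra_simps)
  qed
  have n: "cmod (zeta * a) = 1" "cmod (zeta\<^sup>2 * a) = 1"
    using a by (simp_all add: norm_mult norm_power zeta_simps)
  have e: "w * cnj (zeta * a) = zeta\<^sup>2 * x" "w * cnj (zeta\<^sup>2 * a) = zeta * x"
    by (simp_all add: x_def zeta_simps zeta_cube flip: power_mult)
  then have "Re x = Re (zeta\<^sup>2 * x)" "Re x = Re (zeta * x)"
    using assms(2,3) unfolding ex[OF a] ex[OF n(1)] ex[OF n(2)] e x_def[symmetric] by simp_all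
  then have "Re x = - Re x / 2 + sqrt 3 / 2 * Im x" "Re x = - Re x / 2 - sqrt 3 / 2 * Im x"
    unfolding times_complex.sel by (simp_all add: zeta_simps)
  then have "Re x = 0" "sqrt 3 * Im x = 0" by linarith+
  then have "x = 0" by (simp add: complex_eq_iff)
  then show ?thesis using a by (auto simp: x_def)
qed

text \<open>The second point is the mirror image of \<open>S\<close> in the diameter perpendicular
  to the line. On a tangent the two points coincide, which is the special case in
  \<open>second_brocard_vertex\<close>.\<close>

lemma circle_line_second_point:
  assumes "A \<noteq> S" "cmod (S - c) = r"
  shows "sphere c r \<inter> affine hull {A, S} = {S, c - cnj (S - c) * (S - A) / cnj (S - A)}"
proof -
  define u where "u = S - c"
  define d where "d = S - A"
  define m where "m = (cmod d)\<^sup>2"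
  have d: "d \<noteq> 0" and m: "m > 0" using assms(1) by (simp_all add: d_def m_def)
  have r: "r \<ge> 0" "r\<^sup>2 = (cmod u)\<^sup>2" using assms(2) by (auto simp: u_def)
  define b where "b = 2 * Re (u * cnj d)"
  have line: "affine hull {A, S} = range (\<lambda>t. S + of_real t * d)"
  proof -
    have "affine hull {A, S} = range (\<lambda>t. S + t *\<^sub>R (A - S))"
      by (subst insert_commute) (rule affine_hull_2_alt)
    also have "\<dots> = range (\<lambda>t. S + of_real t * d)"
    proof (intro equalityI image_subsetI)
      fix t show "S + t *\<^sub>R (A - S) \<in> range (\<lambda>t. S + of_real t * d)"
        by (rule range_eqI[of _ _ "- t"]) (simp add: d_def scaleR_conv_of_real algebra_simps)
      show "S + of_real t * d \<in> range (\<lambda>t. S + t *\<^sub>R (A - S))"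
        by (rule range_eqI[of _ _ "- t"]) (simp add: d_def scaleR_conv_of_real algebra_simps)
    qed
    finally show ?thesis .
  qed
  have on: "S + of_real t * d \<in> sphere c r \<longleftrightarrow> t = 0 \<or> t = - b / m" for t
  proof -
    have "(cmod (S + of_real t * d - c))\<^sup>2 = r\<^sup>2 + t * (b + t * m)"
      unfolding r(2) m_def cmod_power2 b_def u_def by (simp add: power2_eq_square algebra_simps)
    moreover have "S + of_real t * d \<in> sphere c r \<longleftrightarrow> (cmod (S + of_real t * d - c))\<^sup>2 = r\<^sup>2"
      using r(1) by (simp add: dist_norm norm_minus_commute)
    ultimately have "S + of_real t * d \<in> sphere c r \<longleftrightarrow> t = 0 \<or> b + t * m = 0" by simp
    also have "b + t * m = 0 \<longleftrightarrow> t = - b / m" using m by (simp add: field_simps) linarith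
    finally show ?thesis .
  qed
  have second: "S + of_real (- b / m) * d = c - cnj u * d / cnj d"
  proof -
    have "of_real b = u * cnj d + cnj u * d"
      by (simp add: b_def complex_eq_iff algebra_simps)
    moreover have "of_real m = d * cnj d" by (simp add: m_def complex_norm_square del: of_real_power)
    ultimately have "of_real (- b / m) * d = - (u * cnj d + cnj u * d) / cnj d"
      using d by (simp add: field_simps)
    then have "of_real (- b / m) * d = - u - cnj u * d / cnj d"
      using d by (simp add: field_simps)
    then show ?thesis by (simp add: u_def)
  qed
  have "sphere c r \<inter> affine hull {A, S} = (\<lambda>t. S + of_real t * d) ` {0, - b / m}"
    unfolding line using on by blast
  also have "\<dots> = {S, c - cnj u * d / cnj d}"
    using second by simp
  finally show ?thesis by (simp only: u_def d_def)
qed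

section \<open>Isodynamic points, then the image under the second Brocard construction\<close>

context moebius_triangle
begin

text \<open>Squared distances proportional to \<open>1 / W b\<close> are inversely proportional to
  the squares of the opposite sides, which is the isodynamic property.\<close>

lemma isodynamicI:
  assumes a: "cmod a = 1" and k: "\<And>b. cmod b = 1 \<Longrightarrow> (dist P (pnt b))\<^sup>2 = k / W b"
  shows "P \<in> isodynamic_points (tri p q s a)"
proof -
  have eq: "dist P (pnt y) * dist (pnt x) (pnt z) = dist P (pnt z) * dist (pnt x) (pnt y)"
    if "cmod x = 1" "cmod y = 1" "cmod z = 1" "(cmod (x - y))\<^sup>2 = 3" "(cmod (x - z))\<^sup>2 = 3" for x y z
  proof -
    have "(dist P (pnt y) * dist (pnt x) (pnt z))\<^sup>2 = (dist P (pnt z) * dist (pnt x) (pnt y))\<^sup>2"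
      using that by (simp add: power_mult_distrib k dist_pnt mult_ac)
    then show ?thesis by (rule power2_eq_imp_eq) simp_all
  qed
  have "P \<in> apollonius_circle A B C" if T: "tri p q s a = {A, B, C}" for A B C
  proof -
    obtain b where b: "cmod b = 1" "A = pnt b"
      "(B = pnt (zeta * b) \<and> C = pnt (zeta\<^sup>2 * b)) \<or> (B = pnt (zeta\<^sup>2 * b) \<and> C = pnt (zeta * b))"
      using tri_labelling[OF a T] by blast
    have "dist P (pnt (zeta * b)) * dist (pnt b) (pnt (zeta\<^sup>2 * b)) =
        dist P (pnt (zeta\<^sup>2 * b)) * dist (pnt b) (pnt (zeta * b))"
      using b(1) unit_diff[OF b(1)] by (intro eq) simp_all
    then show ?thesis using b(2,3) by (auto simp: apollonius_circle_def)
  qed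
  then show ?thesis unfolding isodynamic_points_def by blast
qed

text \<open>For the preimage \<open>w\<close> of \<open>P\<close> the factors \<open>W\<close>
  cancel from the Apollonius conditions; what remains is that \<open>w\<close> is equidistant from
  the vertices of an equilateral triangle.\<close>

lemma isodynamic_points_tri:
  assumes a: "cmod a = 1" and s0: "s > 0"
  shows "isodynamic_points (tri p q s a) = {p + q * of_real s, p + q / of_real s}"
proof (intro equalityI subsetI)
  fix P assume P: "P \<in> isodynamic_points (tri p q s a)"
  define m where "m = (P - p) / q"
  have Pm: "P = p + q * m" using q by (simp add: m_def)
  show "P \<in> {p + q * of_real s, p + q / of_real s}"
  \<comment> \<open>In the first case the preimage of \<open>P\<close> is infinity.\<close>
  proof (cases "1 - of_real s * m = 0")
    case True
    then have "m = 1 / of_real s" using s0 by (simp add: field_simps)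
    then show ?thesis by (simp add: Pm)
  next
    case False
    define w where "w = mob (- s) m"
    have c: "of_real (1 - s\<^sup>2) \<noteq> (0 :: complex)" using s2(3) by (metis less_irrefl of_real_eq_0_iff)
    have w: "1 + of_real s * w \<noteq> 0" "P = pnt w"
      using mob_inverse[OF False] False c by (simp_all add: w_def Pm pt_def)
    define k where "k = (cmod q)\<^sup>2 * (1 - s\<^sup>2)\<^sup>2 / W w"
    have Ww: "W w > 0" using w(1) by (simp add: W_def)
    have k: "k > 0" using Ww q s2 by (simp add: k_def)
    have dP: "(dist P (pnt b))\<^sup>2 = k * (cmod (w - b))\<^sup>2 / W b" if b: "cmod b = 1" for b
    proof -
      have "P - pnt b = q * ((w - b) * of_real (1 - s\<^sup>2) / ((1 + of_real s * w) * (1 + of_real s * b)))"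
        using mob_diff[OF w(1) denom_nz[of b]] b by (simp add: w(2) pt_def flip: right_diff_distrib)
      then have "dist P (pnt b) = cmod q * (cmod (w - b) * \<bar>1 - s\<^sup>2\<bar> / (cmod (1 + of_real s * w) * cmod (1 + of_real s * b)))"
        by (simp only: dist_norm norm_mult norm_divide norm_of_real)
      then show ?thesis
        by (simp add: k_def W_def power_mult_distrib power_divide)
    qed
    have eq: "(cmod (w - y))\<^sup>2 = (cmod (w - z))\<^sup>2"
      if T: "tri p q s a = {pnt x, pnt y, pnt z}"
        and n: "cmod x = 1" "cmod y = 1" "cmod z = 1" "(cmod (x - y))\<^sup>2 = 3" "(cmod (x - z))\<^sup>2 = 3" for x y z
    proof -
      have "P \<in> apollonius_circle (pnt x) (pnt y) (pnt z)"
        using P T unfolding isodynamic_points_def by blast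
      then have "(dist P (pnt y) * dist (pnt x) (pnt z))\<^sup>2 = (dist P (pnt z) * dist (pnt x) (pnt y))\<^sup>2"
        by (simp add: apollonius_circle_def)
      then have "k * (cmod (w - y))\<^sup>2 / W y * ((cmod q)\<^sup>2 * 3 * (1 - s\<^sup>2)\<^sup>2 / (W x * W z)) =
          k * (cmod (w - z))\<^sup>2 / W z * ((cmod q)\<^sup>2 * 3 * (1 - s\<^sup>2)\<^sup>2 / (W x * W y))"
        unfolding power_mult_distrib using n by (simp add: dP dist_pnt)
      then have "(cmod (w - y))\<^sup>2 * (k * ((cmod q)\<^sup>2 * 3 * (1 - s\<^sup>2)\<^sup>2) / (W x * W y * W z)) =
          (cmod (w - z))\<^sup>2 * (k * ((cmod q)\<^sup>2 * 3 * (1 - s\<^sup>2)\<^sup>2) / (W x * W y * W z))"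
        by (simp add: mult_ac)
      moreover have "k * ((cmod q)\<^sup>2 * 3 * (1 - s\<^sup>2)\<^sup>2) / (W x * W y * W z) > 0"
        using k q s2 W_pos[of x] W_pos[of y] W_pos[of z] n by simp
      ultimately show ?thesis by (metis less_irrefl mult_cancel_right)
    qed
    have "(cmod (w - a))\<^sup>2 = (cmod (w - zeta * a))\<^sup>2"
      by (rule eq[of "zeta\<^sup>2 * a"])
        (use a unit_diff[OF a] in \<open>auto simp: tri_def norm_minus_commute\<close>)
    moreover have "(cmod (w - a))\<^sup>2 = (cmod (w - zeta\<^sup>2 * a))\<^sup>2"
      by (rule eq[of "zeta * a"])
        (use a unit_diff[OF a] in \<open>auto simp: tri_def norm_minus_commute\<close>)
    ultimately have "w = 0" by (rule equidistant_imp_0[OF a])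
    then show ?thesis by (simp add: w(2) pt_def mob_def)
  qed
next
  fix P assume "P \<in> {p + q * of_real s, p + q / of_real s}"
  then consider "P = pnt 0" | "P = p + q / of_real s" by (auto simp: pt_def mob_def)
  then show "P \<in> isodynamic_points (tri p q s a)"
  proof cases
    case 1
    show ?thesis
    proof (rule isodynamicI[OF a])
      fix b :: complex assume "cmod b = 1"
      then show "(dist P (pnt b))\<^sup>2 = (cmod q)\<^sup>2 * (1 - s\<^sup>2)\<^sup>2 / W b"
        unfolding 1 by (subst dist_pnt) (simp_all add: W_def)
    qed
  next
    case 2
    show ?thesis
    proof (rule isodynamicI[OF a])
      fix b :: complex assume b: "cmod b = 1"
      have nz: "1 + of_real s * b \<noteq> 0" using denom_nz b by simp
      have "P - pnt b = q * (of_real (1 - s\<^sup>2) / (of_real s * (1 + of_real s * b)))"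
        unfolding 2 pt_def mob_def using nz s0 by (simp add: field_simps power2_eq_square)
      then have "dist P (pnt b) = cmod q * (\<bar>1 - s\<^sup>2\<bar> / (\<bar>s\<bar> * cmod (1 + of_real s * b)))"
        by (simp only: dist_norm norm_mult norm_divide norm_of_real)
      then show "(dist P (pnt b))\<^sup>2 = (cmod q)\<^sup>2 * (1 - s\<^sup>2)\<^sup>2 / s\<^sup>2 / W b"
        by (simp add: W_def power_mult_distrib power_divide)
    qed
  qed
qed

lemma isodynamic_tri:
  assumes a: "cmod a = 1" and s0: "s > 0"
  shows "isodynamic1 (tri p q s a) = p + q * of_real s" "isodynamic2 (tri p q s a) = p + q / of_real s"
proof -
  have q0: "cmod q > 0" using q by simp
  show *: "isodynamic1 (tri p q s a) = p + q * of_real s"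
    unfolding isodynamic1_def isodynamic_points_tri[OF a s0] circumcircle_tri[OF a] circle_radius_sphere[OF q0]
  proof (rule the_equality)
    show "p + q * of_real s \<in> {p + q * of_real s, p + q / of_real s} \<and> p + q * of_real s \<in> ball p (cmod q)"
      using q s by (simp add: dist_norm norm_mult)
    fix P assume P: "P \<in> {p + q * of_real s, p + q / of_real s} \<and> P \<in> ball p (cmod q)"
    have "p + q / of_real s \<notin> ball p (cmod q)"
      using q s s0 by (simp add: dist_norm norm_divide field_simps)
    with P show "P = p + q * of_real s" by blast
  qed
  have d: "dist (p + q * of_real s) p = cmod q * s" using s by (simp add: dist_norm norm_mult)
  have "(cmod q / (cmod q * s))\<^sup>2 *\<^sub>R (p + q * of_real s - p) = q / of_real s"
    using q s0 by (simp add: scaleR_conv_of_real power2_eq_square)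
  then show "isodynamic2 (tri p q s a) = p + q / of_real s"
    unfolding isodynamic2_def circumcircle_tri[OF a] * circle_inverse_def Let_def
      circle_radius_sphere[OF q0] circle_center_sphere[OF q0] d by simp
qed

text \<open>Conjugation replaces the unit \<open>b\<close> by \<open>1 / b\<close>, so the direction
  quotient of the line from \<open>pnt b\<close> to \<open>X6\<close> collects
  \<open>(s - b) * (s + b)\<close> over \<open>(1 + s * b) * (s * b - 1)\<close>. This is the origin
  of the squares \<open>s^2\<close> and \<open>b^2\<close>.\<close>

lemma second_brocard_vertex_tri:
  assumes a: "cmod a = 1" and s0: "s > 0" and b: "cmod b = 1"
  shows "second_brocard_vertex (tri p q s a) (pnt b) =
    pt (p + q * of_real rho) (q * of_real rho) (s\<^sup>2) (- b\<^sup>2)"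
proof -
  note K = brocard_circle_tri[OF a s0]
  define c where "c = p + q * of_real rho"
  define S' where "S' = c - cnj (X6 - c) * (X6 - pnt b) / cnj (X6 - pnt b)"
  have Xc: "X6 - c = q * of_real rho" unfolding K(4) c_def by simp
  have nz: "1 + of_real s * b \<noteq> 0" "1 - of_real s * b \<noteq> 0"
    using b denom_nz[of b] denom_nz[of "- b"] by simp_all
  have c0: "of_real (1 - s\<^sup>2) \<noteq> (0 :: complex)" using s2(3) by (metis less_irrefl of_real_eq_0_iff)
  have sb: "of_real s \<noteq> b" using b s by auto
  define g where "g = of_real (1 - s\<^sup>2) / (1 + complex_of_real s * of_real s)"
  have g: "g \<noteq> 0" "cnj g = g" using c0 one_plus_s2(2) by (simp_all add: g_def)
  have Xb: "X6 - pnt b = q * g * ((of_real s - b) / (1 + of_real s * b))"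
    unfolding X6_diff[OF b] g_def by simp
  have ne: "pnt b \<noteq> X6"
  proof -
    have "X6 - pnt b \<noteq> 0" unfolding Xb using q g sb nz by simp
    then show ?thesis by auto
  qed
  have int: "brocard_circle (tri p q s a) \<inter> affine hull {pnt b, X6} = {X6, S'}"
    unfolding K(1) S'_def c_def[symmetric]
    by (rule circle_line_second_point[OF ne]) (use K(2) in \<open>simp add: Xc norm_mult\<close>)
  have "second_brocard_vertex (tri p q s a) (pnt b) = S'"
  proof (cases "S' = X6")
    case True
    then show ?thesis
      unfolding second_brocard_vertex_def Let_def symmedian_point_tri[OF a] int by simp
  next
    case False
    have "(THE P. P \<in> {X6, S'} \<and> P \<noteq> X6) = S'" using False by (intro the_equality) auto
    moreover have "{X6, S'} \<noteq> {X6}" using False by auto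
    ultimately show ?thesis
      unfolding second_brocard_vertex_def Let_def symmedian_point_tri[OF a] int by simp
  qed
  also have "S' = pt c (q * of_real rho) (s\<^sup>2) (- b\<^sup>2)"
  proof -
    define b' where "b' = cnj b"
    have bb: "b * b' = 1" using unit_cnj[OF b] by (simp add: b'_def)
    have nz': "1 + of_real s * b' \<noteq> 0" "of_real s \<noteq> b'" "1 - of_real (s\<^sup>2) * b\<^sup>2 \<noteq> 0"
      "of_real s * b - 1 \<noteq> 0"
    proof -
      show "1 + of_real s * b' \<noteq> 0" using denom_nz[of b'] b by (simp add: b'_def)
      show "of_real s \<noteq> b'"
      proof
        assume "of_real s = b'"
        then have "cmod (of_real s) = cmod b" by (simp only: b'_def complex_mod_cnj)
        then show False using b s by simp
      qed
      have "1 - of_real (s\<^sup>2) * b\<^sup>2 = (1 + of_real s * b) * (1 - of_real s * b)"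
        by (simp add: power2_eq_square algebra_simps)
      then show "1 - of_real (s\<^sup>2) * b\<^sup>2 \<noteq> 0" using nz by simp
      show "of_real s * b - 1 \<noteq> 0" using nz(2) by auto
    qed
    have "cnj (X6 - c) * (X6 - pnt b) / cnj (X6 - pnt b) =
        q * of_real rho * ((of_real s - b) * (1 + of_real s * b') / ((1 + of_real s * b) * (of_real s - b')))"
    proof -
      define h where "h = (of_real s - b) / (1 + of_real s * b)"
      have ch: "cnj h = (of_real s - b') / (1 + of_real s * b')" by (simp add: h_def b'_def)
      have "cnj (X6 - c) * (X6 - pnt b) / cnj (X6 - pnt b) = q * of_real rho * (h / cnj h)"
        unfolding Xc Xb h_def[symmetric] using q g by simp
      then show ?thesis unfolding ch unfolding h_def by (simp add: mult_ac)
    qed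
    also have "(of_real s - b) * (1 + of_real s * b') / ((1 + of_real s * b) * (of_real s - b')) =
        (of_real s - b) * (b + of_real s) / ((1 + of_real s * b) * (of_real s * b - 1))"
    proof -
      have "(1 + of_real s * b') * (of_real s * b - 1) = (b + of_real s) * (of_real s - b')"
        using bb by algebra
      then show ?thesis using nz nz' by (simp add: frac_eq_eq mult_ac)
    qed
    also have "\<dots> = - mob (s\<^sup>2) (- b\<^sup>2)"
    proof -
      have e: "(of_real s - b) * (b + of_real s) = of_real (s\<^sup>2) - b\<^sup>2"
        "(1 + of_real s * b) * (of_real s * b - 1) = - (1 - of_real (s\<^sup>2) * b\<^sup>2)"
        by (simp_all add: power2_eq_square algebra_simps)
      show ?thesis unfolding e mob_def divide_minus_right by simp
    qed
    finally show ?thesis by (simp add: S'_def pt_def)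
  qed
  finally show ?thesis by (simp add: c_def)
qed

text \<open>Squaring interchanges \<open>zeta\<close> and \<open>zeta^2\<close>, which reverses the
  labelling but leaves the vertex set in normal form.\<close>

lemma second_brocard_triangle_tri:
  assumes a: "cmod a = 1" and s0: "s > 0"
  shows "second_brocard_triangle (tri p q s a) =
    tri (p + q * of_real rho) (q * of_real rho) (s\<^sup>2) (- a\<^sup>2)"
proof -
  have n: "cmod (zeta * a) = 1" "cmod (zeta\<^sup>2 * a) = 1" using a by simp_all
  have sq: "- (zeta * a)\<^sup>2 = zeta\<^sup>2 * - a\<^sup>2" "- (zeta\<^sup>2 * a)\<^sup>2 = zeta * - a\<^sup>2"
    using zeta_cube(4) by (simp_all add: power_mult_distrib flip: power_mult)
  define v where "v = second_brocard_vertex (tri p q s a)"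
  have "second_brocard_triangle (tri p q s a) = v ` tri p q s a"
    by (simp add: second_brocard_triangle_def v_def)
  also have "\<dots> = {v (pnt a), v (pnt (zeta * a)), v (pnt (zeta\<^sup>2 * a))}"
    by (simp add: tri_def)
  also have "\<dots> = tri (p + q * of_real rho) (q * of_real rho) (s\<^sup>2) (- a\<^sup>2)"
    unfolding v_def second_brocard_vertex_tri[OF a s0 a] second_brocard_vertex_tri[OF a s0 n(1)]
      second_brocard_vertex_tri[OF a s0 n(2)] sq
    by (simp only: tri_def insert_commute)
  finally show ?thesis .
qed

end

subsection \<open>Every triangle is a Moebius image of an equilateral one\<close>

text \<open>The two nontrivial Fourier coefficients of a triangle are compared by its signed area;
  in counterclockwise order this bounds the Moebius parameter by 1.\<close>

lemma dft_norm_diff: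
  "(cmod (A + zeta\<^sup>2 * B + zeta * C))\<^sup>2 - (cmod (A + zeta * B + zeta\<^sup>2 * C))\<^sup>2 =
    2 * sqrt 3 * orient A B C"
proof -
  have e: "Re (A + zeta\<^sup>2 * B + zeta * C) = Re A - Re B / 2 + sqrt 3 / 2 * Im B - Re C / 2 - sqrt 3 / 2 * Im C"
    "Im (A + zeta\<^sup>2 * B + zeta * C) = Im A - Im B / 2 - sqrt 3 / 2 * Re B - Im C / 2 + sqrt 3 / 2 * Re C"
    "Re (A + zeta * B + zeta\<^sup>2 * C) = Re A - Re B / 2 - sqrt 3 / 2 * Im B - Re C / 2 + sqrt 3 / 2 * Im C"
    "Im (A + zeta * B + zeta\<^sup>2 * C) = Im A - Im B / 2 + sqrt 3 / 2 * Re B - Im C / 2 - sqrt 3 / 2 * Re C"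
    by (simp_all add: zeta_simps)
  show ?thesis
    unfolding cmod_power2 e orient_def
    by (simp add: power2_eq_square algebra_simps)
qed

text \<open>
  A Moebius map \<open>w \<mapsto> (\<alpha> * w + \<beta>) / (1 + g * w)\<close> sends \<open>1\<close>, \<open>zeta\<close>, \<open>zeta\<^sup>2\<close> to \<open>A\<close>, \<open>B\<close>, \<open>C\<close> iff
  the discrete Fourier transform of the three values \<open>A * (1 + g)\<close>, \<open>B * (1 + g * zeta)\<close>,
  \<open>C * (1 + g * zeta\<^sup>2)\<close> has no component at \<open>w\<^sup>2\<close>; this determines \<open>g\<close>.
\<close>

lemma moebius_normal_form:
  assumes "triangle T"
  obtains p q s a where "moebius_triangle q s" "cmod a = 1" "T = tri p q s a"
proof -
  \<comment> \<open>Transposing \<open>B\<close> and \<open>C\<close> interchanges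
    \<open>num\<close> and \<open>den\<close>, so the orientation decides whether the quotient has
    modulus below 1.\<close>
  obtain A B C where T: "T = {A, B, C}" and D: "orient A B C > 0"
  proof -
    obtain A B C where T: "T = {A, B, C}" using assms unfolding triangle_def by (metis card_3_iff)
    then have "orient A B C \<noteq> 0"
      using assms by (simp add: triangle_def collinear_iff_orient)
    then consider "orient A B C > 0" | "orient A C B > 0"
      using orient_swap(1)[of A C B] by linarith
    then show ?thesis
    proof cases
      case 1 then show ?thesis using that T by blast
    next
      case 2
      moreover have "T = {A, C, B}" using T by auto
      ultimately show ?thesis using that by blast
    qed
  qed
  define num where "num = A + zeta * B + zeta\<^sup>2 * C"
  define den where "den = A + zeta\<^sup>2 * B + zeta * C"
  have "(cmod num)\<^sup>2 < (cmod den)\<^sup>2"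
  proof -
    have "2 * sqrt 3 * orient A B C > 0" using D by simp
    then show ?thesis using dft_norm_diff[of A B C] unfolding num_def den_def by linarith
  qed
  then have cmod_less: "cmod num < cmod den" by (rule power_less_imp_less_base) simp
  then have den: "den \<noteq> 0" by auto
  define g where "g = - num / den"
  define s where "s = cmod g"
  have s: "0 \<le> s" "s < 1" using cmod_less den by (simp_all add: s_def g_def norm_divide)
  \<comment> \<open>A rotation by \<open>a\<close> makes the complex parameter \<open>g\<close>
    real. For \<open>g = 0\<close> any unit would serve.\<close>
  define a where "a = (if g = 0 then 1 else g / of_real s)"
  have a: "cmod a = 1" by (simp add: a_def s_def norm_divide)
  have g: "of_real s * a = g" by (simp add: a_def s_def)
  define A' where "A' = A * (1 + g)"
  define B' where "B' = B * (1 + g * zeta)"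
  define C' where "C' = C * (1 + g * zeta\<^sup>2)"
  have dft: "A' + zeta * B' + zeta\<^sup>2 * C' = 0"
  proof -
    have "A' + zeta * B' + zeta\<^sup>2 * C' = num + g * (A + zeta\<^sup>2 * B + zeta ^ 4 * C)"
      by (simp add: A'_def B'_def C'_def num_def power2_eq_square power4_eq_xxxx algebra_simps)
    also have "\<dots> = 0" using den unfolding zeta_cube(4) den_def[symmetric] g_def by simp
    finally show ?thesis .
  qed
  define \<alpha> where "\<alpha> = (A' + zeta\<^sup>2 * B' + zeta * C') / 3"
  define \<beta> where "\<beta> = (A' + B' + C') / 3"
  have inv: "A' = \<alpha> + \<beta>" "B' = \<alpha> * zeta + \<beta>" "C' = \<alpha> * zeta\<^sup>2 + \<beta>"
  proof -
    have "3 * A' = 3 * (\<alpha> + \<beta>)" "3 * B' = 3 * (\<alpha> * zeta + \<beta>)" "3 * C' = 3 * (\<alpha> * zeta\<^sup>2 + \<beta>)"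
      unfolding distrib_left mult.assoc[symmetric] \<alpha>_def \<beta>_def using dft zeta_sum by (simp, algebra)+
    then show "A' = \<alpha> + \<beta>" "B' = \<alpha> * zeta + \<beta>" "C' = \<alpha> * zeta\<^sup>2 + \<beta>"
      by (metis mult_left_cancel zero_neq_numeral)+
  qed
  \<comment> \<open>\<open>p\<close> and \<open>q\<close> solve
    \<open>(p * s + q) * a = \<alpha>\<close> and \<open>p + q * s = \<beta>\<close>, obtained by
    writing \<open>pt p q s (z * a)\<close> as one fraction.\<close>
  define q where "q = (\<alpha> * cnj a - of_real s * \<beta>) / of_real (1 - s\<^sup>2)"
  define p where "p = \<beta> - q * of_real s"
  have c0: "of_real (1 - s\<^sup>2) \<noteq> (0 :: complex)"
    using s by (metis abs_square_less_1 abs_of_nonneg diff_gt_0_iff_gt less_irrefl of_real_eq_0_iff)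
  have "p * of_real s + q = \<alpha> * cnj a"
  proof -
    have "p * of_real s + q = \<beta> * of_real s + q * of_real (1 - s\<^sup>2)"
      by (simp add: p_def power2_eq_square algebra_simps)
    also have "q * of_real (1 - s\<^sup>2) = \<alpha> * cnj a - of_real s * \<beta>" unfolding q_def using c0 by simp
    finally show ?thesis by simp
  qed
  then have al: "(p * of_real s + q) * a = \<alpha>" using unit_cnj[OF a] by (simp add: mult_ac)
  have be: "p + q * of_real s = \<beta>" by (simp add: p_def)
  have pt: "pt p q s (z * a) = X" if "X * (1 + g * z) = \<alpha> * z + \<beta>" "cmod z = 1" for z X
  proof -
    have "cmod (g * z) < 1" using s that(2) by (simp add: norm_mult s_def)
    then have nz: "1 + g * z \<noteq> 0"
      by (metis add_eq_0_iff less_irrefl norm_minus_cancel norm_one)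
    have "pt p q s (z * a) = (p * (1 + g * z) + q * (z * a + of_real s)) / (1 + g * z)"
      using nz unfolding pt_def mob_def g[symmetric] by (simp add: field_simps)
    also have "p * (1 + g * z) + q * (z * a + of_real s) = (p * of_real s + q) * a * z + (p + q * of_real s)"
      unfolding g[symmetric] by (simp add: algebra_simps)
    also have "\<dots> = X * (1 + g * z)" unfolding al be that(1) ..
    finally show ?thesis using nz by simp
  qed
  have T': "T = tri p q s a"
    unfolding T tri_def
    using pt[of A 1] pt[of B zeta] pt[of C "zeta\<^sup>2"] inv
    by (simp add: A'_def B'_def C'_def zeta_simps norm_power)
  have "q \<noteq> 0"
  proof
    assume "q = 0"
    then have "T = {p}" unfolding T' tri_def pt_def by simp
    then show False using assms by (simp add: triangle_def)
  qed
  then have "moebius_triangle q s" using s by (simp add: moebius_triangle_def)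
  then show ?thesis using that a T' by blast
qed

context moebius_triangle
begin

text \<open>By \<open>dist_side\<close>, equal sides force equal values of \<open>W\<close> at the
  vertices. For \<open>s > 0\<close> the three unit points would have the same real part, which is
  impossible.\<close>

lemma equilateral_tri_iff:
  assumes a: "cmod a = 1"
  shows "equilateral (tri p q s a) \<longleftrightarrow> s = 0"
proof
  assume "s = 0"
  have W1: "W b = 1" for b unfolding W_def using \<open>s = 0\<close> by simp
  have "dist A B = sqrt 3 * cmod q" if AB: "A \<in> tri p q s a" "B \<in> tri p q s a" "A \<noteq> B" for A B
  proof -
    obtain b where b: "cmod b = 1" "A = pnt b \<and> B = pnt (zeta * b) \<or> B = pnt b \<and> A = pnt (zeta * b)"
      using tri_edges[OF a AB] .
    then have "(dist A B)\<^sup>2 = 3 * (cmod q)\<^sup>2"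
      using dist_side[OF b(1), unfolded W1] \<open>s = 0\<close> by (auto simp: dist_commute)
    then have "(dist A B)\<^sup>2 = (sqrt 3 * cmod q)\<^sup>2" by (simp add: power_mult_distrib)
    then show ?thesis by (rule power2_eq_imp_eq) simp_all
  qed
  then show "equilateral (tri p q s a)" unfolding equilateral_def by blast
next
  assume "equilateral (tri p q s a)"
  then obtain d where d: "\<forall>A\<in>tri p q s a. \<forall>B\<in>tri p q s a. A \<noteq> B \<longrightarrow> dist A B = d"
    unfolding equilateral_def ..
  let ?b = "zeta * a" and ?c = "zeta\<^sup>2 * a"
  have n: "cmod ?b = 1" "cmod ?c = 1" using a by simp_all
  have "dist (pnt a) (pnt ?b) = d" "dist (pnt ?b) (pnt ?c) = d" "dist (pnt ?c) (pnt a) = d"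
    using d unit_distinct[OF a] unfolding tri_def by blast+
  moreover have "zeta * ?b = ?c" by (simp add: power2_eq_square)
  moreover have "zeta * ?c = a" using zeta_cube(1) by (metis mult.assoc mult_1)
  ultimately have "d\<^sup>2 * (W a * W ?b) = d\<^sup>2 * (W ?b * W ?c)" "d\<^sup>2 * (W ?b * W ?c) = d\<^sup>2 * (W ?c * W a)"
    using dist_side[OF a] dist_side[OF n(1)] dist_side[OF n(2)] by metis+
  moreover have "d \<noteq> 0" using \<open>dist (pnt a) (pnt ?b) = d\<close> unit_distinct(1)[OF a] by auto
  ultimately have W: "W a = W ?c" "W ?b = W a"
    using W_pos[of a] W_pos[of ?b] W_pos[of ?c] a n by auto
  have Wex: "W b = 1 + s\<^sup>2 * (cmod b)\<^sup>2 + 2 * s * Re b" for b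
    unfolding W_def cmod_power2 by (simp add: power2_eq_square algebra_simps)
  show "s = 0"
  proof (rule ccontr)
    assume "s \<noteq> 0"
    then have "Re a = Re ?c" "Re ?b = Re a" using W a n unfolding Wex by simp_all
    then have "Re a = 0" "sqrt 3 * Im a = 0" unfolding times_complex.sel zeta_simps by linarith+
    then have "a = 0" by (simp add: complex_eq_iff)
    then show False using a by simp
  qed
qed

end

subsection \<open>The sequence of porisms\<close>

text \<open>The representative \<open>a = 1\<close> is arbitrary: by \<open>porism_of_tri\<close>
  every unit gives the same porism.\<close>

definition tri_porism :: "complex \<Rightarrow> complex \<Rightarrow> real \<Rightarrow> porism" where
  "tri_porism p q s = porism_of (tri p q s 1)"

locale moebius_porism = moebius_triangle +
  assumes s0: "s > 0"
begin

lemma tri_porism_eq: "tri_porism p q s = (sphere p (cmod q), E)"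
  by (simp add: tri_porism_def porism_of_tri)

lemma porism_attributes:
  "porism_circumradius (tri_porism p q s) = cmod q"
  "porism_eccentricity (tri_porism p q s) = sqrt 3 * s / sqrt N"
  "porism_brocard_angle (tri_porism p q s) = omega"
  "porism_brocard_circle (tri_porism p q s) = sphere (p + q * of_real rho) (cmod q * rho)"
  "porism_isodynamic_points (tri_porism p q s) = {p + q * of_real s, p + q / of_real s}"
  "porism_X15 (tri_porism p q s) = p + q * of_real s"
  "porism_X16 (tri_porism p q s) = p + q / of_real s"
  unfolding tri_porism_eq using q s0
  by (simp_all add: porism_attribute_tri eccentricity_E brocard_tri brocard_circle_tri
      isodynamic_points_tri isodynamic_tri)

lemma nonequilateral_tri_porism: "nonequilateral_brocard_porism (tri_porism p q s)"
proof -
  have "brocard_porism (tri_porism p q s)"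
    using triangle_tri[of 1] by (auto simp: brocard_porism_def tri_porism_def)
  moreover have "\<not> equilateral T" if "T \<in> three_periodics (tri_porism p q s)" for T
    using that s0 unfolding tri_porism_eq three_periodics_tri by (auto simp: equilateral_tri_iff)
  ultimately show ?thesis by (simp add: nonequilateral_brocard_porism_def)
qed

lemma next_moebius_porism: "moebius_porism (q * of_real rho) (s\<^sup>2)"
proof -
  have "rho > 0" using s0 by (rule brocard_circle_tri(2)[of 1, simplified])
  then show ?thesis using q s0 s2 by unfold_locales simp_all
qed

lemma second_brocard_successor_tri_porism:
  "second_brocard_successor (tri_porism p q s)
     (tri_porism (p + q * of_real rho) (q * of_real rho) (s\<^sup>2))"
proof -
  interpret succ: moebius_porism "p + q * of_real rho" "q * of_real rho" "s\<^sup>2"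
    by (rule next_moebius_porism)
  show ?thesis
    unfolding second_brocard_successor_def
  proof
    fix T assume "T \<in> three_periodics (tri_porism p q s)"
    then obtain a where a: "cmod a = 1" and T: "T = tri p q s a"
      unfolding tri_porism_eq three_periodics_tri by auto
    define T' where "T' = tri (p + q * of_real rho) (q * of_real rho) (s\<^sup>2) (- a\<^sup>2)"
    have n: "cmod (- a\<^sup>2) = 1" using a by (simp add: norm_power)
    have sb: "second_brocard_triangle T = T'"
      unfolding T T'_def by (rule second_brocard_triangle_tri[OF a s0])
    show "triangle (second_brocard_triangle T) \<and>
        porism_of (second_brocard_triangle T) = tri_porism (p + q * of_real rho) (q * of_real rho) (s\<^sup>2) \<and>
        second_brocard_triangle T \<in> three_periodics (tri_porism (p + q * of_real rho) (q * of_real rho) (s\<^sup>2))"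
      unfolding sb T'_def succ.tri_porism_eq succ.three_periodics_tri
      using succ.triangle_tri[OF n] succ.porism_of_tri[OF n] n by auto
  qed
qed

text \<open>The new Brocard circle passes through the center of the old one, and its diameter is
  \<open>2 * succ.rho < 1\<close> times the old radius.\<close>

lemma brocard_circle_nested:
  "porism_brocard_circle (tri_porism (p + q * of_real rho) (q * of_real rho) (s\<^sup>2)) \<subseteq>
    cball (circle_center (porism_brocard_circle (tri_porism p q s)))
      (circle_radius (porism_brocard_circle (tri_porism p q s)))"
proof -
  interpret succ: moebius_porism "p + q * of_real rho" "q * of_real rho" "s\<^sup>2"
    by (rule next_moebius_porism)
  have rho: "rho > 0" "succ.rho > 0" "succ.rho < 1 / 2"
    using brocard_circle_tri(2)[of 1] succ.brocard_circle_tri(2,3)[of 1] s0 succ.s0 by simp_all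
  define R where "R = cmod q * rho"
  have R: "R > 0" using q rho by (simp add: R_def)
  have "dist (p + q * of_real rho) x \<le> R"
    if x: "dist (p + q * of_real rho + q * of_real rho * of_real succ.rho) x = R * succ.rho" for x
  proof -
    have "dist (p + q * of_real rho) x \<le>
        dist (p + q * of_real rho) (p + q * of_real rho + q * of_real rho * of_real succ.rho) + R * succ.rho"
      using dist_triangle x by metis
    also have "\<dots> = R * (2 * succ.rho)"
      using rho by (simp add: dist_norm norm_mult R_def)
    also have "\<dots> \<le> R * 1" using R rho by (intro mult_left_mono) simp_all
    finally show ?thesis by simp
  qed
  moreover have "cmod (q * of_real rho) = R" using rho by (simp add: norm_mult R_def)
  ultimately show ?thesis
    unfolding porism_attributes succ.porism_attributes using R
    by (auto simp flip: R_def)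
qed

text \<open>The factor 1/2 gives the geometric rate needed for convergence to a point; strict
  decrease follows as \<open>q\<close> is nonzero.\<close>

lemma circumradius_decreases: "cmod (q * of_real rho) \<le> cmod q / 2"
proof -
  have "rho > 0" "rho < 1 / 2" using brocard_circle_tri(2,3)[of 1] s0 by simp_all
  then have "cmod q * rho \<le> cmod q * (1 / 2)" by (intro mult_left_mono) simp_all
  then show ?thesis using \<open>rho > 0\<close> by (simp add: norm_mult)
qed

text \<open>The detour over \<open>p\<close> and \<open>Om1\<close> costs at most three circumradii;
  4 is a coarse bound.\<close>

lemma porism_near_X15:
  assumes "P \<in> fst (tri_porism p q s) \<union> snd (tri_porism p q s)"
  shows "dist (p + q * of_real s) P \<le> 4 * cmod q"
proof -
  have X15: "dist (p + q * of_real s) p \<le> cmod q"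
    using s by (simp add: dist_norm norm_mult mult_left_le)
  show ?thesis
  proof (cases "P \<in> sphere p (cmod q)")
    case True
    then have "dist (p + q * of_real s) P \<le> 2 * cmod q"
      using X15 dist_triangle[of "p + q * of_real s" P p] by simp
    then show ?thesis using zero_le_dist[of "p + q * of_real s" P] by linarith
  next
    case False
    then have "P \<in> E" using assms by (simp add: tri_porism_eq)
    then have P: "dist P Om1 \<le> 2 * semi" unfolding E_def ellipse_def using zero_le_dist[of P Om2] by (simp del: zero_le_dist)
    have "4 * semi\<^sup>2 \<le> (cmod q)\<^sup>2"
    proof -
      have "1 \<le> N" by (simp add: N_def)
      moreover have "(1 - s\<^sup>2)\<^sup>2 \<le> 1" using s2 by (simp add: power_le_one)
      ultimately have "(cmod q)\<^sup>2 * (1 - s\<^sup>2)\<^sup>2 \<le> (cmod q)\<^sup>2 * N" by (intro mult_left_mono) simp_all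
      then show ?thesis unfolding semi using N_pos by (simp add: divide_le_eq)
    qed
    then have "2 * semi \<le> cmod q"
      by (intro power2_le_imp_le[of "2 * semi"]) (simp_all add: power_mult_distrib)
    moreover have "dist p Om1 \<le> cmod q"
    proof -
      have "convex hull tri p q s 1 \<subseteq> cball p (cmod q)"
        using tri_subset_circle[of 1] by (intro hull_minimal) auto
      then have "Om1 \<in> cball p (cmod q)"
        using Om_interior(1)[of 1] interior_subset[of "convex hull tri p q s 1"] norm_one by blast
      then show ?thesis by (simp only: mem_cball)
    qed
    ultimately show ?thesis
      using X15 P dist_triangle[of "p + q * of_real s" P p] dist_triangle[of p P Om1]
        dist_commute[of P Om1] zero_le_dist[of "p + q * of_real s" P] by linarith
  qed
qed

end

text \<open>After squaring and cross-multiplying, the difference is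
  \<open>(s^2 - t^2) * (1 - (s * t)^2)\<close>.\<close>

lemma eccentricity_strict_mono:
  fixes s t :: real
  assumes "0 < t" "t < s" "s < 1"
  shows "sqrt 3 * t / sqrt (1 + t\<^sup>2 + t ^ 4) < sqrt 3 * s / sqrt (1 + s\<^sup>2 + s ^ 4)"
proof -
  have "s * t < 1 * 1" using assms by (intro mult_strict_mono) simp_all
  then have "(s * t)\<^sup>2 < 1" using assms by (simp add: power_less_one_iff)
  then have "0 < (s\<^sup>2 - t\<^sup>2) * (1 - (s * t)\<^sup>2)"
    using assms by (intro mult_pos_pos) (simp_all add: power_strict_mono)
  also have "\<dots> = s\<^sup>2 * (1 + t\<^sup>2 + t ^ 4) - t\<^sup>2 * (1 + s\<^sup>2 + s ^ 4)"
    by (simp add: power_mult_distrib algebra_simps power2_eq_square power4_eq_xxxx)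
  finally have *: "t\<^sup>2 * (1 + s\<^sup>2 + s ^ 4) < s\<^sup>2 * (1 + t\<^sup>2 + t ^ 4)" by simp
  have pos: "1 + x\<^sup>2 + x ^ 4 > 0" for x :: real
    by (smt (verit) zero_le_power2 zero_le_even_power even_numeral)
  have "t / sqrt (1 + t\<^sup>2 + t ^ 4) < s / sqrt (1 + s\<^sup>2 + s ^ 4)"
  proof (rule power2_less_imp_less)
    show "(t / sqrt (1 + t\<^sup>2 + t ^ 4))\<^sup>2 < (s / sqrt (1 + s\<^sup>2 + s ^ 4))\<^sup>2"
      using * pos[of s] pos[of t] by (simp add: power_divide divide_less_eq mult.commute less_divide_eq less_imp_le)
  qed (use assms pos[of s] in \<open>simp add: less_imp_le\<close>)
  then show ?thesis unfolding times_divide_eq_right[symmetric] by (rule mult_strict_left_mono) simp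
qed

lemma brocard_cotangent_strict_mono:
  fixes s t :: real
  assumes "0 < t" "t < s" "s < 1"
  shows "sqrt 3 * (1 + t\<^sup>2) / (1 - t\<^sup>2) < sqrt 3 * (1 + s\<^sup>2) / (1 - s\<^sup>2)"
proof -
  have "t\<^sup>2 < s\<^sup>2" using assms by (simp add: power_strict_mono)
  moreover have "s\<^sup>2 < 1" using assms by (simp add: power_less_one_iff)
  ultimately have "(1 + t\<^sup>2) / (1 - t\<^sup>2) < (1 + s\<^sup>2) / (1 - s\<^sup>2)"
    by (simp add: field_simps)
  then show ?thesis unfolding times_divide_eq_right[symmetric] by (rule mult_strict_left_mono) simp
qed

text \<open>The recursion runs on parameters because the successor of a porism is only a
  relation.\<close>

primrec porism_params :: "complex \<Rightarrow> complex \<Rightarrow> real \<Rightarrow> nat \<Rightarrow> complex \<times> complex \<times> real" where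
  "porism_params p q s 0 = (p, q, s)"
| "porism_params p q s (Suc n) =
    (case porism_params p q s n of (p', q', s') \<Rightarrow>
      (let r = of_real (s' / (1 + s'\<^sup>2)) in (p' + q' * r, q' * r, s'\<^sup>2)))"

theorem theorem2:
  fixes \<B>\<^sub>0 :: porism
  assumes "nonequilateral_brocard_porism \<B>\<^sub>0"
  shows "\<exists>\<B> :: nat \<Rightarrow> porism.
    \<B> 0 = \<B>\<^sub>0 \<and>
    (\<forall>n. nonequilateral_brocard_porism (\<B> n)) \<and>
    (\<forall>n. second_brocard_successor (\<B> n) (\<B> (Suc n))) \<and>
    (\<forall>n. porism_isodynamic_points (\<B> n) = {porism_X15 \<B>\<^sub>0, porism_X16 \<B>\<^sub>0} \<and>
         porism_X15 (\<B> n) = porism_X15 \<B>\<^sub>0 \<and>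
         porism_X16 (\<B> n) = porism_X16 \<B>\<^sub>0) \<and>
    (\<forall>n. porism_brocard_circle (\<B> (Suc n)) \<subseteq>
         cball (circle_center (porism_brocard_circle (\<B> n)))
               (circle_radius (porism_brocard_circle (\<B> n)))) \<and>
    (\<forall>n. porism_circumradius (\<B> (Suc n)) < porism_circumradius (\<B> n)) \<and>
    (\<forall>n. porism_eccentricity (\<B> (Suc n)) < porism_eccentricity (\<B> n)) \<and>
    strict_mono (\<lambda>n. porism_brocard_angle (\<B> n)) \<and>
    (\<lambda>n. porism_brocard_angle (\<B> n)) \<longlonglongrightarrow> pi / 6 \<and>
    (\<forall>\<epsilon>>0. \<forall>\<^sub>F n in sequentially.
         fst (\<B> n) \<subseteq> ball (porism_X15 \<B>\<^sub>0) \<epsilon> \<and> snd (\<B> n) \<subseteq> ball (porism_X15 \<B>\<^sub>0) \<epsilon>)"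
proof -
  obtain T where T: "triangle T" "\<B>\<^sub>0 = porism_of T"
    using assms by (auto simp: nonequilateral_brocard_porism_def brocard_porism_def)
  obtain p q s a where ps: "moebius_triangle q s" and a: "cmod a = 1" and Ta: "T = tri p q s a"
    using moebius_normal_form[OF T(1)] .
  interpret m: moebius_triangle p q s by (rule ps)
  have B0: "\<B>\<^sub>0 = (sphere p (cmod q), m.E)" using m.porism_of_tri[OF a] T(2) Ta by simp
  \<comment> \<open>The assumption speaks of 3-periodics, so \<open>T\<close> must be recognised as
    one before \<open>s = 0\<close> can be refuted.\<close>
  then have "T \<in> three_periodics \<B>\<^sub>0" using a by (simp add: m.three_periodics_tri Ta)
  then have "s \<noteq> 0" using assms m.equilateral_tri_iff[OF a]
    by (auto simp: nonequilateral_brocard_porism_def Ta)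
  then have mp: "moebius_porism q s"
    using ps m.s by (simp add: moebius_porism_def moebius_porism_axioms_def)
  define P where "P n = fst (porism_params p q s n)" for n
  define Q where "Q n = fst (snd (porism_params p q s n))" for n
  define S where "S n = snd (snd (porism_params p q s n))" for n
  define r where "r n = S n / (1 + (S n)\<^sup>2)" for n
  have init: "P 0 = p" "Q 0 = q" "S 0 = s" by (simp_all add: P_def Q_def S_def)
  have step: "P (Suc n) = P n + Q n * of_real (r n)" "Q (Suc n) = Q n * of_real (r n)"
    "S (Suc n) = (S n)\<^sup>2" for n
    by (simp_all add: P_def Q_def S_def r_def Let_def split: prod.split)
  have rho: "moebius_triangle.rho (S n) = r n" if "moebius_porism (Q n) (S n)" for n
  proof -
    interpret moebius_porism "P n" "Q n" "S n" by (rule that)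
    show ?thesis by (simp add: rho_def r_def)
  qed
  have mpn: "moebius_porism (Q n) (S n)" for n
  proof (induction n)
    case (Suc n)
    interpret moebius_porism "P n" "Q n" "S n" by (rule Suc)
    show ?case using next_moebius_porism by (simp only: step rho[OF Suc])
  qed (simp add: init mp)
  define B where "B n = tri_porism (P n) (Q n) (S n)" for n
  have S: "0 < S n" "S n < 1" for n
    using mpn[of n] by (simp_all add: moebius_porism_def moebius_porism_axioms_def moebius_triangle_def)
  \<comment> \<open>This one identity keeps both isodynamic points fixed.\<close>
  have rS: "r n * (1 + (S n)\<^sup>2) = S n" for n
    using S(1)[of n] by (simp add: r_def add_pos_nonneg less_imp_neq[THEN not_sym])
  have X15: "P n + Q n * of_real (S n) = p + q * of_real s" for n
  proof (induction n)
    case (Suc n)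
    have "P (Suc n) + Q (Suc n) * of_real (S (Suc n)) = P n + Q n * of_real (r n * (1 + (S n)\<^sup>2))"
      by (simp add: step algebra_simps)
    then show ?case unfolding rS Suc .
  qed (simp add: init)
  have X16: "P n + Q n / of_real (S n) = p + q / of_real s" for n
  proof (induction n)
    case (Suc n)
    have "P (Suc n) + Q (Suc n) / of_real (S (Suc n)) =
        P n + Q n * of_real (r n * (1 + (S n)\<^sup>2)) / of_real ((S n)\<^sup>2)"
      using S(1)[of n] by (simp add: step field_simps)
    also have "\<dots> = P n + Q n / of_real (S n)"
      unfolding rS using S(1)[of n] by (simp add: power2_eq_square)
    finally show ?case unfolding Suc .
  qed (simp add: init)
  note attr = moebius_porism.porism_attributes[where p = "P n" and q = "Q n" and s = "S n" for n,
      OF mpn, folded B_def, unfolded X15 X16]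
  have next_B: "tri_porism (P n + Q n * of_real (moebius_triangle.rho (S n)))
      (Q n * of_real (moebius_triangle.rho (S n))) ((S n)\<^sup>2) = B (Suc n)" for n
    by (simp add: B_def step rho[OF mpn])
  have "\<B>\<^sub>0 = B 0"
    using moebius_porism.tri_porism_eq[OF mp, of p] by (simp add: B_def init B0)
  have S_less: "S (Suc n) < S n" for n
    using S[of n] by (simp add: step power2_eq_square)
  have Q_le: "cmod (Q (Suc n)) \<le> cmod (Q n) / 2" for n
    using moebius_porism.circumradius_decreases[OF mpn, of n] by (simp add: step rho[OF mpn])
  have Q0: "cmod (Q n) > 0" for n
    using mpn[of n] by (simp add: moebius_porism_def moebius_triangle_def)
  have angle: "porism_brocard_angle (B n) = pi / 2 - arctan (sqrt 3 * (1 + (S n)\<^sup>2) / (1 - (S n)\<^sup>2))" for n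
    unfolding attr(3) moebius_triangle.omega_def[OF mpn[of n, THEN moebius_porism.axioms(1)]] ..
  have S_lim: "S \<longlonglongrightarrow> 0"
  proof (rule tendsto_sandwich)
    \<comment> \<open>Exactly, \<open>S n\<close> is \<open>s\<close> to the power
      \<open>2 ^ n\<close>; the linear exponent survives squaring because
      \<open>2 * (n + 1) >= n + 2\<close>.\<close>
    have "S n \<le> s ^ Suc n" for n
    proof (induction n)
      case (Suc n)
      have "S (Suc n) \<le> (s ^ Suc n)\<^sup>2"
        unfolding step using Suc S(1)[of n] by (intro power_mono) simp_all
      also have "\<dots> \<le> s ^ Suc (Suc n)"
        unfolding power_mult[symmetric] using m.s by (intro power_decreasing) simp_all
      finally show ?case .
    qed (simp add: init)
    then show "\<forall>\<^sub>F n in sequentially. S n \<le> s ^ Suc n" by simp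
    show "\<forall>\<^sub>F n in sequentially. 0 \<le> S n" using S(1) by (simp add: less_imp_le)
    show "(\<lambda>n. s ^ Suc n) \<longlonglongrightarrow> 0"
      using m.s by (intro LIMSEQ_Suc LIMSEQ_realpow_zero)
  qed simp
  have angle_lim: "(\<lambda>n. porism_brocard_angle (B n)) \<longlonglongrightarrow> pi / 6"
  proof -
    have "(\<lambda>n. pi / 2 - arctan (sqrt 3 * (1 + (S n)\<^sup>2) / (1 - (S n)\<^sup>2)))
        \<longlonglongrightarrow> pi / 2 - arctan (sqrt 3 * (1 + 0\<^sup>2) / (1 - 0\<^sup>2))"
      by (intro tendsto_intros S_lim) simp
    moreover have "arctan (sqrt 3) = pi / 3"
      using arctan_tan[of "pi / 3"] by (simp add: tan_60)
    ultimately show ?thesis by (simp add: angle)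
  qed
  have shrink: "\<forall>\<^sub>F n in sequentially. fst (B n) \<subseteq> ball (porism_X15 (B 0)) \<epsilon> \<and>
      snd (B n) \<subseteq> ball (porism_X15 (B 0)) \<epsilon>" if "\<epsilon> > 0" for \<epsilon>
  proof -
    have Q_pow: "cmod (Q n) \<le> cmod q * (1 / 2) ^ n" for n
    proof (induction n)
      case (Suc n)
      then show ?case using Q_le[of n] by simp
    qed (simp add: init)
    have "(\<lambda>n. 4 * (cmod q * (1 / 2) ^ n)) \<longlonglongrightarrow> 4 * (cmod q * 0)"
      by (intro tendsto_intros LIMSEQ_realpow_zero) simp_all
    then have "\<forall>\<^sub>F n in sequentially. 4 * (cmod q * (1 / 2) ^ n) < \<epsilon>"
      using that by (intro order_tendstoD(2)) simp_all
    then show ?thesis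
    proof eventually_elim
      case (elim n)
      have "dist (porism_X15 (B 0)) x < \<epsilon>" if "x \<in> fst (B n) \<union> snd (B n)" for x
        using moebius_porism.porism_near_X15[OF mpn that[unfolded B_def]] Q_pow[of n] elim
        unfolding attr(6) X15 by linarith
      then show ?case by auto
    qed
  qed
  show ?thesis
    unfolding \<open>\<B>\<^sub>0 = B 0\<close>
  proof (intro exI[of _ B] conjI allI impI)
    fix n
    show "nonequilateral_brocard_porism (B n)"
      unfolding B_def by (rule moebius_porism.nonequilateral_tri_porism[OF mpn])
    show "second_brocard_successor (B n) (B (Suc n))"
      using moebius_porism.second_brocard_successor_tri_porism[OF mpn, of "P n" n]
      unfolding next_B B_def[symmetric] .
    show "porism_isodynamic_points (B n) = {porism_X15 (B 0), porism_X16 (B 0)}"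
      "porism_X15 (B n) = porism_X15 (B 0)" "porism_X16 (B n) = porism_X16 (B 0)"
      by (simp_all add: attr)
    show "porism_brocard_circle (B (Suc n)) \<subseteq> cball (circle_center (porism_brocard_circle (B n)))
        (circle_radius (porism_brocard_circle (B n)))"
      using moebius_porism.brocard_circle_nested[OF mpn, of "P n" n] unfolding next_B B_def[symmetric] .
    show "porism_circumradius (B (Suc n)) < porism_circumradius (B n)"
      unfolding attr(1) using Q_le[of n] Q0[of n] by linarith
    show "porism_eccentricity (B (Suc n)) < porism_eccentricity (B n)"
      unfolding attr(2) moebius_triangle.N_def[OF mpn[THEN moebius_porism.axioms(1)]]
      by (rule eccentricity_strict_mono[OF S(1) S_less S(2)])
  next
    show "strict_mono (\<lambda>n. porism_brocard_angle (B n))"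
      unfolding strict_mono_Suc_iff angle
      using brocard_cotangent_strict_mono[OF S(1) S_less S(2)] by (simp add: arctan_less_iff)
  qed (use angle_lim shrink in auto)
qed


end
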